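(* Take $\mu_n=\pi_n$, $c_n=r_n$, and choose $a_n$ such that $a_n\sim b_n$. Given any $0<\beta<\infty$, if $r_n$ is a short space scale that satisfies $\frac{1}{\beta n}\log r_n\ge 4\sqrt{\frac{\log n}{n}}$, then, $\mathbb P$-almost surely, $$S_n(\cdot)\Rightarrow S^{short}(\cdot),$$ where $S^{short}$ is the degenerate subordinator of Lévy measure $\nu^{short}=\delta_\infty$ ($\delta_\infty$ being the Dirac point mass at infinity).
   Context: Landscape. Let $\mathcal V_n=\{-1,1\}^n$ and let $\mathcal E_n$ be the edge set of the hypercube. Fix $\beta>0$. Let $(H_n(x),x\in\mathcal V_n)$ be i.i.d. standard Gaussian random variables and $\tau_n(x)=\exp(-\beta\sqrt n\,H_n(x))$. The sequence $(\tau_n(x),x\in\mathcal V_n)$, $n\ge1$, is defined on a common probability space $(\Omega^\tau,\mathcal F^\tau,\mathbb P)$. Dynamics. For fixed landscape, let $(J_n(k),k\in\mathbb N)$, $\mathbb N=\{0,1,2,\dots\}$, be simple random walk on $\mathcal V_n$ (transition probabilities $1/n$ along each edge in $\mathcal E_n$) with initial distribution $\mu_n$. Let $(e_{n,i})$ be i.i.d. mean one exponential random variables independent of $J_n$. The clock process is $\widetilde S_n(k)=\sum_{i=0}^k\tau_n(J_n(i))e_{n,i}$, and for sequences $c_n$ (time scale) and $a_n$ (auxiliary time scale) the re-scaled clock process is $S_n(t)=c_n^{-1}\widetilde S_n(\lfloor a_nt\rfloor)$, $t\ge0$. Set $\pi_n(x)=2^{-n}$, $x\in\mathcal V_n$.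 The arrow $\Rightarrow$ denotes weak convergence (of the law of the dynamics, for fixed landscape) in the space $D([0,\infty))$ of càdlàg functions on $[0,\infty)$ equipped with the Skorohod $J_1$-topology. The limit $S^{short}$ is a degenerate stable subordinator of index $0$; in the paper's words it is degenerate in the sense that its range reduces to the single point $0$. Scales. Given a diverging sequence $r_n$, let $b_n$ be defined by $b_n\mathbb P(\tau_n(x)\ge r_n)=1$ and $m_n=\log b_n/\log2$. The sequence $r_n$ is a short space scale if $m_n$ is a diverging sequence with $m_n/n=o(1)$. Here $u_n\sim v_n$ means $u_n/v_n\to1$. *)

theory Defs
  imports "HOL-Probability.Probability"
begin

subsection \<open>The landscape\<close>

definition hypercube :: "nat \<Rightarrow> (nat \<Rightarrow> int) set" where
  "hypercube n = {..<n} \<rightarrow>\<^sub>E {-1, 1}"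

definition hypercube_edges :: "nat \<Rightarrow> (nat \<Rightarrow> int) set set" where
  "hypercube_edges n =
     {{x, y} |x y. x \<in> hypercube n \<and> y \<in> hypercube n \<and> card {i. i < n \<and> x i \<noteq> y i} = 1}"

text \<open>
  Nothing is assumed about the joint law of the landscapes at different \<open>n\<close>; they only live on
  a common probability space.
\<close>

definition gaussian_landscape ::
    "'w measure \<Rightarrow> (nat \<Rightarrow> (nat \<Rightarrow> int) \<Rightarrow> 'w \<Rightarrow> real) \<Rightarrow> bool" where
  "gaussian_landscape P H \<longleftrightarrow> prob_space P \<and>
     (\<forall>n\<ge>1. prob_space.indep_vars P (\<lambda>_. borel) (H n) (hypercube n) \<and>
            (\<forall>x\<in>hypercube n. distributed P lborel (H n x) std_normal_density))"

definition trap_depth ::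
    "real \<Rightarrow> (nat \<Rightarrow> (nat \<Rightarrow> int) \<Rightarrow> 'w \<Rightarrow> real) \<Rightarrow> nat \<Rightarrow> 'w \<Rightarrow> (nat \<Rightarrow> int) \<Rightarrow> real" where
  "trap_depth \<beta> H n \<omega> x = exp (- \<beta> * sqrt (real n) * H n x \<omega>)"


subsection \<open>The dynamics\<close>

definition srw_transition :: "nat \<Rightarrow> (nat \<Rightarrow> int) \<Rightarrow> (nat \<Rightarrow> int) \<Rightarrow> real" where
  "srw_transition n x y = (if {x, y} \<in> hypercube_edges n then 1 / real n else 0)"

definition simple_random_walk ::
    "nat \<Rightarrow> ((nat \<Rightarrow> int) \<Rightarrow> real) \<Rightarrow> 's measure \<Rightarrow> (nat \<Rightarrow> 's \<Rightarrow> (nat \<Rightarrow> int)) \<Rightarrow> bool" where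
  "simple_random_walk n \<mu> M J \<longleftrightarrow>
     (\<forall>k. J k \<in> M \<rightarrow>\<^sub>M count_space (hypercube n)) \<and>
     (\<forall>k. \<forall>x \<in> {..k} \<rightarrow> hypercube n.
        measure M {w \<in> space M. \<forall>i\<le>k. J i w = x i} =
          \<mu> (x 0) * (\<Prod>i<k. srw_transition n (x i) (x (Suc i))))"

definition hypercube_uniform :: "nat \<Rightarrow> (nat \<Rightarrow> int) \<Rightarrow> real" where
  "hypercube_uniform n x = 1 / 2 ^ n"

text \<open>
  The law of \<open>(J, e)\<close> does not depend on the landscape, so the dynamics is put on a probability
  space of its own; fixing the landscape means fixing \<open>\<omega>\<close> in \<open>trap_depth \<beta> H n \<omega>\<close>.
  Independence of \<open>J\<close> and \<open>e\<close> is stated through the generated sigma-algebras because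
  \<open>indep_var\<close> requires both variables to have the same range type.
\<close>

definition hopping_dynamics ::
    "nat \<Rightarrow> ((nat \<Rightarrow> int) \<Rightarrow> real) \<Rightarrow> 's measure \<Rightarrow> (nat \<Rightarrow> 's \<Rightarrow> (nat \<Rightarrow> int)) \<Rightarrow>
     (nat \<Rightarrow> 's \<Rightarrow> real) \<Rightarrow> bool" where
  "hopping_dynamics n \<mu> M J e \<longleftrightarrow> prob_space M \<and> simple_random_walk n \<mu> M J \<and>
     prob_space.indep_vars M (\<lambda>_. borel) e UNIV \<and>
     (\<forall>i. distributed M lborel (e i) (exponential_density 1)) \<and>
     prob_space.indep_set M
       (sets (vimage_algebra (space M) (\<lambda>w i. J i w) (PiM UNIV (\<lambda>_. count_space (hypercube n)))))
       (sets (vimage_algebra (space M) (\<lambda>w i. e i w) (PiM UNIV (\<lambda>_. borel))))"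

definition clock_process ::
    "((nat \<Rightarrow> int) \<Rightarrow> real) \<Rightarrow> (nat \<Rightarrow> 's \<Rightarrow> (nat \<Rightarrow> int)) \<Rightarrow> (nat \<Rightarrow> 's \<Rightarrow> real) \<Rightarrow> nat \<Rightarrow> 's \<Rightarrow> real"
  where "clock_process \<tau> J e k w = (\<Sum>i\<le>k. \<tau> (J i w) * e i w)"

text \<open>
  The rescaled clock process as a random path. Paths are functions on \<open>[0,\<infinity>)\<close>, encoded as
  \<open>extensional\<close> functions, with values in \<open>[0,\<infinity>]\<close>: a subordinator whose L\'evy measure
  charges \<open>\<infinity>\<close> jumps to \<open>\<infinity>\<close>.
\<close>

definition rescaled_clock ::
    "real \<Rightarrow> real \<Rightarrow> ((nat \<Rightarrow> int) \<Rightarrow> real) \<Rightarrow> (nat \<Rightarrow> 's \<Rightarrow> (nat \<Rightarrow> int)) \<Rightarrow> (nat \<Rightarrow> 's \<Rightarrow> real) \<Rightarrow>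
     's \<Rightarrow> real \<Rightarrow> ennreal" where
  "rescaled_clock c a \<tau> J e w =
     (\<lambda>t\<in>{0..}. ennreal (inverse c * clock_process \<tau> J e (nat \<lfloor>a * t\<rfloor>) w))"


subsection \<open>Space scales\<close>

definition short_space_scale :: "(nat \<Rightarrow> real) \<Rightarrow> (nat \<Rightarrow> real) \<Rightarrow> bool" where
  "short_space_scale r b \<longleftrightarrow>
     filterlim r at_top sequentially \<and>
     filterlim (\<lambda>n. ln (b n) / ln 2) at_top sequentially \<and>
     (\<lambda>n. (ln (b n) / ln 2) / real n) \<longlonglongrightarrow> 0"


subsection \<open>The Skorohod space and weak convergence\<close>

text \<open>
  The function \<open>u \<mapsto> exp (- u)\<close> on \<open>[0,\<infinity>]\<close>, with \<open>exp (- \<infinity>) = 0\<close>. It is a homeomorphism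
  onto \<open>[0,1]\<close>, so \<open>ext_dist\<close> is a metric for the usual topology of the compact half-line.
\<close>

definition exp_neg :: "ennreal \<Rightarrow> real" where
  "exp_neg u = (if u = \<infinity> then 0 else exp (- enn2real u))"

definition ext_dist :: "ennreal \<Rightarrow> ennreal \<Rightarrow> real" where
  "ext_dist u v = \<bar>exp_neg u - exp_neg v\<bar>"

definition cadlag :: "(real \<Rightarrow> ennreal) set" where
  "cadlag = {x \<in> {0..} \<rightarrow>\<^sub>E UNIV.
     (\<forall>t\<ge>0. (x \<longlongrightarrow> x t) (at_right t)) \<and> (\<forall>t>0. \<exists>l. (x \<longlongrightarrow> l) (at_left t))}"

definition time_changes :: "(real \<Rightarrow> real) set" where
  "time_changes = {h. strict_mono_on {0..} h \<and> bij_betw h {0..} {0..}}"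

text \<open>
  The paths \<open>y\<close> that agree with \<open>x\<close> on \<open>[0,T]\<close> up to \<open>\<epsilon>\<close>, after a change of time that
  displaces points by less than \<open>\<epsilon>\<close>. A sequence \<open>y\<^sub>k\<close> converges to \<open>x\<close> in the Skorohod
  \<open>J\<^sub>1\<close>-topology on \<open>[0,\<infinity>)\<close> iff it is eventually in \<open>J1_nbhd x T \<epsilon>\<close> for all \<open>T, \<epsilon> > 0\<close>
  (Ethier and Kurtz, Markov Processes, Proposition 3.5.3 (c)); as \<open>J\<^sub>1\<close> is metrizable, this
  determines it.
\<close>

definition J1_nbhd :: "(real \<Rightarrow> ennreal) \<Rightarrow> real \<Rightarrow> real \<Rightarrow> (real \<Rightarrow> ennreal) set" where
  "J1_nbhd x T \<epsilon> =
     {y \<in> cadlag. \<exists>h\<in>time_changes. \<forall>t\<in>{0..T}. \<bar>h t - t\<bar> < \<epsilon> \<and> ext_dist (y t) (x (h t)) < \<epsilon>}"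

definition skorohod_J1 :: "(real \<Rightarrow> ennreal) topology" where
  "skorohod_J1 =
     topology (\<lambda>U. U \<subseteq> cadlag \<and> (\<forall>x\<in>U. \<exists>T>0. \<exists>\<epsilon>>0. J1_nbhd x T \<epsilon> \<subseteq> U))"

lemma J1_nbhd_mono: "T \<le> T' \<Longrightarrow> \<epsilon>' \<le> \<epsilon> \<Longrightarrow> J1_nbhd x T' \<epsilon>' \<subseteq> J1_nbhd x T \<epsilon>"
  unfolding J1_nbhd_def by (auto simp: Ball_def) (meson order_trans less_le_trans)

lemma openin_skorohod_J1:
  "openin skorohod_J1 U \<longleftrightarrow>
     U \<subseteq> cadlag \<and> (\<forall>x\<in>U. \<exists>T>0. \<exists>\<epsilon>>0. J1_nbhd x T \<epsilon> \<subseteq> U)"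
proof -
  let ?L = "\<lambda>U. U \<subseteq> cadlag \<and> (\<forall>x\<in>U. \<exists>T>0. \<exists>\<epsilon>>0. J1_nbhd x T \<epsilon> \<subseteq> U)"
  have "istopology ?L"
    unfolding istopology_def
  proof (intro conjI allI impI)
    fix U V assume U: "?L U" and V: "?L V"
    show "U \<inter> V \<subseteq> cadlag" using U by blast
    show "\<forall>x\<in>U \<inter> V. \<exists>T>0. \<exists>\<epsilon>>0. J1_nbhd x T \<epsilon> \<subseteq> U \<inter> V"
    proof
      fix x assume x: "x \<in> U \<inter> V"
      obtain T \<epsilon> where 1: "T > 0" "\<epsilon> > 0" "J1_nbhd x T \<epsilon> \<subseteq> U" using U x by blast
      obtain T' \<epsilon>' where 2: "T' > 0" "\<epsilon>' > 0" "J1_nbhd x T' \<epsilon>' \<subseteq> V" using V x by blast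
      have "J1_nbhd x (max T T') (min \<epsilon> \<epsilon>') \<subseteq> U \<inter> V"
        using 1(3) 2(3) J1_nbhd_mono[of T "max T T'" "min \<epsilon> \<epsilon>'" \<epsilon> x]
          J1_nbhd_mono[of T' "max T T'" "min \<epsilon> \<epsilon>'" \<epsilon>' x] by auto
      then show "\<exists>T>0. \<exists>\<epsilon>>0. J1_nbhd x T \<epsilon> \<subseteq> U \<inter> V"
        using 1 2 by (intro exI[of _ "max T T'"] conjI exI[of _ "min \<epsilon> \<epsilon>'"]) auto
    qed
  next
    fix K assume "\<forall>U\<in>K. ?L U"
    then show "\<Union>K \<subseteq> cadlag" by blast
    show "\<forall>x\<in>\<Union>K. \<exists>T>0. \<exists>\<epsilon>>0. J1_nbhd x T \<epsilon> \<subseteq> \<Union>K"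
      using \<open>\<forall>U\<in>K. ?L U\<close> by (meson Union_upper subset_trans UnionE)
  qed
  then show ?thesis unfolding skorohod_J1_def by simp
qed

lemma topspace_skorohod_J1: "topspace skorohod_J1 = cadlag"
proof -
  have "openin skorohod_J1 cadlag"
    unfolding openin_skorohod_J1 by (auto simp: J1_nbhd_def intro!: exI[of _ 1])
  then show ?thesis
    unfolding topspace_def using openin_skorohod_J1 by blast
qed

definition borel_of_top :: "'p topology \<Rightarrow> 'p measure" where
  "borel_of_top X = sigma (topspace X) {U. openin X U}"

definition weak_conv_top :: "'p topology \<Rightarrow> (nat \<Rightarrow> 'p measure) \<Rightarrow> 'p measure \<Rightarrow> bool" where
  "weak_conv_top X Q Q' \<longleftrightarrow>
     (\<forall>f. continuous_map X euclideanreal f \<and> bounded (f ` topspace X) \<longrightarrow>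
        (\<lambda>n. \<integral>x. f x \<partial>Q n) \<longlonglongrightarrow> (\<integral>x. f x \<partial>Q'))"


subsection \<open>Subordinators\<close>

text \<open>
  Possibly killed subordinators, with values in \<open>[0,\<infinity>]\<close>: on the event that the process is not
  yet killed at time \<open>t\<close>, the increment after \<open>t\<close> is independent of the past and distributed
  as the process started afresh. In \<open>ennreal\<close>, \<open>\<infinity> - u = \<infinity>\<close> for finite \<open>u\<close>.
\<close>

definition past_events :: "'t measure \<Rightarrow> ('t \<Rightarrow> real \<Rightarrow> ennreal) \<Rightarrow> real \<Rightarrow> 't set set" where
  "past_events M S t =
     sets (vimage_algebra (space M) (\<lambda>w. restrict (S w) {0..t}) (PiM {0..t} (\<lambda>_. borel)))"

definition subordinator :: "'t measure \<Rightarrow> ('t \<Rightarrow> real \<Rightarrow> ennreal) \<Rightarrow> bool" where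
  "subordinator M S \<longleftrightarrow> prob_space M \<and>
     S \<in> M \<rightarrow>\<^sub>M borel_of_top skorohod_J1 \<and>
     (\<forall>t\<ge>0. (\<lambda>w. S w t) \<in> borel_measurable M) \<and>
     (AE w in M. S w 0 = 0 \<and> mono_on {0..} (S w)) \<and>
     (\<forall>s\<ge>0. \<forall>t\<ge>0. \<forall>A\<in>past_events M S t. \<forall>B\<in>sets borel.
        measure M {w \<in> A. S w t < \<infinity> \<and> S w (t + s) - S w t \<in> B} =
        measure M {w \<in> A. S w t < \<infinity>} * measure M {w \<in> space M. S w s \<in> B})"

text \<open>
  A L\'evy measure lives on \<open>(0,\<infinity>]\<close>; its mass at \<open>\<infinity>\<close> is the killing rate. The
  subordinator of L\'evy measure \<open>\<nu>\<close> is the driftless one, with Laplace exponent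
  \<open>\<theta> \<mapsto> \<integral> (1 - exp (- \<theta> u)) \<nu>(du)\<close>.
\<close>

definition levy_measure :: "ennreal measure \<Rightarrow> bool" where
  "levy_measure \<nu> \<longleftrightarrow> sets \<nu> = sets borel \<and> emeasure \<nu> {0} = 0 \<and> (\<integral>\<^sup>+u. min 1 u \<partial>\<nu>) < \<infinity>"

definition subordinator_of_levy_measure ::
    "ennreal measure \<Rightarrow> 't measure \<Rightarrow> ('t \<Rightarrow> real \<Rightarrow> ennreal) \<Rightarrow> bool" where
  "subordinator_of_levy_measure \<nu> M S \<longleftrightarrow> levy_measure \<nu> \<and> subordinator M S \<and>
     (\<forall>t\<ge>0. \<forall>\<theta>>0.
        (\<integral>w. exp_neg (ennreal \<theta> * S w t) \<partial>M) =
          exp (- t * (\<integral>u. 1 - exp_neg (ennreal \<theta> * u) \<partial>\<nu>)))"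

text \<open>The Dirac point mass at infinity.\<close>

definition nu_short :: "ennreal measure" where
  "nu_short = return borel \<infinity>"

end

theory Submission
  imports Defs "HOL-Real_Asymp.Real_Asymp"
begin

text \<open>
  Write \<open>u\<close> for \<open>ln r / (\<beta> \<surd>n)\<close>, so that a trap is at least \<open>r\<close> deep iff its Gaussian variable is at
  most \<open>- u\<close>, an event of probability \<open>1 / b\<close>. Since \<open>b\<close> grows slower than any exponential, \<open>u\<close> is
  small compared with \<open>\<surd>n\<close>, and then the depths vary slowly at the scale \<open>r\<close>: there is a factor
  \<open>M \<rightarrow> \<infinity>\<close> such that traps deeper than \<open>M r\<close> still have probability asymptotic to \<open>1 / b\<close>
  (lemma \<open>top_tail_limit\<close>), whereas \<open>b\<close> times the mean depth of the others is negligible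
  compared with \<open>r\<close> (lemma \<open>small_traps_limit\<close>). At the scale \<open>r\<close> a trap is therefore invisible or
  infinitely deep. The rescaled clock stays near \<open>0\<close> until the first visit to a deep trap; this
  visit alone carries it to infinity, and by monotonicity it remains there. So the clock is close in
  \<open>J\<^sub>1\<close> to a path with a single jump from \<open>0\<close> to \<open>\<infinity>\<close>, and only the time of the first visit matters.

  This time is asymptotically exponential for almost every landscape. Averaged over the landscape,
  the probability that the first \<open>k\<close> steps avoid all deep traps is the mean of \<open>(1 - p)\<close> to the power
  of the number of visited sites, where \<open>p\<close> is asymptotic to \<open>1 / b\<close>. Character sums show that walks
  of length \<open>k = O(b)\<close> visit nearly \<open>k\<close> different sites (lemma \<open>range_law_card_ge\<close>), whence the limit
  \<open>exp (- t)\<close> if \<open>k \<sim> b t\<close>. The variance over the landscape is at most the expected number of common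
  sites of two independent walks; as these are stationary, it is of order \<open>k\<^sup>2 / 2\<^sup>n\<close>, which is
  summable (lemma \<open>avoidance_variance\<close>). Summability gives almost sure convergence however the landscapes for
  different \<open>n\<close> are coupled. The contribution of the shallow traps is controlled in the same way.

  The limit is identified from its Laplace transform: it does not depend on \<open>\<theta>\<close>, so the subordinator takes
  only the values \<open>0\<close> and \<open>\<infinity>\<close>, and it jumps at an exponential time. Test functionals for
  \<open>J\<^sub>1\<close> depend continuously on the jump time, which reduces the weak convergence to the convergence of
  the laws of the jump times (lemmas \<open>discretise_functional_near_jump\<close> and
  \<open>expectation_functional_near_jump\<close>).
\<close>

section \<open>Paths with a single jump to infinity\<close>

lemma exp_neg_simps [simp]: "exp_neg 0 = 1" "exp_neg \<top> = 0"
  by (auto simp: exp_neg_def)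

lemma exp_neg_bounds: "0 \<le> exp_neg u" "exp_neg u \<le> 1"
  by (auto simp: exp_neg_def)

definition jump_path :: "real \<Rightarrow> real \<Rightarrow> ennreal" where
  "jump_path \<sigma> = (\<lambda>t\<in>{0..}. if t < \<sigma> then 0 else \<infinity>)"

text \<open>
  Closeness to a jump path, read through \<open>exp_neg\<close>, the chart that defines the metric of \<open>[0,\<infinity>]\<close>.
  The window \<open>[0,T]\<close> is finite since \<open>J\<^sub>1\<close> neighbourhoods only look at finite windows; \<open>\<sigma>\<close>
  may lie beyond \<open>T\<close>, which covers paths that have not jumped yet.
\<close>

definition near_jump :: "real \<Rightarrow> real \<Rightarrow> real \<Rightarrow> (real \<Rightarrow> ennreal) \<Rightarrow> bool" where
  "near_jump \<epsilon> T \<sigma> y \<longleftrightarrow> y \<in> cadlag \<and>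
     (\<forall>t\<in>{0..T}. if t < \<sigma> then 1 - \<epsilon> \<le> exp_neg (y t) else exp_neg (y t) \<le> \<epsilon>)"

lemma cadlag_if_locally_constant:
  assumes "x \<in> {0..} \<rightarrow>\<^sub>E UNIV"
    and "\<And>t. t \<ge> 0 \<Longrightarrow> eventually (\<lambda>s. x s = x t) (at_right t)"
    and "\<And>t. t > 0 \<Longrightarrow> \<exists>l. eventually (\<lambda>s. x s = l) (at_left t)"
  shows "x \<in> cadlag"
proof -
  have "(x \<longlongrightarrow> x t) (at_right t)" if "t \<ge> 0" for t
    by (rule tendsto_eventually) (use assms(2)[OF that] in simp)
  moreover have "\<exists>l. (x \<longlongrightarrow> l) (at_left t)" if "t > 0" for t
    using assms(3)[OF that] tendsto_eventually by metis
  ultimately show ?thesis using assms(1) unfolding cadlag_def by blast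
qed

lemma jump_path_cadlag: "jump_path \<sigma> \<in> cadlag"
proof (rule cadlag_if_locally_constant)
  show "jump_path \<sigma> \<in> {0..} \<rightarrow>\<^sub>E UNIV" by (auto simp: jump_path_def)
  show "eventually (\<lambda>s. jump_path \<sigma> s = jump_path \<sigma> t) (at_right t)" if t: "t \<ge> 0" for t
  proof (cases "t < \<sigma>")
    case True
    then show ?thesis using t
      by (intro eventually_at_rightI[of t \<sigma>]) (auto simp: jump_path_def)
  next
    case False
    then show ?thesis using t
      by (intro eventually_at_rightI[of t "t + 1"]) (auto simp: jump_path_def)
  qed
  show "\<exists>l. eventually (\<lambda>s. jump_path \<sigma> s = l) (at_left t)" if t: "t > 0" for t
  proof (cases "t \<le> \<sigma>")
    case True
    then show ?thesis using t
      by (intro exI[of _ 0] eventually_at_leftI[of 0 t]) (auto simp: jump_path_def)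
  next
    case False
    then show ?thesis using t
      by (intro exI[of _ \<infinity>] eventually_at_leftI[of "max 0 \<sigma>" t]) (auto simp: jump_path_def)
  qed
qed

text \<open>
  The change of time that is linear on \<open>[0,\<sigma>]\<close> and a translation afterwards carries \<open>\<sigma>\<close> to
  \<open>c\<close> and displaces no point by more than \<open>\<bar>\<sigma> - c\<bar>\<close>. This is where the jump has to be a single one: a
  path that climbs in two large steps is not close to a jump path in \<open>J\<^sub>1\<close>.
\<close>

lemma near_jump_in_J1_nbhd:
  assumes "c > 0" "\<sigma> > 0" "\<bar>\<sigma> - c\<bar> < \<epsilon>'" "\<epsilon> < \<epsilon>'" "near_jump \<epsilon> T \<sigma> y"
  shows "y \<in> J1_nbhd (jump_path c) T \<epsilon>'"
proof -
  \<comment> \<open>h moves the jump; g is its inverse\<close>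
  define h where "h t = (if t < \<sigma> then t * (c / \<sigma>) else t + (c - \<sigma>))" for t
  define g where "g t = (if t < c then t * (\<sigma> / c) else t + (\<sigma> - c))" for t
  have below: "t * (c / \<sigma>) < c" if "t < \<sigma>" for t
    using that assms(1,2) by (simp add: field_simps)
  have below': "t * (\<sigma> / c) < \<sigma>" if "t < c" for t
    using that assms(1,2) by (simp add: field_simps)
  have "strict_mono_on {0..} h"
  proof (rule strict_mono_onI)
    fix r s :: real assume "r < s"
    then show "h r < h s"
      using below[of r] assms(1,2) by (auto simp: h_def intro: mult_strict_right_mono divide_strict_right_mono)
  qed
  moreover have "bij_betw h {0..} {0..}"
  proof (rule bij_betwI[of _ _ _ g])
    show "h \<in> {0..} \<rightarrow> {0..}" "g \<in> {0..} \<rightarrow> {0..}"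
      using assms(1,2) by (auto simp: h_def g_def)
    show "g (h x) = x" if "x \<in> {0..}" for x
      using below[of x] assms(1,2) by (auto simp: h_def g_def)
    show "h (g x) = x" if "x \<in> {0..}" for x
      using below'[of x] assms(1,2) by (auto simp: h_def g_def)
  qed
  ultimately have "h \<in> time_changes" by (simp add: time_changes_def)
  moreover have "\<bar>h t - t\<bar> < \<epsilon>' \<and> ext_dist (y t) (jump_path c (h t)) < \<epsilon>'" if t: "t \<in> {0..T}" for t
  proof (cases "t < \<sigma>")
    case True
    have "h t - t = t / \<sigma> * (c - \<sigma>)"
      using True assms(2) by (simp add: h_def field_simps)
    moreover have "\<bar>t / \<sigma> * (c - \<sigma>)\<bar> \<le> 1 * \<bar>c - \<sigma>\<bar>"
      unfolding abs_mult using True t assms(2) by (intro mult_right_mono) auto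
    moreover have "jump_path c (h t) = 0"
      using True t below[OF True] assms(1,2) by (auto simp: jump_path_def h_def)
    moreover have "1 - \<epsilon> \<le> exp_neg (y t)" using assms(5) True t by (auto simp: near_jump_def)
    ultimately have "\<bar>h t - t\<bar> \<le> \<bar>\<sigma> - c\<bar>" "ext_dist (y t) (jump_path c (h t)) \<le> \<epsilon>"
      using exp_neg_bounds[of "y t"] by (auto simp: ext_dist_def)
    then show ?thesis using assms(3,4) by linarith
  next
    case False
    have "jump_path c (h t) = \<infinity>"
      using False t assms(1,2) by (auto simp: jump_path_def h_def)
    moreover have "exp_neg (y t) \<le> \<epsilon>" using assms(5) False t by (auto simp: near_jump_def)
    moreover have "\<bar>h t - t\<bar> = \<bar>\<sigma> - c\<bar>" using False by (simp add: h_def)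
    ultimately show ?thesis
      using assms(3,4) exp_neg_bounds[of "y t"] by (auto simp: ext_dist_def)
  qed
  ultimately show ?thesis
    using assms(5) unfolding J1_nbhd_def near_jump_def by blast
qed

lemma continuous_near_jump_path:
  assumes f: "continuous_map skorohod_J1 euclideanreal f" and \<eta>: "\<eta> > 0" and c: "c > 0"
  shows "\<exists>T>0. \<exists>\<rho>>0. \<forall>\<sigma> y \<epsilon>. \<sigma> > 0 \<longrightarrow> \<bar>\<sigma> - c\<bar> < \<rho> \<longrightarrow> \<epsilon> < \<rho> \<longrightarrow> near_jump \<epsilon> T \<sigma> y \<longrightarrow>
           \<bar>f y - f (jump_path c)\<bar> < \<eta>"
proof -
  let ?U = "{y \<in> topspace skorohod_J1. f y \<in> {f (jump_path c) - \<eta> <..< f (jump_path c) + \<eta>}}"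
  have "openin skorohod_J1 ?U"
    using f by (rule openin_continuous_map_preimage) auto
  moreover have "jump_path c \<in> ?U"
    using jump_path_cadlag \<eta> by (simp add: topspace_skorohod_J1)
  ultimately obtain T \<rho> where T: "T > 0" "\<rho> > 0" "J1_nbhd (jump_path c) T \<rho> \<subseteq> ?U"
    unfolding openin_skorohod_J1 by blast
  have "\<bar>f y - f (jump_path c)\<bar> < \<eta>"
    if "\<sigma> > 0" "\<bar>\<sigma> - c\<bar> < \<rho>" "\<epsilon> < \<rho>" "near_jump \<epsilon> T \<sigma> y" for \<sigma> y \<epsilon>
  proof -
    have "y \<in> ?U" using near_jump_in_J1_nbhd[OF c that] T(3) by blast
    then show ?thesis by (auto simp: abs_if)
  qed
  then show ?thesis using T(1,2) by blast
qed

lemma near_jump_mono: "T \<le> T' \<Longrightarrow> \<epsilon>' \<le> \<epsilon> \<Longrightarrow> near_jump \<epsilon>' T' \<sigma> y \<Longrightarrow> near_jump \<epsilon> T \<sigma> y"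
  unfolding near_jump_def by (auto simp: Ball_def split: if_splits) (smt (verit, best))+

text \<open>
  The \<open>\<rho>\<close> and \<open>T\<close> of \<open>continuous_near_jump_path\<close> depend on the jump time, but finitely many of them
  suffice on a compact set of jump times. A partition of \<open>[\<delta>,L]\<close> finer than the Lebesgue number of the
  resulting cover gives a functional of \<open>\<sigma>\<close> that uses only the events \<open>s i < \<sigma>\<close>. Its partition points
  are rational, so that convergence of the jump time distribution is needed at countably many times only.
  Jump times outside \<open>[\<delta>,L]\<close> cost \<open>B\<close>.
\<close>

lemma discretise_functional_near_jump:
  fixes f :: "(real \<Rightarrow> ennreal) \<Rightarrow> real"
  assumes f: "continuous_map skorohod_J1 euclideanreal f" and B: "\<And>y. y \<in> cadlag \<Longrightarrow> \<bar>f y\<bar> \<le> B"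
    and \<eta>: "\<eta> > 0" and \<delta>: "0 < \<delta>" "\<delta> < L" and rat: "\<delta> \<in> \<rat>" "L \<in> \<rat>"
  obtains \<epsilon> T and m :: nat and s v :: "nat \<Rightarrow> real"
  where "\<epsilon> > 0" "T \<ge> L" "s 0 = \<delta>" "s m = L" "\<And>i. i \<le> m \<Longrightarrow> s i \<in> \<rat> \<and> \<delta> \<le> s i \<and> s i \<le> L"
    "\<And>\<sigma> y. near_jump \<epsilon> T \<sigma> y \<Longrightarrow>
        \<bar>f y - (\<Sum>i<m. v i * (of_bool (s i < \<sigma>) - of_bool (s (Suc i) < \<sigma>)))\<bar>
          \<le> \<eta> + B * (1 - of_bool (\<delta> < \<sigma>) + of_bool (L < \<sigma>))"
proof -
  have "\<forall>c\<in>{\<delta>..L}. \<exists>T>0. \<exists>\<rho>>0. \<forall>\<sigma> y \<epsilon>. \<sigma> > 0 \<longrightarrow> \<bar>\<sigma> - c\<bar> < \<rho> \<longrightarrow> \<epsilon> < \<rho> \<longrightarrow>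
      near_jump \<epsilon> T \<sigma> y \<longrightarrow> \<bar>f y - f (jump_path c)\<bar> < \<eta>"
    using continuous_near_jump_path[OF f \<eta>] \<delta>(1) by auto
  then obtain TT \<rho> where TT: "\<And>c. c \<in> {\<delta>..L} \<Longrightarrow> \<rho> c > 0"
    "\<And>c \<sigma> y \<epsilon>. c \<in> {\<delta>..L} \<Longrightarrow> \<sigma> > 0 \<Longrightarrow> \<bar>\<sigma> - c\<bar> < \<rho> c \<Longrightarrow> \<epsilon> < \<rho> c \<Longrightarrow>
      near_jump \<epsilon> (TT c) \<sigma> y \<Longrightarrow> \<bar>f y - f (jump_path c)\<bar> < \<eta>"
    by metis
  obtain C where C: "C \<subseteq> {\<delta>..L}" "finite C" "{\<delta>..L} \<subseteq> (\<Union>c\<in>C. ball c (\<rho> c))"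
    by (rule compactE_image[of "{\<delta>..L}" "{\<delta>..L}" "\<lambda>c. ball c (\<rho> c)"])
       (use TT(1) in \<open>auto intro!: bexI\<close>)
  have "C \<noteq> {}" using C(3) \<delta> by auto
  obtain l where l: "0 < l"
    "\<And>S. S \<subseteq> {\<delta>..L} \<Longrightarrow> diameter S < l \<Longrightarrow> \<exists>B\<in>(\<lambda>c. ball c (\<rho> c)) ` C. S \<subseteq> B"
    by (rule Lebesgue_number_lemma[of "{\<delta>..L}" "(\<lambda>c. ball c (\<rho> c)) ` C"]) (use C \<open>C \<noteq> {}\<close> in auto)
  obtain m :: nat where m: "(L - \<delta>) / l < real m" using reals_Archimedean2 by blast
  have m0: "m > 0" using m l(1) \<delta> by (cases m) (auto simp: field_simps)
  define s where "s i = \<delta> + real i * ((L - \<delta>) / real m)" for i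
  have step: "s (Suc i) = s i + (L - \<delta>) / real m" for i by (simp add: s_def distrib_right add_divide_distrib)
  have mesh: "0 < (L - \<delta>) / real m" "(L - \<delta>) / real m < l"
    using m m0 l(1) \<delta> by (auto simp: field_simps)
  have s_mono: "strict_mono s" unfolding strict_mono_Suc_iff using step mesh by simp
  have s_rng: "s i \<in> \<rat> \<and> \<delta> \<le> s i \<and> s i \<le> L" if "i \<le> m" for i
  proof -
    have "real i * ((L - \<delta>) / real m) = (real i / real m) * (L - \<delta>)" by simp
    also have "\<dots> \<le> 1 * (L - \<delta>)" using that m0 \<delta> by (intro mult_right_mono) auto
    finally show ?thesis using rat \<delta> mesh(1) unfolding s_def by auto
  qed
  have "\<exists>c\<in>C. {s i..s (Suc i)} \<subseteq> ball c (\<rho> c)" if "i < m" for i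
    using l(2)[of "{s i..s (Suc i)}"] s_rng[of i] s_rng[of "Suc i"] that step[of i] mesh
    by (auto simp: diameter_closed_interval)
  then obtain c where c: "\<And>i. i < m \<Longrightarrow> c i \<in> C \<and> {s i..s (Suc i)} \<subseteq> ball (c i) (\<rho> (c i))" by metis
  define \<epsilon> where "\<epsilon> = Min (\<rho> ` C) / 2"
  have \<epsilon>: "\<epsilon> > 0" "\<And>d. d \<in> C \<Longrightarrow> \<epsilon> < \<rho> d"
  proof -
    have *: "Min (\<rho> ` C) > 0" using C TT(1) \<open>C \<noteq> {}\<close> by (subst Min_gr_iff) auto
    then show "\<epsilon> > 0" by (simp add: \<epsilon>_def)
    fix d assume "d \<in> C"
    then have "Min (\<rho> ` C) \<le> \<rho> d" using C by simp
    with * show "\<epsilon> < \<rho> d" unfolding \<epsilon>_def by linarith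
  qed
  \<comment> \<open>\<open>L\<close> is included so that jump times up to \<open>L\<close> lie inside the window\<close>
  define T where "T = Max (insert L (TT ` C))"
  have T: "T \<ge> L" "\<And>d. d \<in> C \<Longrightarrow> T \<ge> TT d" unfolding T_def using C by auto
  define v where "v i = f (jump_path (c i))" for i
  have B0: "B \<ge> 0" using B[OF jump_path_cadlag[of 0]] by linarith
  have main: "\<bar>f y - (\<Sum>i<m. v i * (of_bool (s i < \<sigma>) - of_bool (s (Suc i) < \<sigma>)))\<bar>
          \<le> \<eta> + B * (1 - of_bool (\<delta> < \<sigma>) + of_bool (L < \<sigma>))"
    if y: "near_jump \<epsilon> T \<sigma> y" for \<sigma> y
  proof (cases "\<delta> < \<sigma> \<and> \<sigma> \<le> L")
    case True
    have "\<exists>j<m. s j < \<sigma> \<and> \<sigma> \<le> s (Suc j)"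
    proof -
      define j where "j = (LEAST i. \<sigma> \<le> s i)"
      have ex: "\<sigma> \<le> s m" using True m0 by (simp add: s_def)
      have 1: "\<sigma> \<le> s j" unfolding j_def by (rule LeastI[of _ m]) fact
      have 2: "j \<le> m" unfolding j_def by (rule Least_le) fact
      have "j \<noteq> 0" using 1 True by (auto simp: s_def intro!: Nat.gr0I)
      then obtain k where k: "j = Suc k" by (cases j) auto
      have "\<not> \<sigma> \<le> s k" unfolding j_def by (rule not_less_Least) (use k in \<open>simp add: j_def\<close>)
      then show ?thesis using 1 2 k by (intro exI[of _ k]) auto
    qed
    then obtain j where j: "j < m" "s j < \<sigma>" "\<sigma> \<le> s (Suc j)" by blast
    have ind: "of_bool (s i < \<sigma>) - of_bool (s (Suc i) < \<sigma>) = (of_bool (i = j) :: real)" for i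
    proof -
      have le: "s i < \<sigma> \<longleftrightarrow> i \<le> j" for i
      proof
        assume "i \<le> j" then show "s i < \<sigma>" using j strict_mono_mono[OF s_mono] monoD by (metis le_less_trans)
      next
        assume "s i < \<sigma>" then show "i \<le> j" using j strict_mono_less[OF s_mono]
          by (metis less_Suc_eq_le less_le_trans)
      qed
      show ?thesis unfolding le by auto
    qed
    have "(\<Sum>i<m. v i * (of_bool (s i < \<sigma>) - of_bool (s (Suc i) < \<sigma>))) = v j"
      unfolding ind using j(1) by (simp add: of_bool_def if_distrib cong: if_cong)
    moreover have "\<bar>f y - v j\<bar> < \<eta>"
      unfolding v_def
    proof (rule TT(2))
      show "c j \<in> {\<delta>..L}" using c j C by blast
      show "\<sigma> > 0" using True \<delta> by simp
      have "\<sigma> \<in> {s j..s (Suc j)}" using j by simp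
      then have "\<sigma> \<in> ball (c j) (\<rho> (c j))" using c[OF j(1)] by blast
      then show "\<bar>\<sigma> - c j\<bar> < \<rho> (c j)" by (simp add: dist_real_def abs_minus_commute)
      show "\<epsilon> < \<rho> (c j)" using \<epsilon> c j by blast
      show "near_jump \<epsilon> (TT (c j)) \<sigma> y" using near_jump_mono[OF T(2) order_refl y] c j by blast
    qed
    ultimately show ?thesis using True by simp
  next
    case False
    have "(of_bool (s i < \<sigma>) :: real) = of_bool (s (Suc i) < \<sigma>)" if "i < m" for i
      using False s_rng[of i] s_rng[of "Suc i"] that by auto
    then have "(\<Sum>i<m. v i * (of_bool (s i < \<sigma>) - of_bool (s (Suc i) < \<sigma>))) = 0"
      by (intro sum.neutral) simp
    moreover have "\<bar>f y\<bar> \<le> B" using y B by (auto simp: near_jump_def)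
    ultimately show ?thesis using False \<eta> \<delta> B0 by auto
  qed
  show thesis
    by (rule that[OF \<epsilon>(1) T(1) _ _ s_rng main]) (use m0 in \<open>auto simp: s_def\<close>)
qed

lemma space_borel_of_top_skorohod: "space (borel_of_top skorohod_J1) = cadlag"
  unfolding borel_of_top_def using openin_skorohod_J1
  by (subst space_measure_of) (auto simp: topspace_skorohod_J1)

text \<open>
  Expectation of the estimate of \<open>discretise_functional_near_jump\<close>. The event \<open>U t\<close> stands for "no jump up to time \<open>t\<close>"; it
  has to agree with \<open>t < \<sigma>\<close> on the good event \<open>G\<close> only. The two sides of the later limit are
  instances of this bound with the same \<open>v\<close> and \<open>s\<close>, so that they can be compared.
\<close>

lemma (in prob_space) expectation_functional_near_jump:
  fixes f :: "(real \<Rightarrow> ennreal) \<Rightarrow> real" and X :: "'a \<Rightarrow> real \<Rightarrow> ennreal"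
  assumes X: "X \<in> M \<rightarrow>\<^sub>M borel_of_top skorohod_J1"
    and f: "continuous_map skorohod_J1 euclideanreal f" and B: "\<And>y. y \<in> cadlag \<Longrightarrow> \<bar>f y\<bar> \<le> B"
    and \<eta>: "\<eta> \<ge> 0" and s: "s 0 = \<delta>" "s m = L"
    and approx: "\<And>\<sigma> y. near_jump \<epsilon> T \<sigma> y \<Longrightarrow>
        \<bar>f y - (\<Sum>i<m. v i * (of_bool (s i < \<sigma>) - of_bool (s (Suc i) < \<sigma>)))\<bar>
          \<le> \<eta> + B * (1 - of_bool (\<delta> < \<sigma>) + of_bool (L < \<sigma>))"
    and U: "\<And>i. i \<le> m \<Longrightarrow> U (s i) \<in> events" and G: "G \<in> events"
    and good: "\<And>w. w \<in> G \<Longrightarrow> \<exists>\<sigma>. near_jump \<epsilon> T \<sigma> (X w) \<and> (\<forall>i\<le>m. w \<in> U (s i) \<longleftrightarrow> s i < \<sigma>)"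
  shows "\<bar>(\<integral>y. f y \<partial>distr M (borel_of_top skorohod_J1) X) -
           (\<Sum>i<m. v i * (prob (U (s i)) - prob (U (s (Suc i)))))\<bar>
         \<le> \<eta> + B * (1 - prob (U \<delta>) + prob (U L)) + (2 * B + (\<Sum>i<m. \<bar>v i\<bar>)) * (1 - prob G)"
proof -
  note sp = space_borel_of_top_skorohod
  have fm [measurable]: "f \<in> borel_of_top skorohod_J1 \<rightarrow>\<^sub>M borel"
  proof (rule borel_measurableI)
    fix S :: "real set" assume "open S"
    then have "openin skorohod_J1 {y \<in> topspace skorohod_J1. f y \<in> S}"
      using f by (intro openin_continuous_map_preimage[OF f]) auto
    moreover have "f -` S \<inter> space (borel_of_top skorohod_J1) = {y \<in> topspace skorohod_J1. f y \<in> S}"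
      unfolding sp topspace_skorohod_J1 by auto
    ultimately show "f -` S \<inter> space (borel_of_top skorohod_J1) \<in> sets (borel_of_top skorohod_J1)"
      unfolding borel_of_top_def using openin_subset[of skorohod_J1]
      by (subst sets_measure_of) (blast, auto intro!: sigma_sets.Basic)
  qed
  note [measurable] = X G
  have [measurable]: "U (s i) \<in> events" if "i \<le> m" for i using U that .
  have cad: "X w \<in> cadlag" if "w \<in> space M" for w
    using measurable_space[OF X that] sp by simp
  define h where "h w = (\<Sum>i<m. v i * (indicator (U (s i)) w - indicator (U (s (Suc i))) w :: real))" for w
  have intf: "integrable M (\<lambda>w. f (X w))"
    by (rule integrable_const_bound[of _ B]) (use B cad in auto)
  have inti: "integrable M (\<lambda>w. v i * (indicator (U (s i)) w - indicator (U (s (Suc i))) w :: real))" if "i < m" for i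
    using that U[of i] U[of "Suc i"] by (intro integrable_mult_right Bochner_Integration.integrable_diff
      integrable_real_indicator) (auto simp: emeasure_eq_measure)
  have inth: "integrable M h"
    unfolding h_def by (intro Bochner_Integration.integrable_sum inti) auto
  have Eh: "expectation h = (\<Sum>i<m. v i * (prob (U (s i)) - prob (U (s (Suc i)))))"
    unfolding h_def
  proof (subst Bochner_Integration.integral_sum, intro inti, simp, intro sum.cong refl)
    fix i assume "i \<in> {..<m}"
    then have "U (s i) \<in> events" "U (s (Suc i)) \<in> events" using U by auto
    then show "expectation (\<lambda>w. v i * (indicator (U (s i)) w - indicator (U (s (Suc i))) w :: real)) =
        v i * (prob (U (s i)) - prob (U (s (Suc i))))"
      by (subst integral_mult_right_zero, subst Bochner_Integration.integral_diff)
         (auto simp: emeasure_eq_measure)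
  qed
  have B0: "B \<ge> 0" using B[OF jump_path_cadlag[of 0]] by linarith
  define g where "g w = \<eta> + B * (1 - indicator (U \<delta>) w + indicator (U L) w) +
      (2 * B + (\<Sum>i<m. \<bar>v i\<bar>)) * (1 - indicator G w :: real)" for w
  have U\<delta>: "U \<delta> \<in> events" and UL: "U L \<in> events" using U[of 0] U[of m] s by auto
  have intg: "integrable M g"
    unfolding g_def using U\<delta> UL G
    by (intro Bochner_Integration.integrable_add integrable_mult_right Bochner_Integration.integrable_diff
      integrable_real_indicator integrable_const) (auto simp: emeasure_eq_measure)
  have Eg: "expectation g = \<eta> + B * (1 - prob (U \<delta>) + prob (U L)) + (2 * B + (\<Sum>i<m. \<bar>v i\<bar>)) * (1 - prob G)"
    unfolding g_def using U\<delta> UL G by (simp add: emeasure_eq_measure prob_space)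
  have bound: "\<bar>f (X w) - h w\<bar> \<le> g w" if w: "w \<in> space M" for w
  proof (cases "w \<in> G")
    case True
    then obtain \<sigma> where \<sigma>: "near_jump \<epsilon> T \<sigma> (X w)" "\<And>i. i \<le> m \<Longrightarrow> w \<in> U (s i) \<longleftrightarrow> s i < \<sigma>"
      using good by metis
    have "h w = (\<Sum>i<m. v i * (of_bool (s i < \<sigma>) - of_bool (s (Suc i) < \<sigma>)))"
      unfolding h_def using \<sigma>(2) by (intro sum.cong) (auto simp: indicator_def)
    moreover have "g w = \<eta> + B * (1 - of_bool (\<delta> < \<sigma>) + of_bool (L < \<sigma>))"
      using True \<sigma>(2)[of 0] \<sigma>(2)[of m] s by (simp add: g_def indicator_def)
    ultimately show ?thesis using approx[OF \<sigma>(1)] by simp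
  next
    case False
    have "\<bar>h w\<bar> \<le> (\<Sum>i<m. \<bar>v i\<bar>)"
      unfolding h_def by (rule order_trans[OF sum_abs]) (auto intro!: sum_mono simp: abs_mult indicator_def)
    moreover have "\<bar>f (X w)\<bar> \<le> B" using B cad w by blast
    moreover have "B * (1 - indicator (U \<delta>) w + indicator (U L) w) \<ge> 0"
      using B0 by (intro mult_nonneg_nonneg) (auto simp: indicator_def)
    moreover have "g w = \<eta> + B * (1 - indicator (U \<delta>) w + indicator (U L) w) + (2 * B + (\<Sum>i<m. \<bar>v i\<bar>))"
      using False by (simp add: g_def)
    ultimately show ?thesis using \<eta> B0 by linarith
  qed
  have "(\<integral>y. f y \<partial>distr M (borel_of_top skorohod_J1) X) = expectation (\<lambda>w. f (X w))"
    by (rule integral_distr) measurable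
  moreover have "\<bar>expectation (\<lambda>w. f (X w)) - expectation h\<bar> \<le> expectation g"
    unfolding Bochner_Integration.integral_diff[OF intf inth, symmetric]
    by (rule order_trans[OF integral_abs_bound])
       (intro integral_mono integrable_abs Bochner_Integration.integrable_diff intf inth intg bound)
  ultimately show ?thesis using Eh Eg by simp
qed

section \<open>Measurability of random step paths\<close>

definition step_path :: "real \<Rightarrow> (nat \<Rightarrow> real) \<Rightarrow> real \<Rightarrow> ennreal" where
  "step_path a v = (\<lambda>t\<in>{0..}. ennreal (v (nat \<lfloor>a * t\<rfloor>)))"

lemma step_path_cadlag:
  assumes a: "a > 0"
  shows "step_path a v \<in> cadlag"
proof (rule cadlag_if_locally_constant)
  show "step_path a v \<in> {0..} \<rightarrow>\<^sub>E UNIV" by (auto simp: step_path_def)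
  show "eventually (\<lambda>s. step_path a v s = step_path a v t) (at_right t)" if t: "t \<ge> 0" for t
  proof (rule eventually_at_rightI[of t "(real_of_int \<lfloor>a * t\<rfloor> + 1) / a"])
    show "t < (real_of_int \<lfloor>a * t\<rfloor> + 1) / a"
      using a by (simp add: pos_less_divide_eq) (simp add: mult.commute)
    fix s assume s: "s \<in> {t<..<(real_of_int \<lfloor>a * t\<rfloor> + 1) / a}"
    then have "a * s < real_of_int \<lfloor>a * t\<rfloor> + 1" using a by (simp add: pos_less_divide_eq mult.commute)
    moreover have "a * t \<le> a * s" using s a by simp
    ultimately have "\<lfloor>a * s\<rfloor> = \<lfloor>a * t\<rfloor>" by linarith
    then show "step_path a v s = step_path a v t" using s t by (simp add: step_path_def)
  qed
  show "\<exists>l. eventually (\<lambda>s. step_path a v s = l) (at_left t)" if t: "t > 0" for t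
  proof (intro exI eventually_at_leftI[of "(real_of_int \<lceil>a * t\<rceil> - 1) / a" t])
    have "real_of_int \<lceil>a * t\<rceil> - 1 < a * t" by linarith
    then show "(real_of_int \<lceil>a * t\<rceil> - 1) / a < t"
      using a by (simp add: pos_divide_less_eq mult.commute)
    fix s assume s: "s \<in> {(real_of_int \<lceil>a * t\<rceil> - 1) / a<..<t}"
    then have 1: "real_of_int \<lceil>a * t\<rceil> - 1 < a * s" using a by (simp add: pos_divide_less_eq mult.commute)
    have 2: "a * s < a * t" using s a by simp
    have "\<lfloor>a * s\<rfloor> = \<lceil>a * t\<rceil> - 1" using 1 2 by linarith
    moreover have "s \<ge> 0"
    proof -
      have "\<lceil>a * t\<rceil> \<ge> 1" using a t by (simp add: one_le_ceiling)
      then have "0 < a * s" using 1 by linarith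
      then show ?thesis using a by (simp add: zero_less_mult_iff)
    qed
    ultimately show "step_path a v s = ennreal (v (nat (\<lceil>a * t\<rceil> - 1)))"
      by (simp add: step_path_def)
  qed
qed

lemma enn2real_ennreal': "enn2real (ennreal x) = max 0 x"
  by (cases "x \<ge> 0") (auto simp: ennreal_neg)

lemma ext_dist_ennreal_le: "ext_dist (ennreal x) (ennreal y) \<le> \<bar>x - y\<bar>"
proof -
  have "\<bar>exp (- u) - exp (- v)\<bar> \<le> \<bar>u - v\<bar>" if "u \<ge> 0" "v \<ge> 0" for u v :: real
  proof -
    have *: "exp (- u) - exp (- v) \<le> v - u" if "0 \<le> u" "u \<le> v" for u v :: real
    proof -
      have "exp (- u) - exp (- v) = exp (- u) * (1 - exp (u - v))" by (simp add: algebra_simps flip: exp_add)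
      also have "\<dots> \<le> 1 * (1 - exp (u - v))" using that by (intro mult_right_mono) auto
      also have "\<dots> \<le> v - u" using exp_ge_add_one_self[of "u - v"] unfolding mult_1 by linarith
      finally show ?thesis .
    qed
    show ?thesis
    proof (cases "u \<le> v")
      case True
      then show ?thesis using *[of u v] that by simp
    next
      case False
      then show ?thesis using *[of v u] that by simp
    qed
  qed
  note this[of "max 0 x" "max 0 y"]
  also have "\<bar>max 0 x - max 0 y\<bar> \<le> \<bar>x - y\<bar>" by auto
  finally show ?thesis
    by (simp add: ext_dist_def exp_neg_def enn2real_ennreal' max.commute)
qed

text \<open>
  On a finite window a step path depends on finitely many of its values, so it depends
  continuously on the sequence of values, already without a change of time.
\<close>

lemma open_vimage_step_path:
  assumes a: "a > 0" and U: "openin skorohod_J1 U"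
  shows "open (step_path a -` U)"
proof (subst openin_subopen[of euclidean, simplified], safe)
  fix v assume v: "step_path a v \<in> U"
  then obtain T \<epsilon> where T: "T > 0" "\<epsilon> > 0" "J1_nbhd (step_path a v) T \<epsilon> \<subseteq> U"
    using U unfolding openin_skorohod_J1 by blast
  define A where "A = {w. \<forall>i\<in>{..nat \<lfloor>a * T\<rfloor>}. w i \<in> {v i - \<epsilon><..<v i + \<epsilon>}}"
  have "open A"
    unfolding A_def by (rule product_topology_basis') auto
  moreover have "v \<in> A" using T by (auto simp: A_def)
  moreover have "A \<subseteq> step_path a -` U"
  proof
    fix w assume w: "w \<in> A"
    have "id \<in> time_changes" by (auto simp: time_changes_def strict_mono_on_def)
    moreover have "ext_dist (step_path a w t) (step_path a v t) < \<epsilon>" if t: "t \<in> {0..T}" for t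
    proof -
      have "a * t \<le> a * T" using t a by simp
      then have "nat \<lfloor>a * t\<rfloor> \<le> nat \<lfloor>a * T\<rfloor>" by (intro nat_mono floor_mono)
      then have "\<bar>w (nat \<lfloor>a * t\<rfloor>) - v (nat \<lfloor>a * t\<rfloor>)\<bar> < \<epsilon>" using w
        unfolding A_def mem_Collect_eq by (metis atMost_iff greaterThanLessThan_iff abs_diff_less_iff)
      then show ?thesis
        using t le_less_trans[OF ext_dist_ennreal_le] by (auto simp: step_path_def)
    qed
    ultimately have "step_path a w \<in> J1_nbhd (step_path a v) T \<epsilon>"
      unfolding J1_nbhd_def using T step_path_cadlag[OF a] by (auto intro!: bexI[of _ id])
    then show "w \<in> step_path a -` U" using T by auto
  qed
  ultimately show "\<exists>A. open A \<and> v \<in> A \<and> A \<subseteq> step_path a -` U" by blast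
qed

text \<open>
  The Borel sets of \<open>J\<^sub>1\<close> are not generated by coordinates by definition, which is why
  measurability is derived from continuity on the separable product space of sequences.
\<close>

lemma measurable_step_path:
  assumes a: "a > 0" and S: "\<And>k. (\<lambda>w. S k w) \<in> borel_measurable M"
  shows "(\<lambda>w. step_path a (\<lambda>k. S k w)) \<in> M \<rightarrow>\<^sub>M borel_of_top skorohod_J1"
proof (rule measurable_compose[of "\<lambda>w k. S k w" _ borel])
  show "(\<lambda>w k. S k w) \<in> borel_measurable M"
    by (rule measurable_coordinatewise_then_product) (rule S)
  show "step_path a \<in> borel \<rightarrow>\<^sub>M borel_of_top skorohod_J1"
    unfolding borel_of_top_def
  proof (rule measurable_measure_of)
    show "{U. openin skorohod_J1 U} \<subseteq> Pow (topspace skorohod_J1)"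
      using openin_subset by blast
    show "step_path a \<in> space borel \<rightarrow> topspace skorohod_J1"
      using step_path_cadlag[OF a] by (simp add: topspace_skorohod_J1)
    show "step_path a -` U \<inter> space borel \<in> sets borel" if "U \<in> {U. openin skorohod_J1 U}" for U
      using open_vimage_step_path[OF a] that by simp
  qed
qed


section \<open>The subordinator with an infinite jump\<close>

lemma measurable_exp_neg [measurable]: "exp_neg \<in> borel_measurable borel"
  unfolding exp_neg_def by measurable

lemma exp_neg_double: "exp_neg (2 * u) = (exp_neg u)\<^sup>2"
  by (cases u) (auto simp: exp_neg_def ennreal_mult_eq_top_iff enn2real_mult power2_eq_square simp flip: exp_add)

lemma exp_neg_eq_0_iff: "exp_neg u = 0 \<longleftrightarrow> u = \<infinity>"
  by (simp add: exp_neg_def)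

lemma exp_neg_eq_1_iff: "exp_neg u = 1 \<longleftrightarrow> u = 0"
  by (cases u) (auto simp: exp_neg_def)

text \<open>
  With \<open>\<nu> = \<delta>\<^sub>\<infinity>\<close> the Laplace exponent is \<open>1\<close> for every \<open>\<theta>\<close>. Comparing
  \<open>\<theta> = 1\<close> and \<open>\<theta> = 2\<close> shows that \<open>X = exp_neg (S w t)\<close> satisfies \<open>E (X - X\<^sup>2) = 0\<close>, hence
  \<open>X \<in> {0,1}\<close> almost surely.
\<close>

lemma
  assumes S: "subordinator_of_levy_measure nu_short N S" and t: "t \<ge> 0"
  shows AE_short_subordinator: "AE w in N. S w t = 0 \<or> S w t = \<infinity>"
    and prob_short_subordinator: "measure N {w \<in> space N. S w t = 0} = exp (- t)"
proof -
  have sub: "subordinator N S" using S by (simp add: subordinator_of_levy_measure_def)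
  interpret prob_space N using sub by (simp add: subordinator_def)
  have [measurable]: "(\<lambda>w. S w t) \<in> borel_measurable N" using sub t by (simp add: subordinator_def)
  have laplace: "expectation (\<lambda>w. exp_neg (ennreal \<theta> * S w t)) = exp (- t)" if \<theta>: "\<theta> > 0" for \<theta>
  proof -
    have "(\<integral>u. 1 - exp_neg (ennreal \<theta> * u) \<partial>nu_short) = 1"
      unfolding nu_short_def using \<theta> by (subst integral_return) (auto simp: ennreal_mult_top)
    then show ?thesis using S t \<theta> by (simp add: subordinator_of_levy_measure_def)
  qed
  have int1: "integrable N (\<lambda>w. exp_neg (S w t))" and int2: "integrable N (\<lambda>w. (exp_neg (S w t))\<^sup>2)"
    by (rule integrable_const_bound[of _ 1]; use exp_neg_bounds in \<open>auto simp: abs_square_le_1\<close>)+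
  have E1: "expectation (\<lambda>w. exp_neg (S w t)) = exp (- t)" using laplace[of 1] by simp
  have E2: "expectation (\<lambda>w. (exp_neg (S w t))\<^sup>2) = exp (- t)"
    using laplace[of 2] by (simp add: exp_neg_double)
  have "expectation (\<lambda>w. exp_neg (S w t) - (exp_neg (S w t))\<^sup>2) = 0"
    using int1 int2 E1 E2 by simp
  then have "AE w in N. exp_neg (S w t) - (exp_neg (S w t))\<^sup>2 = 0"
    using exp_neg_bounds int1 int2
    by (subst (asm) integral_nonneg_eq_0_iff_AE)
       (auto simp: power2_eq_square mult_left_le)
  then show ae: "AE w in N. S w t = 0 \<or> S w t = \<infinity>"
  proof eventually_elim
    case (elim w)
    then have "exp_neg (S w t) = 0 \<or> exp_neg (S w t) = 1" by (auto simp: power2_eq_square)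
    then show ?case unfolding exp_neg_eq_0_iff exp_neg_eq_1_iff by blast
  qed
  have "expectation (\<lambda>w. exp_neg (S w t)) = expectation (indicator {w \<in> space N. S w t = 0})"
  proof (rule integral_cong_AE)
    show "AE w in N. exp_neg (S w t) = indicator {w \<in> space N. S w t = 0} w"
      using ae AE_space[of N] by eventually_elim (auto simp: indicator_def)
  qed measurable
  then show "prob {w \<in> space N. S w t = 0} = exp (- t)"
    using E1 by simp
qed

text \<open>
  The values are \<open>0\<close> or \<open>\<infinity>\<close> simultaneously at all rational times, hence at all times by right
  continuity; monotonicity then leaves a single jump. The case \<open>A = {}\<close> is that of a path without
  a jump on \<open>[0,T]\<close>.
\<close>

lemma AE_short_subordinator_near_jump:
  assumes S: "subordinator_of_levy_measure nu_short N S" and \<epsilon>: "\<epsilon> \<ge> 0"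
  shows "AE w in N. \<exists>\<sigma>. near_jump \<epsilon> T \<sigma> (S w) \<and> (\<forall>t\<in>{0..T}. S w t = 0 \<longleftrightarrow> t < \<sigma>)"
proof -
  have sub: "subordinator N S" using S by (simp add: subordinator_of_levy_measure_def)
  interpret prob_space N using sub by (simp add: subordinator_def)
  note sp = space_borel_of_top_skorohod
  have cad: "S w \<in> cadlag" if "w \<in> space N" for w
    using sub that measurable_space[of S N "borel_of_top skorohod_J1" w] sp by (auto simp: subordinator_def)
  have "AE w in N. \<forall>q\<in>{q. q \<ge> 0} \<inter> \<rat>. S w q = 0 \<or> S w q = \<infinity>"
    using AE_short_subordinator[OF S] by (subst AE_ball_countable) (auto intro: countable_rat)
  moreover have "AE w in N. mono_on {0..} (S w)"
    using sub by (auto simp: subordinator_def)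
  moreover have "AE w in N. w \<in> space N" by (rule AE_space)
  ultimately show ?thesis
  proof eventually_elim
    case (elim w)
    have right: "(S w \<longlongrightarrow> S w t) (at_right t)" if "t \<ge> 0" for t
      using cad[OF elim(3)] that by (auto simp: cadlag_def)
    have mono: "S w s \<le> S w t" if "0 \<le> s" "s \<le> t" for s t
      using elim(2) that by (auto simp: mono_on_def)
    have two: "S w t = 0 \<or> S w t = \<infinity>" if t: "t \<ge> 0" for t
    proof (rule ccontr)
      assume "\<not> ?thesis"
      then have "0 < S w t" "S w t < \<infinity>" by (auto simp: zero_less_iff_neq_zero less_top)
      then have "eventually (\<lambda>s. 0 < S w s \<and> S w s < \<infinity>) (at_right t)"
        using order_tendstoD[OF right[OF t]] by (auto intro: eventually_conj)
      then obtain b where b: "b > t" "\<And>s. t < s \<Longrightarrow> s < b \<Longrightarrow> 0 < S w s \<and> S w s < \<infinity>"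
        unfolding eventually_at_right_field by blast
      obtain q where "q \<in> \<rat>" "t < q" "q < b" using Rats_dense_in_real[OF b(1)] by blast
      then show False using b(2)[of q] elim(1) t by force
    qed
    define A where "A = {t\<in>{0..T}. S w t \<noteq> 0}"
    define \<sigma> where "\<sigma> = (if A = {} then T + 1 else Inf A)"
    have iff: "S w t = 0 \<longleftrightarrow> t < \<sigma>" if t: "t \<in> {0..T}" for t
    proof (cases "A = {}")
      case True
      then show ?thesis using t by (auto simp: \<sigma>_def A_def)
    next
      case False
      have bdd: "bdd_below A" by (rule bdd_belowI[of _ 0]) (auto simp: A_def)
      have \<sigma>0: "\<sigma> \<ge> 0" unfolding \<sigma>_def using False by (auto intro!: cInf_greatest simp: A_def)
      have inf: "S w s = \<infinity>" if s: "s > \<sigma>" for s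
      proof -
        obtain x where x: "x \<in> A" "x < s"
          using s False bdd cInf_less_iff[of A s] by (auto simp: \<sigma>_def)
        then have "S w x = \<infinity>" using two[of x] by (auto simp: A_def)
        then show ?thesis using mono[of x s] x by (auto simp: A_def top_unique)
      qed
      have "(S w \<longlongrightarrow> \<infinity>) (at_right \<sigma>)"
        by (rule tendsto_eventually) (use inf in \<open>auto intro!: eventually_at_rightI[of \<sigma> "\<sigma> + 1"]\<close>)
      then have S\<sigma>: "S w \<sigma> = \<infinity>"
        using right[OF \<sigma>0] tendsto_unique[of "at_right \<sigma>"] by force
      show ?thesis
      proof
        assume "S w t = 0"
        then show "t < \<sigma>" using inf[of t] S\<sigma> by (cases "t = \<sigma>"; cases "t > \<sigma>") auto
      next
        assume "t < \<sigma>"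
        then have "t \<notin> A" using cInf_lower[OF _ bdd] False by (force simp: \<sigma>_def)
        then show "S w t = 0" using t by (simp add: A_def)
      qed
    qed
    have "near_jump \<epsilon> T \<sigma> (S w)"
      unfolding near_jump_def
    proof (intro conjI ballI)
      fix t assume t: "t \<in> {0..T}"
      show "if t < \<sigma> then 1 - \<epsilon> \<le> exp_neg (S w t) else exp_neg (S w t) \<le> \<epsilon>"
        using iff[OF t] two[of t] t \<epsilon> by auto
    qed (use cad elim in blast)
    then show ?case using iff by blast
  qed
qed

section \<open>The range of simple random walk on the hypercube\<close>

definition flip :: "nat \<Rightarrow> (nat \<Rightarrow> int) \<Rightarrow> (nat \<Rightarrow> int)" where
  "flip i x = x(i := - x i)"

lemma finite_hypercube [simp]: "finite (hypercube n)"
  unfolding hypercube_def by (intro finite_PiE) auto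

lemma card_hypercube: "card (hypercube n) = 2 ^ n"
  unfolding hypercube_def by (subst card_PiE) (auto simp: numeral_2_eq_2)

lemma hypercube_coordinate: "x \<in> hypercube n \<Longrightarrow> i < n \<Longrightarrow> x i = -1 \<or> x i = 1"
  unfolding hypercube_def by (auto simp: PiE_iff)

lemma flip_in_hypercube: "x \<in> hypercube n \<Longrightarrow> i < n \<Longrightarrow> flip i x \<in> hypercube n"
  unfolding hypercube_def flip_def PiE_iff extensional_def by force

lemma flip_flip [simp]: "flip i (flip i x) = x"
  by (auto simp: flip_def)

text \<open>
  Neighbours on the hypercube differ by one sign, which turns sums over neighbours into sums over
  coordinates.
\<close>

lemma edge_iff_flip:
  assumes x: "x \<in> hypercube n"
  shows "{x, y} \<in> hypercube_edges n \<longleftrightarrow> (\<exists>i<n. y = flip i x)"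
proof
  assume "\<exists>i<n. y = flip i x"
  then obtain i where i: "i < n" "y = flip i x" by blast
  have "{j. j < n \<and> x j \<noteq> y j} = {i}"
    using i hypercube_coordinate[OF x i(1)] by (auto simp: flip_def)
  then have "card {j. j < n \<and> x j \<noteq> y j} = 1" by simp
  then show "{x, y} \<in> hypercube_edges n"
    unfolding hypercube_edges_def using x flip_in_hypercube[OF x i(1)] i(2) by blast
next
  assume "{x, y} \<in> hypercube_edges n"
  then obtain u v where uv: "{x, y} = {u, v}" "u \<in> hypercube n" "v \<in> hypercube n"
    "card {j. j < n \<and> u j \<noteq> v j} = 1"
    unfolding hypercube_edges_def by blast
  have y: "y \<in> hypercube n" "card {j. j < n \<and> x j \<noteq> y j} = 1"
    using uv by (auto simp: doubleton_eq_iff eq_commute[of "v _" "u _"])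
  then obtain i where i: "{j. j < n \<and> x j \<noteq> y j} = {i}" by (auto simp: card_1_singleton_iff)
  then have "i < n" "x i \<noteq> y i" by auto
  have "y j = flip i x j" for j
  proof (cases "j < n")
    case True
    show ?thesis
    proof (cases "j = i")
      case True
      then show ?thesis
        using hypercube_coordinate[OF x \<open>i < n\<close>] hypercube_coordinate[OF y(1) \<open>i < n\<close>] \<open>x i \<noteq> y i\<close>
        by (auto simp: flip_def)
    next
      case False
      then have "x j = y j" using i \<open>j < n\<close> by blast
      then show ?thesis using False by (simp add: flip_def)
    qed
  next
    case False
    then show ?thesis using x y(1) \<open>i < n\<close> unfolding hypercube_def by (auto simp: flip_def PiE_iff extensional_def)
  qed
  then show "\<exists>i<n. y = flip i x" using \<open>i < n\<close> by blast
qed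

lemma sum_srw_transition:
  fixes F :: "(nat \<Rightarrow> int) \<Rightarrow> real"
  assumes x: "x \<in> hypercube n"
  shows "(\<Sum>z\<in>hypercube n. srw_transition n x z * F z) = (\<Sum>i<n. F (flip i x)) / real n"
proof -
  have inj: "inj_on (\<lambda>i. flip i x) {..<n}"
  proof (rule inj_onI)
    fix i j assume *: "i \<in> {..<n}" "j \<in> {..<n}" "flip i x = flip j x"
    then have "flip i x i = flip j x i" by simp
    then show "i = j" using hypercube_coordinate[OF x, of i] * by (auto simp: flip_def split: if_splits)
  qed
  have "(\<Sum>z\<in>hypercube n. srw_transition n x z * F z) =
      (\<Sum>z\<in>(\<lambda>i. flip i x) ` {..<n}. srw_transition n x z * F z)"
    using flip_in_hypercube[OF x]
    by (intro sum.mono_neutral_right) (auto simp: srw_transition_def edge_iff_flip[OF x])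
  also have "\<dots> = (\<Sum>i<n. srw_transition n x (flip i x) * F (flip i x))"
    by (rule sum.reindex_cong[OF inj]) auto
  also have "\<dots> = (\<Sum>i<n. F (flip i x) / real n)"
    by (intro sum.cong) (auto simp: srw_transition_def edge_iff_flip[OF x])
  finally show ?thesis by (simp add: sum_divide_distrib)
qed

definition paths :: "nat \<Rightarrow> nat \<Rightarrow> (nat \<Rightarrow> nat \<Rightarrow> int) set" where
  "paths n k = {..k} \<rightarrow>\<^sub>E hypercube n"

definition path_weight :: "nat \<Rightarrow> nat \<Rightarrow> (nat \<Rightarrow> nat \<Rightarrow> int) \<Rightarrow> real" where
  "path_weight n k x = hypercube_uniform n (x 0) * (\<Prod>i<k. srw_transition n (x i) (x (Suc i)))"

text \<open>
  Expectation of a function of the first \<open>k\<close> steps of the stationary walk, as a finite sum. It is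
  used in place of an integral because the walk is specified by its cylinder probabilities.
\<close>

definition path_sum :: "nat \<Rightarrow> nat \<Rightarrow> ((nat \<Rightarrow> nat \<Rightarrow> int) \<Rightarrow> real) \<Rightarrow> real" where
  "path_sum n k F = (\<Sum>x\<in>paths n k. path_weight n k x * F x)"

lemma finite_paths [simp]: "finite (paths n k)"
  unfolding paths_def by (intro finite_PiE) auto

lemma path_weight_nonneg: "path_weight n k x \<ge> 0"
  unfolding path_weight_def by (intro mult_nonneg_nonneg prod_nonneg)
    (auto simp: hypercube_uniform_def srw_transition_def)

lemma path_sum_mono: "(\<And>x. x \<in> paths n k \<Longrightarrow> F x \<le> G x) \<Longrightarrow> path_sum n k F \<le> path_sum n k G"
  unfolding path_sum_def by (intro sum_mono mult_left_mono path_weight_nonneg)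

lemma path_sum_cong: "(\<And>x. x \<in> paths n k \<Longrightarrow> F x = G x) \<Longrightarrow> path_sum n k F = path_sum n k G"
  unfolding path_sum_def by (intro sum.cong) auto

lemma path_sum_sum: "path_sum n k (\<lambda>x. \<Sum>i\<in>I. F i x) = (\<Sum>i\<in>I. path_sum n k (F i))"
  unfolding path_sum_def sum_distrib_left by (rule sum.swap)

lemma path_sum_cmult: "path_sum n k (\<lambda>x. c * F x) = c * path_sum n k F"
  unfolding path_sum_def sum_distrib_left by (intro sum.cong) (auto simp: mult_ac)

lemma path_sum_diff: "path_sum n k (\<lambda>x. F x - G x) = path_sum n k F - path_sum n k G"
  unfolding path_sum_def sum_subtractf[symmetric] by (intro sum.cong) (auto simp: algebra_simps)

lemma path_sum_0: "path_sum n 0 (\<lambda>x. \<phi> (x 0)) = (\<Sum>v\<in>hypercube n. \<phi> v) / 2 ^ n"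
proof -
  have "path_sum n 0 (\<lambda>x. \<phi> (x 0)) = (\<Sum>v\<in>hypercube n. \<phi> v / 2 ^ n)"
    unfolding path_sum_def
  proof (rule sum.reindex_bij_witness[where j = "\<lambda>x. x 0" and i = "\<lambda>v. \<lambda>k\<in>{..0}. v"])
    fix x assume "x \<in> paths n 0"
    then show "(\<lambda>k\<in>{..0}. x 0) = x" "x 0 \<in> hypercube n"
      by (auto simp: paths_def PiE_iff extensional_def fun_eq_iff)
  qed (auto simp: paths_def path_weight_def hypercube_uniform_def)
  then show ?thesis by (simp add: sum_divide_distrib)
qed

text \<open>
  The Markov property.
\<close>

lemma path_sum_Suc:
  "path_sum n (Suc k) F = path_sum n k (\<lambda>x. (\<Sum>i<n. F (x(Suc k := flip i (x k)))) / real n)"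
proof -
  have eq: "paths n (Suc k) = (\<lambda>(z, x). x(Suc k := z)) ` (hypercube n \<times> paths n k)"
    unfolding paths_def atMost_Suc by (rule PiE_insert_eq)
  have inj: "inj_on (\<lambda>(z, x). x(Suc k := z)) (hypercube n \<times> paths n k)"
    unfolding paths_def by (rule inj_combinator) auto
  have w: "path_weight n (Suc k) (x(Suc k := z)) = path_weight n k x * srw_transition n (x k) z" for x z
  proof -
    have "(\<Prod>i<k. srw_transition n ((x(Suc k := z)) i) ((x(Suc k := z)) (Suc i))) =
        (\<Prod>i<k. srw_transition n (x i) (x (Suc i)))"
      by (intro prod.cong) auto
    then show ?thesis unfolding path_weight_def prod.lessThan_Suc by simp
  qed
  have "path_sum n (Suc k) F =
      (\<Sum>(z, x)\<in>hypercube n \<times> paths n k. path_weight n (Suc k) (x(Suc k := z)) * F (x(Suc k := z)))"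
    unfolding path_sum_def eq by (rule sum.reindex_cong[OF inj]) auto
  also have "\<dots> = (\<Sum>x\<in>paths n k. \<Sum>z\<in>hypercube n. path_weight n k x * (srw_transition n (x k) z * F (x(Suc k := z))))"
    unfolding w by (subst sum.cartesian_product[symmetric], subst sum.swap) (simp add: mult.assoc)
  also have "\<dots> = path_sum n k (\<lambda>x. (\<Sum>i<n. F (x(Suc k := flip i (x k)))) / real n)"
    unfolding path_sum_def
    by (intro sum.cong refl, subst sum_distrib_left[symmetric], subst sum_srw_transition)
       (auto simp: paths_def PiE_iff)
  finally show ?thesis .
qed

text \<open>
  The uniform distribution is invariant, since flipping a fixed coordinate permutes the
  hypercube.
\<close>

lemma path_sum_last:
  assumes n: "n \<ge> 1"
  shows "path_sum n k (\<lambda>x. \<phi> (x k)) = (\<Sum>v\<in>hypercube n. \<phi> v) / 2 ^ n"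
proof (induction k arbitrary: \<phi>)
  case 0
  show ?case by (rule path_sum_0)
next
  case (Suc k)
  have "path_sum n (Suc k) (\<lambda>x. \<phi> (x (Suc k))) = path_sum n k (\<lambda>x. (\<Sum>i<n. \<phi> (flip i (x k))) / real n)"
    by (subst path_sum_Suc) simp
  also have "\<dots> = (\<Sum>v\<in>hypercube n. (\<Sum>i<n. \<phi> (flip i v)) / real n) / 2 ^ n" by (rule Suc.IH)
  also have "(\<Sum>v\<in>hypercube n. (\<Sum>i<n. \<phi> (flip i v)) / real n) = (\<Sum>i<n. \<Sum>v\<in>hypercube n. \<phi> (flip i v)) / real n"
    by (subst sum_divide_distrib[symmetric], subst sum.swap) simp
  also have "(\<Sum>v\<in>hypercube n. \<phi> (flip i v)) = (\<Sum>v\<in>hypercube n. \<phi> v)" if "i < n" for i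
    by (rule sum.reindex_bij_witness[of _ "flip i" "flip i"]) (use that flip_in_hypercube in auto)
  then have "(\<Sum>i<n. \<Sum>v\<in>hypercube n. \<phi> (flip i v)) / real n = (\<Sum>v\<in>hypercube n. \<phi> v)"
    using n by simp
  finally show ?case .
qed

lemma path_sum_1: "n \<ge> 1 \<Longrightarrow> path_sum n k (\<lambda>_. 1) = 1"
  using path_sum_last[of n k "\<lambda>_. 1"] by (simp add: card_hypercube)

definition character :: "nat set \<Rightarrow> (nat \<Rightarrow> int) \<Rightarrow> real" where
  "character S x = (\<Prod>i\<in>S. real_of_int (x i))"

definition eigenvalue :: "nat \<Rightarrow> nat set \<Rightarrow> real" where
  "eigenvalue n S = 1 - 2 * real (card S) / real n"

lemma character_square:
  assumes "x \<in> hypercube n" "S \<subseteq> {..<n}"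
  shows "character S x * character S x = 1"
  unfolding character_def prod.distrib[symmetric]
  using hypercube_coordinate[OF assms(1)] assms(2) by (intro prod.neutral) force

lemma character_flip:
  assumes "S \<subseteq> {..<n}"
  shows "character S (flip i x) = (if i \<in> S then - character S x else character S x)"
proof (cases "i \<in> S")
  case True
  have fin: "finite S" using assms finite_subset by blast
  show ?thesis using True unfolding character_def prod.remove[OF fin True]
    by (simp add: flip_def)
next
  case False
  then show ?thesis unfolding character_def flip_def by (auto intro!: prod.cong)
qed

lemma character_eigenfunction:
  assumes S: "S \<subseteq> {..<n}" and n: "n \<ge> 1"
  shows "(\<Sum>i<n. character S (flip i x)) / real n = eigenvalue n S * character S x"
proof -
  have fin: "finite S" using S finite_subset by blast
  have "(\<Sum>i<n. character S (flip i x)) = (\<Sum>i<n. character S x - (if i \<in> S then 2 * character S x else 0))"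
    using character_flip[OF S] by (intro sum.cong) auto
  also have "\<dots> = real n * character S x - 2 * real (card S) * character S x"
    using S by (simp add: sum_subtractf flip: sum.inter_restrict) (simp add: Int_absorb1)
  finally show ?thesis using n by (simp add: eigenvalue_def field_simps)
qed

lemma sum_characters:
  assumes "x \<in> hypercube n" "y \<in> hypercube n"
  shows "(\<Sum>S\<in>Pow {..<n}. character S x * character S y) = 2 ^ n * of_bool (x = y)"
proof -
  have "(\<Sum>S\<in>Pow {..<n}. character S x * character S y) = (\<Prod>i<n. real_of_int (x i * y i) + 1)"
    by (subst prod_add) (auto simp: character_def prod.distrib)
  also have "\<dots> = 2 ^ n * of_bool (x = y)"
  proof (cases "x = y")
    case True
    have "real_of_int (x i * y i) + 1 = 2" if "i < n" for i
      using hypercube_coordinate[OF assms(1) that] True by auto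
    then show ?thesis using True by simp
  next
    case False
    then obtain i where i: "x i \<noteq> y i" by blast
    then have "i < n" using assms unfolding hypercube_def PiE_iff extensional_def by force
    then have "real_of_int (x i * y i) + 1 = 0"
      using i hypercube_coordinate[OF assms(1)] hypercube_coordinate[OF assms(2)] by fastforce
    then show ?thesis using False \<open>i < n\<close> by (auto intro!: prod_zero)
  qed
  finally show ?thesis .
qed

text \<open>
  The characters of \<open>{-1,1}\<^sup>n\<close> are eigenfunctions of the transition operator.
\<close>

lemma path_sum_character:
  assumes n: "n \<ge> 1" and S: "S \<subseteq> {..<n}"
  shows "path_sum n (i + l) (\<lambda>x. character S (x i) * character S (x (i + l))) = eigenvalue n S ^ l"
proof (induction l)
  case 0
  have "path_sum n i (\<lambda>x. character S (x i) * character S (x i)) = path_sum n i (\<lambda>_. 1)"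
    by (rule path_sum_cong, rule character_square[OF _ S]) (auto simp: paths_def PiE_iff)
  then show ?case using path_sum_1[OF n] by simp
next
  case (Suc l)
  have "path_sum n (i + Suc l) (\<lambda>x. character S (x i) * character S (x (i + Suc l))) =
      path_sum n (i + l) (\<lambda>x. character S (x i) * ((\<Sum>j<n. character S (flip j (x (i + l)))) / real n))"
    unfolding add_Suc_right by (subst path_sum_Suc) (simp add: sum_distrib_left)
  also have "\<dots> = path_sum n (i + l) (\<lambda>x. eigenvalue n S * (character S (x i) * character S (x (i + l))))"
    unfolding character_eigenfunction[OF S n] by (simp add: mult_ac)
  finally show ?case unfolding path_sum_cmult Suc.IH by simp
qed

text \<open>
  Orthogonality of the characters expresses the event of return as a character sum.
\<close>

lemma path_sum_return:
  assumes n: "n \<ge> 1"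
  shows "path_sum n (i + l) (\<lambda>x. of_bool (x i = x (i + l))) = (\<Sum>S\<in>Pow {..<n}. eigenvalue n S ^ l) / 2 ^ n"
proof -
  have "path_sum n (i + l) (\<lambda>x. of_bool (x i = x (i + l))) =
    path_sum n (i + l) (\<lambda>x. inverse (2 ^ n) * (\<Sum>S\<in>Pow {..<n}. character S (x i) * character S (x (i + l))))"
    by (rule path_sum_cong, subst sum_characters) (auto simp: paths_def PiE_iff)
  also have "\<dots> = inverse (2 ^ n) * (\<Sum>S\<in>Pow {..<n}. eigenvalue n S ^ l)"
    unfolding path_sum_cmult path_sum_sum using path_sum_character[OF n] by simp
  finally show ?thesis by (simp add: field_simps)
qed

lemma sum_Pow_lessThan_Suc:
  "(\<Sum>S\<in>Pow {..<Suc n}. F S) = (\<Sum>S\<in>Pow {..<n}. F S + F (insert n S))"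
proof -
  have "inj_on (insert n) (Pow {..<n})"
    by (rule inj_onI) (auto simp: insert_eq_iff dest: lessThan_iff[THEN iffD1])
  then show ?thesis
    unfolding lessThan_Suc Pow_insert
    by (subst sum.union_disjoint) (auto simp: sum.distrib sum.reindex)
qed

lemma sum_eigenvalue_moments:
  "(\<Sum>S\<in>Pow {..<n}. real n - 2 * real (card S)) = 0"
  "(\<Sum>S\<in>Pow {..<n}. (real n - 2 * real (card S))\<^sup>2) = real n * 2 ^ n"
proof (induction n)
  case (Suc n)
  have c: "card (insert n S) = Suc (card S)" if "S \<in> Pow {..<n}" for S
    using that finite_subset by (subst card_insert_disjoint) auto
  have "(\<Sum>S\<in>Pow {..<Suc n}. real (Suc n) - 2 * real (card S)) = (\<Sum>S\<in>Pow {..<n}. 2 * (real n - 2 * real (card S)))"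
    unfolding sum_Pow_lessThan_Suc by (intro sum.cong) (auto simp: c)
  then show "(\<Sum>S\<in>Pow {..<Suc n}. real (Suc n) - 2 * real (card S)) = 0"
    unfolding sum_distrib_left[symmetric] Suc.IH(1) by simp
  have "(\<Sum>S\<in>Pow {..<Suc n}. (real (Suc n) - 2 * real (card S))\<^sup>2) =
      (\<Sum>S\<in>Pow {..<n}. 2 * (real n - 2 * real (card S))\<^sup>2 + 2)"
    unfolding sum_Pow_lessThan_Suc by (intro sum.cong) (auto simp: c power2_eq_square algebra_simps)
  then show "(\<Sum>S\<in>Pow {..<Suc n}. (real (Suc n) - 2 * real (card S))\<^sup>2) = real (Suc n) * 2 ^ Suc n"
    unfolding sum.distrib sum_distrib_left[symmetric] Suc.IH(2) by (simp add: card_Pow algebra_simps)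
qed auto

lemma geometric_sum_le:
  fixes x :: real
  assumes "-1 \<le> x" "x \<le> 1 / 2"
  shows "(\<Sum>l<m. x ^ l) \<le> 2"
proof -
  have "(1 - x) * (\<Sum>l<m. x ^ l) = 1 - x ^ m" by (rule one_diff_power_eq[symmetric])
  moreover have "1 - x ^ m \<le> 2 * (1 - x)"
  proof (cases "x \<ge> 0")
    case True
    then show ?thesis using assms by (simp add: add_increasing2) (smt (verit) zero_le_power)
  next
    case False
    have "\<bar>x ^ m\<bar> \<le> 1" using assms False by (simp add: power_abs power_le_one)
    then have "1 - x ^ m \<le> 2" unfolding abs_le_iff by linarith
    then show ?thesis using False by simp
  qed
  ultimately have "(1 - x) * (\<Sum>l<m. x ^ l) \<le> (1 - x) * 2" by simp
  moreover have "1 - x > 0" using assms by simp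
  ultimately show ?thesis using mult_le_cancel_left_pos by blast
qed

text \<open>
  For an eigenvalue up to \<open>1/2\<close> the powers beyond the first add up to at most twice its square. An
  eigenvalue above
  \<open>1/2\<close> belongs to a set with fewer than \<open>n/4\<close> elements; the factor \<open>(4/3)\<^sup>n (81/256)\<^sup>c\<close> with
  \<open>81/256 = (3/4)\<^sup>4\<close> exceeds \<open>1\<close> for these sets, and is a Chernoff weight whose sum
  over all sets is exponentially smaller than \<open>2\<^sup>n\<close>.
\<close>

lemma sum_eigenvalue_powers_le:
  assumes n: "n \<ge> 1" and S: "S \<subseteq> {..<n}" and K: "K \<ge> 1"
  shows "(\<Sum>l=1..K. eigenvalue n S ^ l) \<le>
    eigenvalue n S + 2 * (eigenvalue n S)\<^sup>2 + real K * ((4 / 3) ^ n * (81 / 256) ^ card S)"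
proof -
  let ?x = "eigenvalue n S"
  have cS: "card S \<le> n" using card_mono[OF _ S] by simp
  then have x: "-1 \<le> ?x" "?x \<le> 1" using n by (auto simp: eigenvalue_def field_simps)
  show ?thesis
  proof (cases "?x \<le> 1 / 2")
    case True
    have "(\<Sum>l=1..K. ?x ^ l) \<le> ?x + 2 * ?x\<^sup>2"
    proof -
      have "(\<Sum>l=1..K. ?x ^ l) = (\<Sum>l<K. ?x ^ Suc l)"
        by (rule sum.reindex_bij_witness[of _ Suc "\<lambda>l. l - 1"]) auto
      also have "\<dots> = (\<Sum>l<Suc (K - 1). ?x ^ Suc l)" using K by simp
      also have "\<dots> = ?x + ?x\<^sup>2 * (\<Sum>l<K - 1. ?x ^ l)"
        unfolding sum.lessThan_Suc_shift sum_distrib_left by (simp add: power2_eq_square mult_ac)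
      also have "\<dots> \<le> ?x + ?x\<^sup>2 * 2"
        using geometric_sum_le[OF x(1) True] by (intro add_left_mono mult_left_mono) auto
      finally show ?thesis by simp
    qed
    moreover have "0 \<le> real K * ((4 / 3) ^ n * (81 / 256) ^ card S)" by simp
    ultimately show ?thesis by linarith
  next
    case False
    have "(\<Sum>l=1..K. ?x ^ l) \<le> (\<Sum>l=1..K. 1)"
      using False x by (intro sum_mono power_le_one) auto
    moreover have "1 \<le> (4 / 3) ^ n * (81 / 256 :: real) ^ card S"
    proof -
      have "4 * card S \<le> n" using False n by (simp add: eigenvalue_def field_simps)
      then have "(3 / 4 :: real) ^ n \<le> (3 / 4) ^ (4 * card S)" by (intro power_decreasing) auto
      also have "\<dots> = (81 / 256) ^ card S" unfolding power_mult by (simp add: power_divide)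
      finally have "(4 / 3) ^ n * (3 / 4 :: real) ^ n \<le> (4 / 3) ^ n * (81 / 256) ^ card S"
        by (intro mult_left_mono) auto
      then show ?thesis by (simp flip: power_mult_distrib)
    qed
    then have "real K * 1 \<le> real K * ((4 / 3) ^ n * (81 / 256) ^ card S)" by (intro mult_left_mono) auto
    ultimately show ?thesis using False by (simp add: add_increasing)
  qed
qed


text \<open>
  The mean of the eigenvalues is \<open>0\<close> and that of their squares is \<open>1/n\<close>, so a walk of
  subexponential length returns to its position with probability \<open>O(1/n)\<close>.
\<close>

lemma path_sum_total_returns_le:
  assumes n: "n \<ge> 1" and K: "K \<ge> 1"
  shows "(\<Sum>l=1..K. path_sum n (i + l) (\<lambda>x. of_bool (x i = x (i + l)))) \<le>
    2 / real n + real K * (337 / 384) ^ n"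
proof -
  have avg: "(\<Sum>S\<in>Pow {..<n}. eigenvalue n S) = 0"
  proof -
    have "(\<Sum>S\<in>Pow {..<n}. eigenvalue n S) = (\<Sum>S\<in>Pow {..<n}. (real n - 2 * real (card S)) / real n)"
      using n by (intro sum.cong) (auto simp: eigenvalue_def diff_divide_distrib)
    then show ?thesis by (simp add: sum_eigenvalue_moments flip: sum_divide_distrib)
  qed
  have avg2: "(\<Sum>S\<in>Pow {..<n}. (eigenvalue n S)\<^sup>2) = 2 ^ n / real n"
  proof -
    have "(\<Sum>S\<in>Pow {..<n}. (eigenvalue n S)\<^sup>2) = (\<Sum>S\<in>Pow {..<n}. (real n - 2 * real (card S))\<^sup>2 / (real n)\<^sup>2)"
      using n by (intro sum.cong) (auto simp: eigenvalue_def diff_divide_distrib simp flip: power_divide)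
    also have "\<dots> = real n * 2 ^ n / (real n)\<^sup>2"
      by (simp add: sum_eigenvalue_moments flip: sum_divide_distrib)
    finally show ?thesis using n by (simp add: power2_eq_square)
  qed
  have avg3: "(\<Sum>S\<in>Pow {..<n}. (4 / 3) ^ n * (81 / 256 :: real) ^ card S) = 2 ^ n * (337 / 384) ^ n"
  proof -
    have "(\<Sum>S\<in>Pow {..<n}. (81 / 256 :: real) ^ card S) = (\<Prod>i<n. 81 / 256 + 1)"
      by (subst prod_add) auto
    also have "\<dots> = (337 / 256) ^ n" by simp
    finally show ?thesis unfolding sum_distrib_left[symmetric] by (simp flip: power_mult_distrib)
  qed
  have "(\<Sum>l=1..K. path_sum n (i + l) (\<lambda>x. of_bool (x i = x (i + l)))) =
      (\<Sum>S\<in>Pow {..<n}. \<Sum>l=1..K. eigenvalue n S ^ l) / 2 ^ n"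
    unfolding path_sum_return[OF n] sum_divide_distrib[symmetric] by (subst sum.swap) simp
  also have "\<dots> \<le> (\<Sum>S\<in>Pow {..<n}. eigenvalue n S + 2 * (eigenvalue n S)\<^sup>2 +
      real K * ((4 / 3) ^ n * (81 / 256) ^ card S)) / 2 ^ n"
    using sum_eigenvalue_powers_le[OF n _ K] by (intro divide_right_mono sum_mono) auto
  also have "\<dots> = (2 * (2 ^ n / real n) + real K * (2 ^ n * (337 / 384) ^ n)) / 2 ^ n"
    by (simp only: sum.distrib sum_distrib_left[of 2, symmetric] sum_distrib_left[of "real K", symmetric] avg avg2 avg3 add_0_left)
  also have "\<dots> = 2 / real n + real K * (337 / 384) ^ n"
    using n by (simp add: add_divide_distrib)
  finally show ?thesis .
qed

lemma path_sum_restrict: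
  assumes n: "n \<ge> 1" and j: "\<And>x y. (\<And>i. i \<le> j \<Longrightarrow> x i = y i) \<Longrightarrow> F x = F y"
  shows "path_sum n (j + l) F = path_sum n j F"
proof (induction l)
  case (Suc l)
  have "F (x(Suc (j + l) := z)) = F x" for x z by (rule j) auto
  then show ?case using Suc n by (simp add: path_sum_Suc)
qed simp

text \<open>
  Only the last visit to each site is counted; every other time is followed by a return.
\<close>

lemma path_sum_range_card_ge:
  assumes n: "n \<ge> 1"
  shows "path_sum n k (\<lambda>x. real (card (x ` {..k}))) \<ge>
    real (k + 1) * (1 - 2 / real n - real (k + 1) * (337 / 384) ^ n)"
proof -
  have point: "real (k + 1) - (\<Sum>i\<le>k. \<Sum>l=1..k+1. of_bool (i + l \<le> k \<and> x i = x (i + l))) \<le> real (card (x ` {..k}))"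
    for x :: "nat \<Rightarrow> nat \<Rightarrow> int"
  proof -
    define R where "R = {i. i \<le> k \<and> (\<exists>l\<in>{1..k+1}. i + l \<le> k \<and> x i = x (i + l))}"
    have R: "R \<subseteq> {..k}" by (auto simp: R_def)
    have "inj_on x ({..k} - R)"
    proof (rule linorder_inj_onI)
      fix i j assume ij: "i < j" "i \<in> {..k} - R" "j \<in> {..k} - R"
      then have "\<not> (j - i \<in> {1..k+1} \<and> i + (j - i) \<le> k \<and> x i = x (i + (j - i)))"
        unfolding R_def by blast
      then show "x i \<noteq> x j" using ij by auto
    qed auto
    then have "card ({..k} - R) \<le> card (x ` {..k})"
      by (metis Diff_subset card_image card_mono finite_atMost finite_imageI image_mono)
    moreover have "card ({..k} - R) = k + 1 - card R"
      using R by (subst card_Diff_subset) (auto intro: finite_subset)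
    moreover have "real (card R) \<le> (\<Sum>i\<le>k. \<Sum>l=1..k+1. of_bool (i + l \<le> k \<and> x i = x (i + l)))"
    proof -
      have "real (card R) = (\<Sum>i\<le>k. of_bool (i \<in> R))"
        using R by (simp add: of_bool_def Int_absorb1 flip: sum.inter_restrict)
      also have "\<dots> \<le> (\<Sum>i\<le>k. \<Sum>l=1..k+1. of_bool (i + l \<le> k \<and> x i = x (i + l)))"
      proof (rule sum_mono)
        fix i assume "i \<in> {..k}"
        show "of_bool (i \<in> R) \<le> (\<Sum>l=1..k+1. of_bool (i + l \<le> k \<and> x i = x (i + l)) :: real)"
        proof (cases "i \<in> R")
          case True
          then obtain l where l: "l \<in> {1..k+1}" "i + l \<le> k \<and> x i = x (i + l)" by (auto simp: R_def)
          have "(1::real) = of_bool (i + l \<le> k \<and> x i = x (i + l))" using l by simp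
          also have "\<dots> \<le> (\<Sum>l=1..k+1. of_bool (i + l \<le> k \<and> x i = x (i + l)))"
            by (rule member_le_sum) (use l in auto)
          finally show ?thesis using True by simp
        qed (auto intro: sum_nonneg)
      qed
      finally show ?thesis .
    qed
    ultimately show ?thesis by linarith
  qed
  have "path_sum n k (\<lambda>x. \<Sum>l=1..k+1. of_bool (i + l \<le> k \<and> x i = x (i + l))) \<le> 2 / real n + real (k + 1) * (337 / 384) ^ n"
    for i
  proof -
    have "path_sum n k (\<lambda>x. of_bool (i + l \<le> k \<and> x i = x (i + l))) \<le>
        path_sum n (i + l) (\<lambda>x. of_bool (x i = x (i + l)))" for l
    proof (cases "i + l \<le> k")
      case True
      then obtain d where d: "k = i + l + d" using le_Suc_ex by blast
      have "path_sum n (i + l + d) (\<lambda>x. of_bool (x i = x (i + l))) = path_sum n (i + l) (\<lambda>x. of_bool (x i = x (i + l)))"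
        by (rule path_sum_restrict[OF n]) simp
      then show ?thesis using True d by simp
    next
      case False
      then show ?thesis by (simp add: path_sum_def sum_nonneg path_weight_nonneg)
    qed
    then have "path_sum n k (\<lambda>x. \<Sum>l=1..k+1. of_bool (i + l \<le> k \<and> x i = x (i + l))) \<le>
        (\<Sum>l=1..k+1. path_sum n (i + l) (\<lambda>x. of_bool (x i = x (i + l))))"
      unfolding path_sum_sum by (intro sum_mono)
    also have "\<dots> \<le> 2 / real n + real (k + 1) * (337 / 384) ^ n"
      using path_sum_total_returns_le[OF n, of "k + 1"] by simp
    finally show ?thesis .
  qed
  then have "(\<Sum>i\<le>k. path_sum n k (\<lambda>x. \<Sum>l=1..k+1. of_bool (i + l \<le> k \<and> x i = x (i + l)))) \<le>
      (\<Sum>i\<le>k. 2 / real n + real (k + 1) * (337 / 384) ^ n)" by (intro sum_mono)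
  moreover have "path_sum n k (\<lambda>x. real (k + 1) - (\<Sum>i\<le>k. \<Sum>l=1..k+1. of_bool (i + l \<le> k \<and> x i = x (i + l))))
      \<le> path_sum n k (\<lambda>x. real (card (x ` {..k})))"
    by (rule path_sum_mono) (rule point)
  moreover have "path_sum n k (\<lambda>_. real (k + 1)) = real (k + 1)"
    using path_sum_cmult[of n k "real (k + 1)" "\<lambda>_. 1"] path_sum_1[OF n] by simp
  ultimately show ?thesis
    unfolding path_sum_diff path_sum_sum[of n k _ "{..k}"] by (simp add: algebra_simps)
qed

locale hypercube_walk = prob_space M for M :: "'s measure" +
  fixes n :: nat and J :: "nat \<Rightarrow> 's \<Rightarrow> (nat \<Rightarrow> int)"
  assumes n: "n \<ge> 1" and walk: "simple_random_walk n (hypercube_uniform n) M J"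
begin

lemma measurable_walk [measurable]: "J k \<in> M \<rightarrow>\<^sub>M count_space (hypercube n)"
  using walk by (simp add: simple_random_walk_def)

lemma walk_in_hypercube: "w \<in> space M \<Longrightarrow> J k w \<in> hypercube n"
  using measurable_space[OF measurable_walk] by simp

lemma sets_walk_eq [measurable]: "{w \<in> space M. J i w = v} \<in> events"
proof -
  have "{w \<in> space M. J i w = v} = J i -` ({v} \<inter> hypercube n) \<inter> space M"
    using walk_in_hypercube by auto
  then show ?thesis using measurable_sets[OF measurable_walk[of i], of "{v} \<inter> hypercube n"] by simp
qed

lemma sets_walk_path: "{w \<in> space M. \<forall>i\<le>k. J i w = x i} \<in> events"
  by measurable

lemma path_in_paths: "w \<in> space M \<Longrightarrow> (\<lambda>i\<in>{..k}. J i w) \<in> paths n k"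
  using walk_in_hypercube by (auto simp: paths_def)

lemma path_eq_iff: "x \<in> paths n k \<Longrightarrow> (\<lambda>i\<in>{..k}. J i w) = x \<longleftrightarrow> (\<forall>i\<le>k. J i w = x i)"
  unfolding paths_def PiE_iff extensional_def by (auto simp: fun_eq_iff restrict_def)

lemma path_event_eq:
  "{w \<in> space M. \<Phi> (\<lambda>i\<in>{..k}. J i w)} = (\<Union>x\<in>{x\<in>paths n k. \<Phi> x}. {w \<in> space M. \<forall>i\<le>k. J i w = x i})"
proof -
  have "\<Phi> (\<lambda>i\<in>{..k}. J i w) \<longleftrightarrow> (\<exists>x\<in>{x\<in>paths n k. \<Phi> x}. \<forall>i\<le>k. J i w = x i)" if "w \<in> space M" for w
    using path_in_paths[OF that, of k] path_eq_iff by (metis (no_types, lifting) mem_Collect_eq)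
  then show ?thesis by blast
qed

lemma sets_path_event: "{w \<in> space M. \<Phi> (\<lambda>i\<in>{..k}. J i w)} \<in> events"
  unfolding path_event_eq by (intro sets.finite_UN sets_walk_path) auto

lemma prob_path_event:
  "prob {w \<in> space M. \<Phi> (\<lambda>i\<in>{..k}. J i w)} = path_sum n k (\<lambda>x. of_bool (\<Phi> x))"
proof -
  have "prob {w \<in> space M. \<Phi> (\<lambda>i\<in>{..k}. J i w)} =
      (\<Sum>x\<in>{x\<in>paths n k. \<Phi> x}. prob {w \<in> space M. \<forall>i\<le>k. J i w = x i})"
    unfolding path_event_eq
  proof (rule finite_measure_finite_Union)
    show "disjoint_family_on (\<lambda>x. {w \<in> space M. \<forall>i\<le>k. J i w = x i}) {x \<in> paths n k. \<Phi> x}"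
      unfolding disjoint_family_on_def
    proof (intro ballI impI)
      fix x y assume xy: "x \<in> {x \<in> paths n k. \<Phi> x}" "y \<in> {x \<in> paths n k. \<Phi> x}" "x \<noteq> y"
      have "x = y" if "\<forall>i\<le>k. J i w = x i" "\<forall>i\<le>k. J i w = y i" for w
        using path_eq_iff[of x k w] path_eq_iff[of y k w] that xy by simp
      then show "{w \<in> space M. \<forall>i\<le>k. J i w = x i} \<inter> {w \<in> space M. \<forall>i\<le>k. J i w = y i} = {}"
        using xy(3) by blast
    qed
  qed (use sets_walk_path in auto)
  also have "\<dots> = (\<Sum>x\<in>{x\<in>paths n k. \<Phi> x}. path_weight n k x)"
  proof (intro sum.cong refl)
    fix x assume "x \<in> {x \<in> paths n k. \<Phi> x}"
    then have "x \<in> {..k} \<rightarrow> hypercube n" by (auto simp: paths_def)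
    then show "prob {w \<in> space M. \<forall>i\<le>k. J i w = x i} = path_weight n k x"
      using walk unfolding simple_random_walk_def path_weight_def by blast
  qed
  also have "\<dots> = path_sum n k (\<lambda>x. of_bool (\<Phi> x))"
    unfolding path_sum_def by (simp add: sum.inter_filter of_bool_def if_distrib cong: if_cong)
  finally show ?thesis .
qed

lemma prob_walk_at: 
  assumes v: "v \<in> hypercube n"
  shows "prob {w \<in> space M. J k w = v} = 1 / 2 ^ n"
  using prob_path_event[of "\<lambda>x. x k = v" k] path_sum_last[OF n, of k "\<lambda>u. of_bool (u = v)"] v
  by (simp add: of_bool_def cong: conj_cong)

lemma image_restrict_eq: "(\<lambda>i\<in>{..k}. J i w) ` {..k} = (\<lambda>i. J i w) ` {..k}"
  by (rule image_cong) auto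

text \<open>
  The landscape interacts with the walk only through the set of visited sites. Its law is a weight
  on the subsets of the hypercube, which separates the randomness of the walk from that of
  the landscape.
\<close>

definition range_law :: "nat \<Rightarrow> (nat \<Rightarrow> int) set \<Rightarrow> real" where
  "range_law k R = prob {w \<in> space M. (\<lambda>i. J i w) ` {..k} = R}"

lemma sum_range_law: "(\<Sum>R\<in>Pow (hypercube n). range_law k R * F R) = path_sum n k (\<lambda>x. F (x ` {..k}))"
proof -
  have "range_law k R = path_sum n k (\<lambda>x. of_bool (x ` {..k} = R))" for R
    using prob_path_event[of "\<lambda>x. x ` {..k} = R" k] by (simp add: range_law_def image_restrict_eq)
  then have "(\<Sum>R\<in>Pow (hypercube n). range_law k R * F R) =
      path_sum n k (\<lambda>x. \<Sum>R\<in>Pow (hypercube n). F R * of_bool (x ` {..k} = R))"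
    unfolding path_sum_sum path_sum_cmult by (simp add: mult.commute)
  also have "\<dots> = path_sum n k (\<lambda>x. F (x ` {..k}))"
  proof (rule path_sum_cong)
    fix x assume "x \<in> paths n k"
    then have "x ` {..k} \<in> Pow (hypercube n)" by (auto simp: paths_def)
    then show "(\<Sum>R\<in>Pow (hypercube n). F R * of_bool (x ` {..k} = R)) = F (x ` {..k})"
      by (simp add: of_bool_def if_distrib cong: if_cong)
  qed
  finally show ?thesis .
qed

lemma range_law_nonneg: "range_law k R \<ge> 0"
  by (simp add: range_law_def)

lemma range_law_total: "(\<Sum>R\<in>Pow (hypercube n). range_law k R) = 1"
  using sum_range_law[of k "\<lambda>_. 1"] path_sum_1[OF n] by simp

lemma range_law_visits:
  assumes v: "v \<in> hypercube n"
  shows "(\<Sum>R\<in>Pow (hypercube n). range_law k R * of_bool (v \<in> R)) \<le> real (k + 1) / 2 ^ n"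
proof -
  have "(\<Sum>R\<in>Pow (hypercube n). range_law k R * of_bool (v \<in> R)) = path_sum n k (\<lambda>x. of_bool (v \<in> x ` {..k}))"
    by (rule sum_range_law)
  also have "\<dots> \<le> path_sum n k (\<lambda>x. \<Sum>i\<le>k. of_bool (x i = v))"
  proof (rule path_sum_mono)
    fix x :: "nat \<Rightarrow> nat \<Rightarrow> int"
    show "of_bool (v \<in> x ` {..k}) \<le> (\<Sum>i\<le>k. of_bool (x i = v) :: real)"
    proof (cases "v \<in> x ` {..k}")
      case True
      then obtain i where i: "i \<le> k" "x i = v" by auto
      have "(1::real) = of_bool (x i = v)" using i by simp
      also have "\<dots> \<le> (\<Sum>i\<le>k. of_bool (x i = v))" by (rule member_le_sum) (use i in auto)
      finally show ?thesis using True by simp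
    qed (auto intro: sum_nonneg)
  qed
  also have "\<dots> = (\<Sum>i\<le>k. 1 / 2 ^ n)"
    unfolding path_sum_sum
  proof (intro sum.cong refl)
    fix i assume "i \<in> {..k}"
    then obtain d where d: "k = i + d" using le_Suc_ex by auto
    have "path_sum n (i + d) (\<lambda>x. of_bool (x i = v)) = path_sum n i (\<lambda>x. of_bool (x i = v))"
      by (rule path_sum_restrict[OF n]) simp
    also have "\<dots> = 1 / 2 ^ n"
      using path_sum_last[OF n, of i "\<lambda>u. of_bool (u = v)"] v by (simp add: of_bool_def)
    finally show "path_sum n k (\<lambda>x. of_bool (x i = v)) = 1 / 2 ^ n" using d by simp
  qed
  finally show ?thesis by simp
qed

lemma range_law_card_ge:
  "(\<Sum>R\<in>Pow (hypercube n). range_law k R * real (card R)) \<ge>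
     real (k + 1) * (1 - 2 / real n - real (k + 1) * (337 / 384) ^ n)"
  using path_sum_range_card_ge[OF n, of k] by (simp add: sum_range_law)

lemma prob_walk_avoids:
  "prob {w \<in> space M. \<forall>i\<le>k. J i w \<notin> A} = (\<Sum>R\<in>Pow (hypercube n). range_law k R * of_bool (\<forall>x\<in>R. x \<notin> A))"
  using prob_path_event[of "\<lambda>x. \<forall>i\<le>k. x i \<notin> A" k]
  unfolding sum_range_law by (simp add: atMost_def)

end

section \<open>Gaussian tail estimates\<close>

definition gauss_tail :: "real \<Rightarrow> real" where
  "gauss_tail u = (\<integral>x. std_normal_density x * indicator {..-u} x \<partial>lborel)"

lemma integrable_std_normal_indicator [simp]:
  "A \<in> sets borel \<Longrightarrow> integrable lborel (\<lambda>x. std_normal_density x * indicator A x)"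
  by (rule integrable_mult_indicator[of A lborel "std_normal_density", simplified real_scaleR_def, THEN
      Bochner_Integration.integrable_cong[THEN iffD1, rotated -1]]) (auto simp: mult.commute)

lemma (in prob_space) prob_std_normal_le:
  assumes X: "distributed M lborel X std_normal_density"
  shows "prob {w \<in> space M. X w \<le> - u} = gauss_tail u"
proof -
  have [measurable]: "X \<in> borel_measurable M" using distributed_measurable[OF X] by simp
  have "gauss_tail u = expectation (\<lambda>w. indicator {..-u} (X w))"
    unfolding gauss_tail_def by (rule distributed_integral[OF X]) auto
  also have "\<dots> = expectation (indicator {w \<in> space M. X w \<le> - u})"
    by (intro Bochner_Integration.integral_cong) (auto simp: indicator_def)
  finally show ?thesis by simp
qed

lemma std_normal_density_shift: "std_normal_density (x - u) = std_normal_density u * exp (u * x - x\<^sup>2 / 2)"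
proof -
  have "- (x - u)\<^sup>2 / 2 = - u\<^sup>2 / 2 + (u * x - x\<^sup>2 / 2)" by (simp add: power2_eq_square field_simps)
  then show ?thesis unfolding std_normal_density_def by (simp only: exp_add mult.assoc)
qed

lemma std_normal_density_antimono: "0 \<le> u \<Longrightarrow> u \<le> \<bar>x\<bar> \<Longrightarrow> std_normal_density x \<le> std_normal_density u"
  unfolding std_normal_density_def
  by (intro mult_left_mono) (auto simp: abs_le_square_iff[of u x, symmetric])

text \<open>
  Translating by \<open>u\<close> multiplies the density on the negative half-line by at most
  \<open>exp (- u\<^sup>2 / 2)\<close>.
\<close>

lemma gauss_tail_le_exp:
  assumes u: "u \<ge> 0"
  shows "gauss_tail u \<le> exp (- u\<^sup>2 / 2)"
proof -
  have "gauss_tail u = (\<integral>x. std_normal_density (- u + 1 * x) * indicator {..-u} (- u + 1 * x) \<partial>lborel)"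
    unfolding gauss_tail_def by (subst lborel_integral_real_affine[of 1 _ "- u"]) auto
  also have "\<dots> \<le> (\<integral>x. exp (- u\<^sup>2 / 2) * std_normal_density x \<partial>lborel)"
  proof (rule integral_mono)
    show "integrable lborel (\<lambda>x. std_normal_density (- u + 1 * x) * indicator {..-u} (- u + 1 * x) :: real)"
      by (rule lborel_integrable_real_affine) auto
    fix x :: real
    show "std_normal_density (- u + 1 * x) * indicator {..-u} (- u + 1 * x) \<le> exp (- u\<^sup>2 / 2) * std_normal_density x"
    proof (cases "x \<le> 0")
      case True
      have "std_normal_density (- u + 1 * x) = std_normal_density (u - x)"
        by (simp add: std_normal_density_def power2_commute)
      also have "\<dots> = std_normal_density x * exp (x * u - u\<^sup>2 / 2)" by (rule std_normal_density_shift)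
      also have "\<dots> \<le> std_normal_density x * exp (- u\<^sup>2 / 2)"
        using True u by (intro mult_left_mono) (auto simp: mult_nonpos_nonneg)
      finally show ?thesis using True by (simp add: mult.commute)
    qed (auto simp: indicator_def)
  qed auto
  finally show ?thesis by simp
qed

lemma integral_std_normal_interval:
  "x \<le> y \<Longrightarrow> (\<And>t. t \<in> {x<..y} \<Longrightarrow> std_normal_density t \<le> c) \<Longrightarrow>
     (\<integral>t. std_normal_density t * indicator {x<..y} t \<partial>lborel) \<le> c * (y - x)"
  "x \<le> y \<Longrightarrow> (\<And>t. t \<in> {x<..y} \<Longrightarrow> c \<le> std_normal_density t) \<Longrightarrow>
     c * (y - x) \<le> (\<integral>t. std_normal_density t * indicator {x<..y} t \<partial>lborel)"
proof -
  have *: "(\<integral>t. c * indicator {x<..y} t \<partial>lborel) = c * (y - x)" if "x \<le> y"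
    using that by simp
  have int: "integrable lborel (\<lambda>t. c * indicator {x<..y} t :: real)" if "x \<le> y"
    using that by (intro integrable_mult_right integrable_real_indicator) auto
  show "(\<integral>t. std_normal_density t * indicator {x<..y} t \<partial>lborel) \<le> c * (y - x)"
    if "x \<le> y" "\<And>t. t \<in> {x<..y} \<Longrightarrow> std_normal_density t \<le> c"
    unfolding *[OF that(1), symmetric]
    by (intro integral_mono int) (use that in \<open>auto split: split_indicator\<close>)
  show "c * (y - x) \<le> (\<integral>t. std_normal_density t * indicator {x<..y} t \<partial>lborel)"
    if "x \<le> y" "\<And>t. t \<in> {x<..y} \<Longrightarrow> c \<le> std_normal_density t"
    unfolding *[OF that(1), symmetric]
    by (intro integral_mono int) (use that in \<open>auto split: split_indicator\<close>)
qed

lemma gauss_tail_diff: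
  assumes "\<delta> \<ge> 0"
  shows "gauss_tail u - gauss_tail (u + \<delta>) = (\<integral>t. std_normal_density t * indicator {-(u+\<delta>)<..-u} t \<partial>lborel)"
proof -
  have "gauss_tail u - gauss_tail (u + \<delta>) =
      (\<integral>t. std_normal_density t * indicator {..-u} t - std_normal_density t * indicator {..-(u+\<delta>)} t \<partial>lborel)"
    unfolding gauss_tail_def by (rule Bochner_Integration.integral_diff[symmetric]) auto
  also have "\<dots> = (\<integral>t. std_normal_density t * indicator {-(u+\<delta>)<..-u} t \<partial>lborel)"
    by (intro Bochner_Integration.integral_cong) (use assms in \<open>auto split: split_indicator\<close>)
  finally show ?thesis .
qed

lemma gauss_tail_diff_le:
  assumes "u \<ge> 0" "\<delta> \<ge> 0"
  shows "gauss_tail u - gauss_tail (u + \<delta>) \<le> \<delta> * std_normal_density u"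
proof -
  have "(\<integral>t. std_normal_density t * indicator {-(u+\<delta>)<..-u} t \<partial>lborel) \<le> std_normal_density u * (- u - (-(u+\<delta>)))"
    by (rule integral_std_normal_interval) (use assms std_normal_density_antimono in auto)
  then show ?thesis using gauss_tail_diff[OF assms(2)] by (simp add: mult.commute)
qed

lemma gauss_tail_nonneg: "gauss_tail u \<ge> 0"
  unfolding gauss_tail_def by (intro Bochner_Integration.integral_nonneg) auto

text \<open>
  A lower Mills ratio bound up to a constant: on the interval of length \<open>1/u\<close> beyond \<open>u\<close> the density
  drops by a factor of at most \<open>exp (3/2)\<close>.
\<close>

lemma std_normal_density_le_gauss_tail:
  assumes u: "u \<ge> 1"
  shows "std_normal_density u \<le> exp (3 / 2) * u * gauss_tail u"
proof -
  have iu: "1 / u \<le> 1" "1 / u > 0" using u by auto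
  have "std_normal_density u * exp (- 3 / 2) * (- u - (- (u + 1 / u))) \<le>
      (\<integral>t. std_normal_density t * indicator {- (u + 1 / u)<..-u} t \<partial>lborel)"
  proof (rule integral_std_normal_interval)
    fix t assume t: "t \<in> {- (u + 1 / u)<..-u}"
    have "std_normal_density u * exp (- 3 / 2) \<le> std_normal_density u * exp (u * (- 1 / u) - (- 1 / u)\<^sup>2 / 2)"
    proof (intro mult_left_mono)
      have "(- 1 / u)\<^sup>2 = (1 / u)\<^sup>2" by (simp add: power_divide)
      also have "\<dots> \<le> 1" using iu by (intro power_le_one) auto
      finally have "(- 1 / u)\<^sup>2 \<le> 1" .
      moreover have "u * (- 1 / u) = - 1" using u by simp
      ultimately show "exp (- 3 / 2) \<le> exp (u * (- 1 / u) - (- 1 / u)\<^sup>2 / 2)"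
        unfolding exp_le_cancel_iff by linarith
    qed auto
    also have "\<dots> = std_normal_density (- 1 / u - u)" by (rule std_normal_density_shift[symmetric])
    also have "\<dots> = std_normal_density (u + 1 / u)"
      unfolding std_normal_density_def by (simp add: power2_eq_square algebra_simps)
    also have "\<dots> = std_normal_density \<bar>u + 1 / u\<bar>" using iu u by simp
    also have "\<dots> \<le> std_normal_density \<bar>t\<bar>" using t u iu by (intro std_normal_density_antimono) auto
    also have "\<dots> = std_normal_density t" by (simp add: std_normal_density_def)
    finally show "std_normal_density u * exp (- 3 / 2) \<le> std_normal_density t" .
  qed (use iu in auto)
  also have "\<dots> \<le> gauss_tail u"
    using gauss_tail_diff[of "1 / u" u] iu gauss_tail_nonneg[of "u + 1 / u"] by simp
  finally have "std_normal_density u * exp (- 3 / 2) * (1 / u) \<le> gauss_tail u" by simp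
  then have "(exp (3 / 2) * u) * (std_normal_density u * exp (- 3 / 2) * (1 / u)) \<le> (exp (3 / 2) * u) * gauss_tail u"
    using u by (intro mult_left_mono) auto
  moreover have "(exp (3 / 2) * u) * (std_normal_density u * exp (- 3 / 2) * (1 / u)) = std_normal_density u"
  proof -
    have "exp (3 / 2) * exp (- 3 / 2 :: real) = 1" by (simp flip: exp_add)
    then show ?thesis using u by (simp add: field_simps)
  qed
  ultimately show ?thesis by simp
qed

lemma integral_exp_decay:
  assumes l: "l > 0"
  shows "integrable lborel (\<lambda>x. exp (- l * x) * indicator {0<..} x :: real)"
    "(\<integral>x. exp (- l * x) * indicator {0<..} x \<partial>lborel) = 1 / l"
proof -
  interpret prob_space "density lborel (exponential_density l)"
    by (rule prob_space_exponential_density[OF l])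
  have "(\<integral>\<^sup>+x. ennreal (exponential_density l x) \<partial>lborel) = 1"
    using emeasure_space_1 by (simp add: emeasure_density)
  then have hb: "has_bochner_integral lborel (exponential_density l) 1"
    using l by (intro has_bochner_integral_nn_integral) (auto simp: exponential_density_def)
  have eq: "AE x in lborel. exponential_density l x / l = exp (- l * x) * indicator {0<..} x"
    using AE_lborel_singleton[of 0]
    by eventually_elim (use l in \<open>auto simp: exponential_density_def indicator_def mult.commute\<close>)
  have hb': "has_bochner_integral lborel (\<lambda>x. exponential_density l x / l) (1 / l)"
    by (rule has_bochner_integral_divide_zero[OF hb])
  have "has_bochner_integral lborel (\<lambda>x. exp (- l * x) * indicator {0<..} x :: real) (1 / l)"
    using hb' by (rule has_bochner_integral_cong_AE[THEN iffD1, rotated -1]) (use eq in \<open>auto simp: exponential_density_def\<close>)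
  then show "integrable lborel (\<lambda>x. exp (- l * x) * indicator {0<..} x :: real)"
    "(\<integral>x. exp (- l * x) * indicator {0<..} x \<partial>lborel) = 1 / l"
    by (auto simp: has_bochner_integral_iff)
qed

text \<open>
  For \<open>s\<close> above \<open>u\<close> the exponential weight wins over the Gaussian density up to the cutoff, so the
  truncated moment is concentrated at the cutoff \<open>- u\<close>.
\<close>

lemma (in prob_space) truncated_exponential_moment_le:
  assumes X: "distributed M lborel X std_normal_density" and s: "u < s" "0 \<le> s"
  shows "expectation (\<lambda>w. exp (- s * X w) * indicator {- u<..} (X w)) \<le> exp (s * u) * std_normal_density u / (s - u)"
proof -
  define g :: "real \<Rightarrow> real" where "g x = exp (- s * x) * indicator {- u<..} x" for x
  have [measurable]: "g \<in> borel_measurable borel" unfolding g_def by measurable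
  have int: "integrable lborel (\<lambda>x. std_normal_density x * g x)"
  proof (rule Bochner_Integration.integrable_bound[of _ "\<lambda>x. exp (s * u) * std_normal_density x"])
    show "AE x in lborel. norm (std_normal_density x * g x) \<le> norm (exp (s * u) * std_normal_density x)"
    proof (rule AE_I2)
      fix x
      have "g x \<le> exp (s * u)"
        unfolding g_def indicator_def using s mult_left_mono[of "- x" u s] by auto
      then have "std_normal_density x * g x \<le> std_normal_density x * exp (s * u)" by (intro mult_left_mono) auto
      then show "norm (std_normal_density x * g x) \<le> norm (exp (s * u) * std_normal_density x)"
        by (simp add: g_def abs_mult mult_ac)
    qed
  qed auto
  have "expectation (\<lambda>w. g (X w)) = (\<integral>x. std_normal_density x * g x \<partial>lborel)"
    by (rule distributed_integral[OF X, symmetric]) auto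
  also have "\<dots> = (\<integral>x. std_normal_density (- u + 1 * x) * g (- u + 1 * x) \<partial>lborel)"
    by (subst lborel_integral_real_affine[of 1 _ "- u"]) auto
  also have "\<dots> \<le> (\<integral>x. exp (s * u) * std_normal_density u * (exp (- (s - u) * x) * indicator {0<..} x) \<partial>lborel)"
  proof (rule integral_mono)
    show "integrable lborel (\<lambda>x. std_normal_density (- u + 1 * x) * g (- u + 1 * x))"
      using int by (rule lborel_integrable_real_affine) simp
    show "integrable lborel (\<lambda>x. exp (s * u) * std_normal_density u * (exp (- (s - u) * x) * indicator {0<..} x) :: real)"
      using s by (intro integrable_mult_right integral_exp_decay) auto
    fix x :: real
    show "std_normal_density (- u + 1 * x) * g (- u + 1 * x) \<le>
        exp (s * u) * std_normal_density u * (exp (- (s - u) * x) * indicator {0<..} x)"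
    proof (cases "x > 0")
      case True
      have "std_normal_density (- u + 1 * x) = std_normal_density u * exp (u * x - x\<^sup>2 / 2)"
        using std_normal_density_shift[of x u] by simp
      also have "\<dots> \<le> std_normal_density u * exp (u * x)" by (intro mult_left_mono) auto
      finally have "std_normal_density (- u + 1 * x) * exp (s * u - s * x) \<le>
          std_normal_density u * exp (u * x) * exp (s * u - s * x)"
        by (intro mult_right_mono) auto
      also have "\<dots> = exp (s * u) * std_normal_density u * exp (- (s - u) * x)"
      proof -
        have "exp (u * x) * exp (s * u - s * x) = exp (s * u) * exp (- (s - u) * x)"
          unfolding exp_add[symmetric] by (simp add: algebra_simps)
        then show ?thesis by (simp only: mult.assoc mult.left_commute)
      qed
      finally show ?thesis using True by (simp add: g_def algebra_simps)
    qed (auto simp: g_def)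
  qed
  also have "\<dots> = exp (s * u) * std_normal_density u / (s - u)"
    using integral_exp_decay(2)[of "s - u"] s by (simp only: integral_mult_right_zero) simp
  finally show ?thesis unfolding g_def .
qed

section \<open>Short scales: slow variation of the trap depths\<close>

text \<open>
  A short space scale, with the defining relation of \<open>b\<close> expressed through the Gaussian tail.
\<close>

locale short_scale =
  fixes \<beta> :: real and r b :: "nat \<Rightarrow> real"
  assumes \<beta>: "\<beta> > 0"
    and r: "\<And>n. n \<ge> 1 \<Longrightarrow> r n > 0"
    and b_tail: "\<And>n. n \<ge> 1 \<Longrightarrow> b n * gauss_tail (ln (r n) / (\<beta> * sqrt (real n))) = 1"
    and ln_b_at_top: "filterlim (\<lambda>n. ln (b n)) at_top sequentially"
    and ln_b_small: "(\<lambda>n. ln (b n) / real n) \<longlonglongrightarrow> 0"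
    and r_lower: "\<And>n. n \<ge> 1 \<Longrightarrow> ln (r n) / (\<beta> * sqrt (real n)) \<ge> 4 * sqrt (ln (real n))"
begin

definition depth :: "nat \<Rightarrow> real" where "depth n = ln (r n) / (\<beta> * sqrt (real n))"

text \<open>
  The factor \<open>M\<close> by which deep traps exceed the scale \<open>r\<close>. With \<open>\<kappa> = depth / (\<beta> \<surd>n)\<close> it is
  \<open>\<kappa>\<close> to the power \<open>-1/2\<close>: it diverges, while \<open>M \<kappa>\<close>, which bounds all error terms, tends to
  \<open>0\<close>.
\<close>

definition blowup :: "nat \<Rightarrow> real" where "blowup n = sqrt (\<beta> * sqrt (real n) / depth n)"

text \<open>
  A trap has depth at least \<open>blowup * r\<close> iff its Gaussian variable is at most \<open>- top_depth\<close>.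
\<close>

definition top_depth :: "nat \<Rightarrow> real" where "top_depth n = depth n + ln (blowup n) / (\<beta> * sqrt (real n))"

lemma b_pos: "n \<ge> 1 \<Longrightarrow> b n > 0"
  using b_tail[of n] gauss_tail_nonneg by (metis less_eq_real_def mult_nonpos_nonneg not_le zero_less_one)

lemma b_at_top: "filterlim b at_top sequentially"
proof -
  have "filterlim (\<lambda>n. exp (ln (b n))) at_top sequentially"
    by (rule filterlim_compose[OF exp_at_top ln_b_at_top])
  moreover have "eventually (\<lambda>n. exp (ln (b n)) = b n) sequentially"
    using eventually_ge_at_top[of 1] by eventually_elim (simp add: b_pos)
  ultimately show ?thesis using filterlim_cong[OF refl refl] by metis
qed

lemma depth_at_top: "filterlim depth at_top sequentially"
proof (rule filterlim_at_top_mono)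
  show "filterlim (\<lambda>n. 4 * sqrt (ln (real n))) at_top sequentially"
    by real_asymp
  show "eventually (\<lambda>n. 4 * sqrt (ln (real n)) \<le> depth n) sequentially"
    using eventually_ge_at_top[of 1] by eventually_elim (simp add: depth_def r_lower)
qed

lemma depth_ge_1: "eventually (\<lambda>n. depth n \<ge> 1) sequentially"
  using depth_at_top by (simp add: filterlim_at_top)

lemma depth_square_le: "eventually (\<lambda>n. (depth n)\<^sup>2 \<le> 2 * ln (b n)) sequentially"
  using depth_ge_1 eventually_ge_at_top[of 1]
proof eventually_elim
  case (elim n)
  have "1 \<le> b n * exp (- (depth n)\<^sup>2 / 2)"
    using b_tail[of n] elim b_pos[of n] gauss_tail_le_exp[of "depth n"]
    by (metis depth_def mult_left_mono less_imp_le order_trans zero_le_one)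
  then have "exp ((depth n)\<^sup>2 / 2) \<le> b n" by (simp add: exp_minus field_simps)
  then have "(depth n)\<^sup>2 / 2 \<le> ln (b n)" using b_pos[of n] elim ln_ge_iff[of "b n"] by blast
  then show ?case by simp
qed

text \<open>
  The Gaussian tail gives \<open>u\<^sup>2 \<le> 2 ln b\<close>, and \<open>ln b\<close> is small compared with \<open>n\<close>. This
  limit is the source of the slow variation of the trap depths.
\<close>

lemma depth_ratio: "(\<lambda>n. depth n / (\<beta> * sqrt (real n))) \<longlonglongrightarrow> 0"
proof -
  have "(\<lambda>n. (depth n / (\<beta> * sqrt (real n)))\<^sup>2) \<longlonglongrightarrow> 0"
  proof (rule tendsto_sandwich[OF _ _ tendsto_const])
    show "(\<lambda>n. 2 / \<beta>\<^sup>2 * (ln (b n) / real n)) \<longlonglongrightarrow> 0"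
      by (rule tendsto_mult_right_zero[OF ln_b_small])
    show "eventually (\<lambda>n. (depth n / (\<beta> * sqrt (real n)))\<^sup>2 \<le> 2 / \<beta>\<^sup>2 * (ln (b n) / real n)) sequentially"
      using depth_square_le eventually_ge_at_top[of 1]
    proof eventually_elim
      case (elim n)
      have "(depth n / (\<beta> * sqrt (real n)))\<^sup>2 = (depth n)\<^sup>2 / (\<beta>\<^sup>2 * real n)"
        by (simp add: power_divide power_mult_distrib)
      also have "\<dots> \<le> 2 * ln (b n) / (\<beta>\<^sup>2 * real n)" using elim by (intro divide_right_mono) auto
      finally show ?case by simp
    qed
  qed auto
  then show ?thesis by simp
qed

lemma blowup_eq: "eventually (\<lambda>n. depth n > 0 \<and> blowup n > 0 \<and> blowup n * (depth n / (\<beta> * sqrt (real n))) = sqrt (depth n / (\<beta> * sqrt (real n)))) sequentially"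
  using depth_ge_1 eventually_ge_at_top[of 1]
proof eventually_elim
  case (elim n)
  define s where "s = \<beta> * sqrt (real n)"
  have s: "s > 0" using elim \<beta> by (simp add: s_def)
  have "sqrt (s / depth n) * (depth n / s) = sqrt (depth n / s)"
    using s elim by (simp add: real_sqrt_divide field_simps flip: power2_eq_square)
  then show ?case using elim s unfolding blowup_def s_def by simp
qed

lemma sqrt_depth_ratio: "(\<lambda>n. sqrt (depth n / (\<beta> * sqrt (real n)))) \<longlonglongrightarrow> 0"
  using tendsto_real_sqrt[OF depth_ratio] by simp

lemma blowup_at_top: "filterlim blowup at_top sequentially"
proof -
  have "filterlim (\<lambda>n. inverse (sqrt (depth n / (\<beta> * sqrt (real n))))) at_top sequentially"
  proof (rule filterlim_inverse_at_top[OF sqrt_depth_ratio])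
    show "eventually (\<lambda>n. 0 < sqrt (depth n / (\<beta> * sqrt (real n)))) sequentially"
      using depth_ge_1 eventually_ge_at_top[of 1] by eventually_elim (use \<beta> in auto)
  qed
  then show ?thesis by (simp add: blowup_def[abs_def] real_sqrt_inverse[symmetric])
qed

lemma eventually_scales:
  "eventually (\<lambda>n. n \<ge> 1 \<and> depth n \<ge> 1 \<and> blowup n \<ge> 1 \<and> depth n \<le> top_depth n \<and> top_depth n < \<beta> * sqrt (real n) \<and>
     depth n * (top_depth n - depth n) \<le> sqrt (depth n / (\<beta> * sqrt (real n))) \<and>
     top_depth n \<le> 2 * depth n) sequentially"
proof -
  have "eventually (\<lambda>n. blowup n \<ge> 1) sequentially"
    using blowup_at_top by (simp add: filterlim_at_top)
  moreover have "eventually (\<lambda>n. depth n / (\<beta> * sqrt (real n)) < 1 / 2) sequentially"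
    using order_tendstoD(2)[OF depth_ratio, of "1 / 2"] by simp
  ultimately show ?thesis
    using depth_ge_1 blowup_eq eventually_ge_at_top[of 1]
  proof eventually_elim
    case (elim n)
    define s where "s = \<beta> * sqrt (real n)"
    have s: "s > 0" using elim \<beta> by (simp add: s_def)
    have \<kappa>: "depth n / s < 1 / 2" "blowup n * (depth n / s) = sqrt (depth n / s)" using elim by (auto simp: s_def)
    have ln: "0 \<le> ln (blowup n)" "ln (blowup n) \<le> blowup n" using elim ln_le_minus_one[of "blowup n"] by auto
    have diff: "top_depth n - depth n = ln (blowup n) / s" by (simp add: top_depth_def s_def)
    have 1: "depth n * (ln (blowup n) / s) \<le> sqrt (depth n / s)"
    proof -
      have "depth n * (ln (blowup n) / s) \<le> depth n * (blowup n / s)"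
        using elim s ln by (intro mult_left_mono divide_right_mono) auto
      then show ?thesis using \<kappa>(2) by (simp add: mult.commute)
    qed
    have "sqrt (depth n / s) \<le> 1" using \<kappa> s elim by (auto intro: real_le_lsqrt)
    then have "depth n * (ln (blowup n) / s) \<le> depth n * 1" using 1 elim by linarith
    then have 2: "ln (blowup n) / s \<le> depth n"
      using elim mult_left_le_imp_le[of "depth n" "ln (blowup n) / s" 1] by linarith
    have 3: "0 \<le> ln (blowup n) / s" using ln s by simp
    have 4: "2 * depth n < s" using \<kappa>(1) s by (simp add: field_simps)
    have "depth n \<le> top_depth n" "top_depth n \<le> 2 * depth n" "top_depth n < s"
      using diff 2 3 4 by linarith+
    then show ?case using elim 1 unfolding s_def[symmetric] diff by simp
  qed
qed

lemma density_depth_le: "eventually (\<lambda>n. b n * std_normal_density (depth n) \<le> exp (3 / 2) * depth n) sequentially"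
  using depth_ge_1 eventually_ge_at_top[of 1]
proof eventually_elim
  case (elim n)
  have "b n * std_normal_density (depth n) \<le> b n * (exp (3 / 2) * depth n * gauss_tail (depth n))"
    using std_normal_density_le_gauss_tail[of "depth n"] elim b_pos[of n] by (intro mult_left_mono) auto
  also have "\<dots> = exp (3 / 2) * depth n * (b n * gauss_tail (depth n))" by simp
  also have "b n * gauss_tail (depth n) = 1" using b_tail elim by (simp add: depth_def)
  finally show ?case by simp
qed

text \<open>
  Slow variation: the tail at \<open>u\<close> has decay rate about \<open>u\<close>, and the shift from \<open>depth\<close> to
  \<open>top_depth\<close> is small compared with \<open>1/u\<close>.
\<close>

lemma top_tail_limit: "(\<lambda>n. b n * gauss_tail (top_depth n)) \<longlonglongrightarrow> 1"
proof (rule tendsto_sandwich)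
  show "(\<lambda>n. 1 - exp (3 / 2) * sqrt (depth n / (\<beta> * sqrt (real n)))) \<longlonglongrightarrow> 1"
    using tendsto_diff[OF tendsto_const[of 1] tendsto_mult_right_zero[OF sqrt_depth_ratio, of "exp (3 / 2)"]] by simp
  show "eventually (\<lambda>n. 1 - exp (3 / 2) * sqrt (depth n / (\<beta> * sqrt (real n))) \<le> b n * gauss_tail (top_depth n)) sequentially"
    using eventually_scales density_depth_le
  proof eventually_elim
    case (elim n)
    let ?d = "top_depth n - depth n"
    have b1: "b n * gauss_tail (depth n) = 1" using b_tail elim by (simp add: depth_def)
    have "gauss_tail (depth n) - gauss_tail (depth n + ?d) \<le> ?d * std_normal_density (depth n)"
      using elim by (intro gauss_tail_diff_le) auto
    then have "b n * (gauss_tail (depth n) - gauss_tail (top_depth n)) \<le> b n * (?d * std_normal_density (depth n))"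
      using b_pos[of n] elim by (intro mult_left_mono) auto
    also have "\<dots> = ?d * (b n * std_normal_density (depth n))" by simp
    also have "\<dots> \<le> ?d * (exp (3 / 2) * depth n)" using elim by (intro mult_left_mono) auto
    also have "\<dots> = exp (3 / 2) * (depth n * ?d)" by simp
    also have "\<dots> \<le> exp (3 / 2) * sqrt (depth n / (\<beta> * sqrt (real n)))" using elim by (intro mult_left_mono) auto
    finally show ?case using b1 by (simp add: right_diff_distrib)
  qed
  show "eventually (\<lambda>n. b n * gauss_tail (top_depth n) \<le> 1) sequentially"
    using eventually_scales
  proof eventually_elim
    case (elim n)
    have "gauss_tail (top_depth n) \<le> gauss_tail (depth n)"
      unfolding gauss_tail_def using elim by (intro integral_mono) (auto split: split_indicator)
    then have "b n * gauss_tail (top_depth n) \<le> b n * gauss_tail (depth n)"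
      using b_pos[of n] elim by (intro mult_left_mono) auto
    also have "\<dots> = 1" using b_tail elim by (simp add: depth_def)
    finally show ?case .
  qed
qed auto

text \<open>
  The expression is \<open>b / r\<close> times the bound of \<open>truncated_exponential_moment_le\<close> at the cutoff
  \<open>top_depth\<close>.
\<close>

lemma small_traps_limit:
  "(\<lambda>n. b n * (blowup n * std_normal_density (top_depth n) / (\<beta> * sqrt (real n) - top_depth n))) \<longlonglongrightarrow> 0"
proof (rule tendsto_sandwich[OF _ _ tendsto_const])
  let ?k = "\<lambda>n. depth n / (\<beta> * sqrt (real n))"
  have "(\<lambda>n. exp (3 / 2) * (sqrt (?k n) / (1 - 2 * ?k n))) \<longlonglongrightarrow> exp (3 / 2) * (0 / (1 - 2 * 0))"
    by (intro tendsto_intros sqrt_depth_ratio depth_ratio) auto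
  then show "(\<lambda>n. exp (3 / 2) * (sqrt (?k n) / (1 - 2 * ?k n))) \<longlonglongrightarrow> 0" by simp
  show "eventually (\<lambda>n. 0 \<le> b n * (blowup n * std_normal_density (top_depth n) / (\<beta> * sqrt (real n) - top_depth n))) sequentially"
    using eventually_scales
    by eventually_elim (use b_pos in \<open>auto intro!: mult_nonneg_nonneg divide_nonneg_nonneg simp: less_imp_le\<close>)
  have "eventually (\<lambda>n. ?k n < 1 / 2) sequentially"
    using order_tendstoD(2)[OF depth_ratio, of "1 / 2"] by simp
  then show "eventually (\<lambda>n. b n * (blowup n * std_normal_density (top_depth n) / (\<beta> * sqrt (real n) - top_depth n))
      \<le> exp (3 / 2) * (sqrt (?k n) / (1 - 2 * ?k n))) sequentially"
    using eventually_scales density_depth_le blowup_eq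
  proof eventually_elim
    case (elim n)
    define s where "s = \<beta> * sqrt (real n)"
    have s: "s > 0" using elim \<beta> by (simp add: s_def)
    have 4: "2 * depth n < s" using elim s unfolding s_def[symmetric] by (simp add: field_simps)
    have "b n * std_normal_density (top_depth n) \<le> b n * std_normal_density (depth n)"
      using elim b_pos[of n] by (intro mult_left_mono std_normal_density_antimono) auto
    also have "\<dots> \<le> exp (3 / 2) * depth n" using elim by simp
    finally have "b n * std_normal_density (top_depth n) * (blowup n / (s - top_depth n)) \<le>
        exp (3 / 2) * depth n * (blowup n / (s - 2 * depth n))"
    proof (rule mult_mono)
      show "blowup n / (s - top_depth n) \<le> blowup n / (s - 2 * depth n)"
        using elim 4 by (intro divide_left_mono) (auto simp: s_def)
    qed (use elim in \<open>auto simp: s_def\<close>)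
    also have "\<dots> = exp (3 / 2) * ((blowup n * (depth n / s)) / (1 - 2 * (depth n / s)))"
      using s 4 by (simp add: field_simps)
    also have "blowup n * (depth n / s) = sqrt (depth n / s)" using elim by (simp add: s_def)
    finally show ?case unfolding s_def by (simp add: mult_ac)
  qed
qed

end

section \<open>Second moments over a random landscape\<close>

text \<open>
  The series of the squares has finite expectation, hence converges almost surely. As this
  argument does not see how the variables are coupled, it handles landscapes on a common space whose
  joint law is arbitrary.
\<close>

lemma (in prob_space) AE_tendsto_0_if_summable_second_moments:
  fixes X :: "nat \<Rightarrow> 'a \<Rightarrow> real"
  assumes meas [measurable]: "\<And>n. X n \<in> borel_measurable M"
    and int: "\<And>n. n \<ge> n0 \<Longrightarrow> integrable M (\<lambda>w. (X n w)\<^sup>2)"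
    and le: "\<And>n. n \<ge> n0 \<Longrightarrow> expectation (\<lambda>w. (X n w)\<^sup>2) \<le> v n" and v: "summable v"
  shows "AE w in M. (\<lambda>n. X n w) \<longlonglongrightarrow> 0"
proof -
  have v0: "v n \<ge> 0" if "n \<ge> n0" for n
    by (rule order_trans[OF _ le[OF that]]) simp
  have "(\<integral>\<^sup>+w. (\<Sum>n. ennreal ((X (n + n0) w)\<^sup>2)) \<partial>M) = (\<Sum>n. \<integral>\<^sup>+w. ennreal ((X (n + n0) w)\<^sup>2) \<partial>M)"
    by (rule nn_integral_suminf) measurable
  also have "\<dots> = (\<Sum>n. ennreal (expectation (\<lambda>w. (X (n + n0) w)\<^sup>2)))"
    by (intro suminf_cong nn_integral_eq_integral int) auto
  also have "\<dots> \<le> (\<Sum>n. ennreal (v (n + n0)))"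
    by (intro suminf_le ennreal_leI le) auto
  also have "\<dots> < \<infinity>"
    using summable_ignore_initial_segment[OF v, of n0] v0
    by (subst suminf_ennreal2) auto
  finally have "AE w in M. (\<Sum>n. ennreal ((X (n + n0) w)\<^sup>2)) \<noteq> \<infinity>"
    by (intro nn_integral_noteq_infinite) auto
  then show ?thesis
  proof eventually_elim
    case (elim w)
    then have "summable (\<lambda>n. (X (n + n0) w)\<^sup>2)"
      by (intro summable_suminf_not_top) auto
    then have "(\<lambda>n. (X (n + n0) w)\<^sup>2) \<longlonglongrightarrow> 0" by (rule summable_LIMSEQ_zero)
    then have "(\<lambda>n. X (n + n0) w) \<longlonglongrightarrow> 0" by simp
    then show ?case by (rule LIMSEQ_offset)
  qed
qed

lemma (in prob_space) prob_all_gt: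
  fixes X :: "'i \<Rightarrow> 'a \<Rightarrow> real"
  assumes V: "finite V" and X: "indep_vars (\<lambda>_. borel) X V"
    and p: "\<And>x. x \<in> V \<Longrightarrow> prob {w \<in> space M. X x w \<le> c} = p" and R: "R \<subseteq> V"
  shows "prob {w \<in> space M. \<forall>x\<in>R. X x w > c} = (1 - p) ^ card R"
proof (cases "R = {}")
  case True
  then show ?thesis by (simp add: prob_space)
next
  case False
  have meas: "X x \<in> borel_measurable M" if "x \<in> V" for x using X that by (simp add: indep_vars_def2)
  have gt: "prob (X x -` {c<..} \<inter> space M) = 1 - p" if x: "x \<in> V" for x
  proof -
    have [measurable]: "X x \<in> borel_measurable M" using meas x .
    have "prob {w \<in> space M. \<not> X x w \<le> c} = 1 - prob {w \<in> space M. X x w \<le> c}"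
      by (rule prob_neg) measurable
    moreover have "X x -` {c<..} \<inter> space M = {w \<in> space M. \<not> X x w \<le> c}" by auto
    ultimately show ?thesis using p[OF x] by simp
  qed
  have "prob (\<Inter>x\<in>R. X x -` {c<..} \<inter> space M) = (\<Prod>x\<in>R. prob (X x -` {c<..} \<inter> space M))"
    using R V finite_subset by (intro indep_varsD_finite[OF indep_vars_subset[OF X R]] False) auto
  also have "\<dots> = (\<Prod>x\<in>R. 1 - p)" using gt R by (intro prod.cong) auto
  also have "(\<Inter>x\<in>R. X x -` {c<..} \<inter> space M) = {w \<in> space M. \<forall>x\<in>R. X x w > c}" using False by auto
  finally show ?thesis by simp
qed

lemma power_diff_le_Bernoulli:
  fixes p :: real
  assumes "0 \<le> p" "p \<le> 1" "r \<le> k"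
  shows "(1 - p) ^ r - (1 - p) ^ k \<le> p * (real k - real r)"
proof -
  obtain d where d: "k = r + d" using assms(3) le_Suc_ex by blast
  have "1 + real d * (- p) \<le> (1 + - p) ^ d" using assms by (intro Bernoulli_inequality) auto
  then have *: "1 - (1 - p) ^ d \<le> real d * p" by simp
  have "(1 - p) ^ r - (1 - p) ^ k = (1 - p) ^ r * (1 - (1 - p) ^ d)" by (simp add: d power_add algebra_simps)
  also have "\<dots> \<le> 1 * (1 - (1 - p) ^ d)"
    using assms by (intro mult_right_mono) (auto intro!: power_le_one)
  finally show ?thesis using * by (simp add: d mult.commute)
qed

text \<open>
  \<open>Q\<close> is the probability that a random set \<open>R\<close> with law \<open>W\<close> avoids the random set of sites where
  \<open>X\<close> is at most \<open>c\<close>. Its square is the probability that two independent copies \<open>R\<close> and \<open>R'\<close> do so,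
  which involves \<open>card (R \<union> R')\<close> sites. The shortfall from \<open>card R + card R'\<close> is due to
  the common sites, whose expected number is the sum over sites of the squared visit probabilities.
\<close>

lemma (in prob_space)
  fixes X :: "'i \<Rightarrow> 'a \<Rightarrow> real" and W :: "'i set \<Rightarrow> real"
  assumes V: "finite V" and X: "indep_vars (\<lambda>_. borel) X V"
    and p: "\<And>x. x \<in> V \<Longrightarrow> prob {w \<in> space M. X x w \<le> c} = p" and V0: "V \<noteq> {}"
    and W0: "\<And>R. W R \<ge> 0" and W1: "\<And>v. v \<in> V \<Longrightarrow> (\<Sum>R\<in>Pow V. W R * of_bool (v \<in> R)) \<le> q"
  defines "Q \<equiv> \<lambda>w. \<Sum>R\<in>Pow V. W R * of_bool (\<forall>x\<in>R. \<not> X x w \<le> c)"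
    and "m \<equiv> \<Sum>R\<in>Pow V. W R * (1 - p) ^ card R"
  shows avoidance_measurable: "Q \<in> borel_measurable M"
    and avoidance_integrable: "integrable M (\<lambda>w. (Q w - m)\<^sup>2)"
    and avoidance_variance: "expectation (\<lambda>w. (Q w - m)\<^sup>2) \<le> p * q\<^sup>2 * real (card V)"
proof -
  have meas: "X x \<in> borel_measurable M" if "x \<in> V" for x using X that by (simp add: indep_vars_def2)
  define E where "E R = {w \<in> space M. \<forall>x\<in>R. X x w > c}" for R
  have E [measurable]: "E R \<in> events" if "R \<subseteq> V" for R
  proof -
    have "finite R" using V that finite_subset by blast
    have "{w \<in> space M. X x w > c} \<in> events" if "x \<in> R" for x
    proof -
      have [measurable]: "X x \<in> borel_measurable M" using meas \<open>R \<subseteq> V\<close> that by blast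
      show ?thesis by measurable
    qed
    then show ?thesis unfolding E_def using \<open>finite R\<close> by (intro sets.sets_Collect_finite_All) auto
  qed
  have PE: "prob (E R) = (1 - p) ^ card R" if "R \<subseteq> V" for R
    unfolding E_def by (rule prob_all_gt[OF V X p that])
  have Q: "Q w = (\<Sum>R\<in>Pow V. W R * indicator (E R) w)" if "w \<in> space M" for w
    unfolding Q_def using that by (intro sum.cong) (auto simp: E_def indicator_def not_le)
  have [measurable]: "(\<lambda>w. \<Sum>R\<in>Pow V. W R * indicator (E R) w) \<in> borel_measurable M"
    by (intro borel_measurable_sum borel_measurable_times borel_measurable_indicator) (auto intro: E)
  show Qm: "Q \<in> borel_measurable M"
    by (subst measurable_cong[OF Q]) auto
  have intI: "integrable M (\<lambda>w. W R * indicator (E R) w)" if "R \<in> Pow V" for R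
    using E that by (intro integrable_mult_right integrable_real_indicator) (auto simp: emeasure_eq_measure)
  have EQ: "expectation Q = m"
  proof -
    have "expectation Q = expectation (\<lambda>w. \<Sum>R\<in>Pow V. W R * indicator (E R) w)"
      by (intro Bochner_Integration.integral_cong Q) auto
    also have "\<dots> = (\<Sum>R\<in>Pow V. expectation (\<lambda>w. W R * indicator (E R) w))"
      by (rule Bochner_Integration.integral_sum) (rule intI)
    also have "\<dots> = m" unfolding m_def using PE E by (intro sum.cong) (auto simp: emeasure_eq_measure)
    finally show ?thesis .
  qed
  have sq: "(Q w)\<^sup>2 = (\<Sum>R\<in>Pow V. \<Sum>R'\<in>Pow V. W R * W R' * indicator (E (R \<union> R')) w)" if "w \<in> space M" for w
  proof -
    have "indicator (E R) w * indicator (E R') w = (indicator (E (R \<union> R')) w :: real)" for R R'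
      by (auto simp: E_def indicator_def)
    then show ?thesis unfolding Q[OF that] power2_eq_square sum_product
      by (intro sum.cong refl) (metis (no_types, lifting) mult.assoc mult.left_commute)
  qed
  have intI2: "integrable M (\<lambda>w. W R * W R' * indicator (E (R \<union> R')) w)" if "R \<in> Pow V" "R' \<in> Pow V" for R R'
    using E that by (intro integrable_mult_right integrable_real_indicator) (auto simp: emeasure_eq_measure)
  have EQ2: "expectation (\<lambda>w. (Q w)\<^sup>2) = (\<Sum>R\<in>Pow V. \<Sum>R'\<in>Pow V. W R * W R' * (1 - p) ^ card (R \<union> R'))"
  proof -
    have "expectation (\<lambda>w. (Q w)\<^sup>2) =
        expectation (\<lambda>w. \<Sum>R\<in>Pow V. \<Sum>R'\<in>Pow V. W R * W R' * indicator (E (R \<union> R')) w)"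
      by (intro Bochner_Integration.integral_cong sq) auto
    also have "\<dots> = (\<Sum>R\<in>Pow V. \<Sum>R'\<in>Pow V. expectation (\<lambda>w. W R * W R' * indicator (E (R \<union> R')) w))"
      by (subst Bochner_Integration.integral_sum, intro Bochner_Integration.integrable_sum intI2, assumption, assumption,
          intro sum.cong refl Bochner_Integration.integral_sum intI2)
    also have "\<dots> = (\<Sum>R\<in>Pow V. \<Sum>R'\<in>Pow V. W R * W R' * (1 - p) ^ card (R \<union> R'))"
      by (intro sum.cong refl) (simp add: PE E emeasure_eq_measure)
    finally show ?thesis .
  qed
  have intQ: "integrable M Q"
    by (subst Bochner_Integration.integrable_cong[OF refl Q])
       (auto intro!: Bochner_Integration.integrable_sum intI)
  have intQ2: "integrable M (\<lambda>w. (Q w)\<^sup>2)"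
    by (subst Bochner_Integration.integrable_cong[OF refl sq])
       (auto intro!: Bochner_Integration.integrable_sum intI2)
  have expand: "(Q w - m)\<^sup>2 = (Q w)\<^sup>2 - 2 * m * Q w + m\<^sup>2" for w
    by (simp add: power2_eq_square algebra_simps)
  show "integrable M (\<lambda>w. (Q w - m)\<^sup>2)"
    unfolding expand using intQ intQ2
    by (intro Bochner_Integration.integrable_add Bochner_Integration.integrable_diff integrable_mult_right) auto
  have "expectation (\<lambda>w. (Q w - m)\<^sup>2) = expectation (\<lambda>w. (Q w)\<^sup>2) - m * m"
    unfolding expand using intQ intQ2 EQ by (simp add: prob_space power2_eq_square)
  also have "\<dots> = (\<Sum>R\<in>Pow V. \<Sum>R'\<in>Pow V. W R * W R' * ((1 - p) ^ card (R \<union> R') - (1 - p) ^ (card R + card R')))"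
    unfolding EQ2 m_def sum_product by (simp add: power_add algebra_simps sum_subtractf)
  also have "\<dots> \<le> (\<Sum>R\<in>Pow V. \<Sum>R'\<in>Pow V. W R * W R' * (p * (\<Sum>v\<in>V. of_bool (v \<in> R) * of_bool (v \<in> R'))))"
  proof (intro sum_mono mult_left_mono mult_nonneg_nonneg W0)
    fix R R' assume R: "R \<in> Pow V" "R' \<in> Pow V"
    then have fin: "finite R" "finite R'" using V finite_subset by auto
    obtain x where "x \<in> V" using V0 by blast
    have p01: "0 \<le> p" "p \<le> 1" using p[OF \<open>x \<in> V\<close>] by auto
    have "(1 - p) ^ card (R \<union> R') - (1 - p) ^ (card R + card R') \<le> p * (real (card R + card R') - real (card (R \<union> R')))"
      by (rule power_diff_le_Bernoulli[OF p01]) (rule card_Un_le)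
    also have "real (card R + card R') - real (card (R \<union> R')) = real (card (R \<inter> R'))"
      using card_Un_Int[OF fin] by simp
    also have "\<dots> = (\<Sum>v\<in>V. of_bool (v \<in> R) * of_bool (v \<in> R'))"
    proof -
      have "(\<Sum>v\<in>V. of_bool (v \<in> R) * of_bool (v \<in> R') :: real) = (\<Sum>v\<in>V. of_bool (v \<in> R \<inter> R'))"
        by (intro sum.cong) auto
      also have "\<dots> = real (card (V \<inter> (R \<inter> R')))"
        unfolding of_bool_def sum.inter_restrict[OF V, symmetric] by simp
      also have "V \<inter> (R \<inter> R') = R \<inter> R'" using R by auto
      finally show ?thesis ..
    qed
    finally show "(1 - p) ^ card (R \<union> R') - (1 - p) ^ (card R + card R') \<le>
        p * (\<Sum>v\<in>V. of_bool (v \<in> R) * of_bool (v \<in> R'))" .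
  qed
  also have "\<dots> = p * (\<Sum>v\<in>V. (\<Sum>R\<in>Pow V. W R * of_bool (v \<in> R)) * (\<Sum>R'\<in>Pow V. W R' * of_bool (v \<in> R')))"
  proof -
    have "(\<Sum>R\<in>Pow V. \<Sum>R'\<in>Pow V. W R * W R' * (p * (\<Sum>v\<in>V. of_bool (v \<in> R) * of_bool (v \<in> R')))) =
        (\<Sum>R\<in>Pow V. \<Sum>R'\<in>Pow V. \<Sum>v\<in>V. p * ((W R * of_bool (v \<in> R)) * (W R' * of_bool (v \<in> R'))))"
      by (intro sum.cong refl) (simp add: sum_distrib_left mult_ac)
    also have "\<dots> = (\<Sum>v\<in>V. \<Sum>R\<in>Pow V. \<Sum>R'\<in>Pow V. p * ((W R * of_bool (v \<in> R)) * (W R' * of_bool (v \<in> R'))))"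
      by (subst sum.swap[of _ V], intro sum.cong refl sum.swap)
    also have "\<dots> = p * (\<Sum>v\<in>V. (\<Sum>R\<in>Pow V. W R * of_bool (v \<in> R)) * (\<Sum>R'\<in>Pow V. W R' * of_bool (v \<in> R')))"
      unfolding sum_product by (simp only: sum_distrib_left)
    finally show ?thesis .
  qed
  also have "\<dots> \<le> p * (\<Sum>v\<in>V. q * q)"
  proof (intro mult_left_mono sum_mono mult_mono W1)
    obtain x where "x \<in> V" using V0 by blast
    then show "0 \<le> p" using p[of x] by auto
    show "0 \<le> q" using W1[OF \<open>x \<in> V\<close>] sum_nonneg[of "Pow V" "\<lambda>R. W R * of_bool (x \<in> R)"] W0 by force
  qed (auto intro!: sum_nonneg W0)
  finally show "expectation (\<lambda>w. (Q w - m)\<^sup>2) \<le> p * q\<^sup>2 * real (card V)"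
    by (simp add: power2_eq_square mult_ac)
qed

lemma (in prob_space)
  fixes X :: "'i \<Rightarrow> 'a \<Rightarrow> real" and g :: "real \<Rightarrow> real"
  assumes V: "finite V" "V \<noteq> {}" and X: "indep_vars (\<lambda>_. borel) X V"
    and g [measurable]: "g \<in> borel_measurable borel" and g0: "\<And>x. 0 \<le> g x" "\<And>x. g x \<le> C"
    and m: "\<And>x. x \<in> V \<Longrightarrow> expectation (\<lambda>w. g (X x w)) = m"
  defines "Y \<equiv> \<lambda>w. (\<Sum>x\<in>V. g (X x w)) / real (card V)"
  shows empirical_mean_measurable: "Y \<in> borel_measurable M"
    and empirical_mean_integrable: "integrable M (\<lambda>w. (Y w - m)\<^sup>2)"
    and empirical_mean_variance: "expectation (\<lambda>w. (Y w - m)\<^sup>2) \<le> C\<^sup>2 / real (card V)"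
proof -
  have meas: "X x \<in> borel_measurable M" if "x \<in> V" for x using X that by (simp add: indep_vars_def2)
  define G where "G x w = g (X x w) - m" for x w
  have Gm: "G x \<in> borel_measurable M" if "x \<in> V" for x
  proof -
    have [measurable]: "X x \<in> borel_measurable M" using meas that .
    show ?thesis unfolding G_def by measurable
  qed
  have int1: "integrable M (\<lambda>w. g (X x w))" if "x \<in> V" for x
  proof -
    have [measurable]: "X x \<in> borel_measurable M" using meas that .
    show ?thesis by (rule integrable_const_bound[of _ C]) (use g0 in auto)
  qed
  have m01: "0 \<le> m \<and> m \<le> C"
  proof -
    obtain x where x: "x \<in> V" using V by blast
    have "expectation (\<lambda>w. g (X x w)) \<le> expectation (\<lambda>w. C)"
      by (intro integral_mono int1 x) (use g0 in auto)
    moreover have "0 \<le> expectation (\<lambda>w. g (X x w))"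
      by (intro Bochner_Integration.integral_nonneg g0)
    ultimately show ?thesis using m[OF x] by (simp add: prob_space)
  qed
  have GC: "\<bar>G x w\<bar> \<le> C" for x w unfolding G_def using g0[of "X x w"] m01 by (auto simp: abs_le_iff intro: diff_mono add_increasing)
  have EG: "expectation (G x) = 0" if "x \<in> V" for x
    unfolding G_def using int1[OF that] m[OF that] by (simp add: prob_space)
  have intG: "integrable M (G x)" if "x \<in> V" for x
    by (rule integrable_const_bound[of _ C]) (use GC Gm[OF that] in auto)
  have intGG: "integrable M (\<lambda>w. G x w * G y w)" if "x \<in> V" "y \<in> V" for x y
    by (rule integrable_const_bound[of _ "C * C"])
       (use GC Gm that in \<open>auto simp: abs_mult intro!: AE_I2 mult_mono order_trans[OF abs_ge_zero GC]\<close>)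
  have ind: "indep_vars (\<lambda>_. borel) G V"
    using indep_vars_compose2[OF X, of "\<lambda>_ z. g z - m" "\<lambda>_. borel"] unfolding G_def by simp
  have cov: "expectation (\<lambda>w. G x w * G y w) \<le> (if x = y then C\<^sup>2 else 0)" if "x \<in> V" "y \<in> V" for x y
  proof (cases "x = y")
    case True
    have "expectation (\<lambda>w. G x w * G x w) \<le> expectation (\<lambda>w. C\<^sup>2)"
      using GC by (intro integral_mono intGG that) (auto simp: power2_eq_square[symmetric] abs_le_square_iff[symmetric] intro: order_trans[OF GC abs_ge_self])
    then show ?thesis using True by (simp add: prob_space)
  next
    case False
    have "indep_vars (\<lambda>_. borel) G {x, y}" by (rule indep_vars_subset[OF ind]) (use that in auto)
    then have "expectation (\<lambda>w. \<Prod>i\<in>{x, y}. G i w) = (\<Prod>i\<in>{x, y}. expectation (G i))"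
      by (rule indep_vars_lebesgue_integral[rotated]) (use intG that in auto)
    then have "expectation (\<lambda>w. G x w * G y w) = expectation (G x) * expectation (G y)"
      using False by simp
    then show ?thesis using False EG that by simp
  qed
  have N: "real (card V) > 0" using V by (simp add: card_gt_0_iff)
  have Y: "(Y w - m)\<^sup>2 = (\<Sum>x\<in>V. \<Sum>y\<in>V. G x w * G y w) / (real (card V))\<^sup>2" for w
  proof -
    have "Y w - m = (\<Sum>x\<in>V. G x w) / real (card V)"
      using N by (simp add: Y_def G_def sum_subtractf field_simps)
    then show ?thesis by (simp add: power_divide power2_eq_square[of "sum _ _"] sum_product)
  qed
  have "Y = (\<lambda>w. (\<Sum>x\<in>V. G x w) / real (card V) + m)"
    using N by (simp add: Y_def G_def sum_subtractf field_simps)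
  then show "Y \<in> borel_measurable M" using Gm by simp
  show "integrable M (\<lambda>w. (Y w - m)\<^sup>2)"
    unfolding Y by (intro integrable_divide_zero Bochner_Integration.integrable_sum intGG impI)
  have "expectation (\<lambda>w. (Y w - m)\<^sup>2) = (\<Sum>x\<in>V. \<Sum>y\<in>V. expectation (\<lambda>w. G x w * G y w)) / (real (card V))\<^sup>2"
    unfolding Y
    by (subst integral_divide_zero, subst Bochner_Integration.integral_sum,
        intro Bochner_Integration.integrable_sum intGG, assumption, assumption,
        intro arg_cong2[where f = "(/)"] refl sum.cong Bochner_Integration.integral_sum intGG)
  also have "\<dots> \<le> (\<Sum>x\<in>V. \<Sum>y\<in>V. if x = y then C\<^sup>2 else 0) / (real (card V))\<^sup>2"
    by (intro divide_right_mono sum_mono cov) auto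
  also have "\<dots> = C\<^sup>2 / real (card V)" using V N by (simp add: power2_eq_square)
  finally show "expectation (\<lambda>w. (Y w - m)\<^sup>2) \<le> C\<^sup>2 / real (card V)" .
qed

section \<open>Almost sure behaviour of the landscape\<close>

lemma (in hypercube_walk) range_law_eq_0:
  assumes "card R > k + 1"
  shows "range_law k R = 0"
proof -
  have "(\<lambda>i. J i w) ` {..k} \<noteq> R" for w
    using assms card_image_le[of "{..k}" "\<lambda>i. J i w"] by auto
  then show ?thesis by (simp add: range_law_def)
qed

text \<open>
  Compared with a walk that visits \<open>k + 1\<close> different sites, each repeated site costs at most
  \<open>p\<close>.
\<close>

lemma (in hypercube_walk) avoidance_mean_bounds:
  fixes k :: nat and p :: real
  assumes p: "0 \<le> p" "p \<le> 1"
  defines "m \<equiv> \<Sum>R\<in>Pow (hypercube n). range_law k R * (1 - p) ^ card R"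
  shows "(1 - p) ^ (k + 1) \<le> m"
    and "m \<le> (1 - p) ^ (k + 1) + p * real (k + 1) * (2 / real n + real (k + 1) * (337 / 384) ^ n)"
proof -
  let ?V = "Pow (hypercube n)"
  have const: "(\<Sum>R\<in>?V. range_law k R * c) = c" for c
    unfolding sum_distrib_right[symmetric] range_law_total by simp
  \<comment> \<open>sets with more than \<open>k + 1\<close> elements have weight \<open>0\<close>\<close>
  have "(\<Sum>R\<in>?V. range_law k R * (1 - p) ^ (k + 1)) \<le> m"
    unfolding m_def
  proof (rule sum_mono)
    fix R assume "R \<in> ?V"
    show "range_law k R * (1 - p) ^ (k + 1) \<le> range_law k R * (1 - p) ^ card R"
    proof (cases "card R > k + 1")
      case False
      then show ?thesis using p by (intro mult_left_mono power_decreasing range_law_nonneg) auto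
    qed (simp add: range_law_eq_0)
  qed
  then show "(1 - p) ^ (k + 1) \<le> m" unfolding const .
  have "m \<le> (\<Sum>R\<in>?V. range_law k R * ((1 - p) ^ (k + 1) + p * real (k + 1)) - p * (range_law k R * real (card R)))"
    unfolding m_def
  proof (rule sum_mono)
    fix R assume "R \<in> ?V"
    show "range_law k R * (1 - p) ^ card R \<le>
        range_law k R * ((1 - p) ^ (k + 1) + p * real (k + 1)) - p * (range_law k R * real (card R))"
    proof (cases "card R > k + 1")
      case False
      have "range_law k R * (1 - p) ^ card R \<le> range_law k R * ((1 - p) ^ (k + 1) + p * (real (k + 1) - real (card R)))"
        using power_diff_le_Bernoulli[OF p, of "card R" "k + 1"] False range_law_nonneg
        by (intro mult_left_mono) auto
      then show ?thesis by (simp add: algebra_simps)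
    qed (simp add: range_law_eq_0)
  qed
  also have "\<dots> = (1 - p) ^ (k + 1) + p * real (k + 1) - p * (\<Sum>R\<in>?V. range_law k R * real (card R))"
    unfolding sum_subtractf const sum_distrib_left ..
  also have "\<dots> \<le> (1 - p) ^ (k + 1) + p * real (k + 1) -
      p * (real (k + 1) * (1 - 2 / real n - real (k + 1) * (337 / 384) ^ n))"
    using range_law_card_ge p by (intro diff_left_mono mult_left_mono) auto
  also have "\<dots> = (1 - p) ^ (k + 1) + p * real (k + 1) * (2 / real n + real (k + 1) * (337 / 384) ^ n)"
    by (simp add: algebra_simps)
  finally show "m \<le> (1 - p) ^ (k + 1) + p * real (k + 1) * (2 / real n + real (k + 1) * (337 / 384) ^ n)" .
qed

lemma tendsto_one_minus_power:
  fixes p :: "nat \<Rightarrow> real" and k :: "nat \<Rightarrow> nat"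
  assumes p: "p \<longlonglongrightarrow> 0" and pk: "(\<lambda>n. real (k n) * p n) \<longlonglongrightarrow> t" and p0: "eventually (\<lambda>n. 0 \<le> p n) sequentially"
  shows "(\<lambda>n. (1 - p n) ^ k n) \<longlonglongrightarrow> exp (- t)"
proof -
  have "(\<lambda>n. exp (- (real (k n) * p n))) \<longlonglongrightarrow> exp (- t)" by (intro tendsto_intros pk)
  moreover have "(\<lambda>n. (1 - p n) ^ k n - exp (- (real (k n) * p n))) \<longlonglongrightarrow> 0"
  proof (rule Lim_null_comparison)
    have "(\<lambda>n. (real (k n) * p n) * p n) \<longlonglongrightarrow> t * 0" by (intro tendsto_intros pk p)
    then show "(\<lambda>n. (real (k n) * p n) * p n) \<longlonglongrightarrow> 0" by simp
    have "eventually (\<lambda>n. p n < 1) sequentially" using order_tendstoD(2)[OF p, of 1] by simp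
    then show "eventually (\<lambda>n. norm ((1 - p n) ^ k n - exp (- (real (k n) * p n))) \<le> real (k n) * p n * p n) sequentially"
      using p0
    proof eventually_elim
      case (elim n)
      have "exp (- p n) \<le> 1 - p n + (p n)\<^sup>2"
      proof -
        have "1 \<le> (1 - p n + (p n)\<^sup>2) * (1 + p n)"
        proof -
          have "(1 - p n + (p n)\<^sup>2) * (1 + p n) = 1 + (p n) ^ 3"
            by (simp add: power2_eq_square power3_eq_cube algebra_simps)
          then show ?thesis using elim by simp
        qed
        also have "\<dots> \<le> (1 - p n + (p n)\<^sup>2) * exp (p n)"
          using elim exp_ge_add_one_self[of "p n"] by (intro mult_left_mono) auto
        finally show ?thesis by (simp add: exp_minus field_simps)
      qed
      moreover have "1 - p n \<le> exp (- p n)" using exp_ge_add_one_self[of "- p n"] by simp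
      ultimately have *: "norm ((1 - p n) - exp (- p n)) \<le> p n * p n" by (simp add: power2_eq_square)
      have "exp (- (real (k n) * p n)) = exp (- p n) ^ k n" by (simp add: exp_of_nat_mult[symmetric])
      then have "norm ((1 - p n) ^ k n - exp (- (real (k n) * p n))) \<le> real (k n) * norm ((1 - p n) - exp (- p n))"
        using elim norm_power_diff[of "1 - p n" "exp (- p n)" "k n"] by simp
      also have "\<dots> \<le> real (k n) * (p n * p n)" by (intro mult_left_mono *) auto
      finally show ?case by simp
    qed
  qed
  ultimately show ?thesis using tendsto_add by force
qed

context short_scale
begin

lemma b_le_exp:
  assumes "\<delta> > 0"
  shows "eventually (\<lambda>n. b n \<le> exp (\<delta> * real n)) sequentially"
proof -
  have "eventually (\<lambda>n. ln (b n) / real n < \<delta>) sequentially"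
    using order_tendstoD(2)[OF ln_b_small assms] .
  then show ?thesis using eventually_ge_at_top[of 1]
  proof eventually_elim
    case (elim n)
    then have "ln (b n) \<le> \<delta> * real n" by (simp add: field_simps)
    then show ?case using b_pos[of n] elim by (metis exp_le_cancel_iff exp_ln)
  qed
qed

text \<open>
  Two walks of length of order \<open>b\<close> have about \<open>b\<^sup>2 / 2\<^sup>n\<close> common sites; the factor \<open>n\<close> leaves room for the
  square of \<open>blowup\<close>.
\<close>

lemma summable_variance_bound: "summable (\<lambda>n. C * (real n * (b n)\<^sup>2 / 2 ^ n))"
proof (intro summable_mult)
  have *: "eventually (\<lambda>n. norm (real n * (b n)\<^sup>2 / 2 ^ n) \<le> 8 * exp (- 1 / 8) ^ n) sequentially"
    using b_le_exp[of "1 / 8", simplified] eventually_ge_at_top[of 1]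
  proof eventually_elim
    case (elim n)
    have "(b n)\<^sup>2 \<le> (exp (real n / 8))\<^sup>2" using elim b_pos[of n] by (intro power_mono) auto
    also have "\<dots> = exp (real n / 4)" by (simp add: power2_eq_square flip: exp_add)
    finally have b2: "(b n)\<^sup>2 \<le> exp (real n / 4)" .
    have n: "real n \<le> 8 * exp (real n / 8)" using exp_ge_add_one_self[of "real n / 8"] by linarith
    have "exp (1 / 2 :: real) \<le> 2" using exp_le_cancel_iff[of "1 / 2" "ln 2"] ln2_ge_two_thirds by simp
    then have "exp (1 / 2 :: real) ^ n \<le> 2 ^ n" by (intro power_mono) auto
    then have two: "exp (real n / 2) \<le> 2 ^ n" by (simp add: exp_of_nat_mult[symmetric])
    have "real n * (b n)\<^sup>2 / 2 ^ n \<le> (8 * exp (real n / 8)) * exp (real n / 4) / exp (real n / 2)"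
      using b2 n two by (intro frac_le mult_mono) auto
    also have "\<dots> = 8 * exp (real n / 8 + real n / 4 - real n / 2)"
      by (simp only: exp_diff exp_add mult.assoc times_divide_eq_right)
    also have "\<dots> = 8 * exp (- 1 / 8) ^ n" by (simp add: exp_of_nat_mult[symmetric])
    finally show ?case by simp
  qed
  show "summable (\<lambda>n. real n * (b n)\<^sup>2 / 2 ^ n)"
    by (rule summable_comparison_test_ev[OF *]) (intro summable_mult summable_geometric, simp)
qed

lemma top_tail_bounds: "0 \<le> gauss_tail (top_depth n)" "gauss_tail (top_depth n) \<le> 1"
proof -
  show "0 \<le> gauss_tail (top_depth n)" by (rule gauss_tail_nonneg)
  have "gauss_tail (top_depth n) \<le> (\<integral>x. std_normal_density x \<partial>lborel)"
    unfolding gauss_tail_def by (intro integral_mono) (auto split: split_indicator)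
  then show "gauss_tail (top_depth n) \<le> 1" by simp
qed

lemma tendsto_top_tail: "(\<lambda>n. gauss_tail (top_depth n)) \<longlonglongrightarrow> 0"
proof -
  have "(\<lambda>n. inverse (b n) * (b n * gauss_tail (top_depth n))) \<longlonglongrightarrow> 0 * 1"
    by (intro tendsto_mult top_tail_limit tendsto_inverse_0_at_top b_at_top)
  moreover have "eventually (\<lambda>n. inverse (b n) * (b n * gauss_tail (top_depth n)) = gauss_tail (top_depth n)) sequentially"
    using eventually_ge_at_top[of 1]
  proof eventually_elim
    case (elim n)
    then show ?case using b_pos[of n] by simp
  qed
  ultimately show ?thesis by (rule Lim_transform_eventually[THEN tendsto_eq_rhs]) simp
qed

text \<open>
  Depth relative to \<open>r\<close> of a trap with Gaussian variable \<open>z\<close>, set to \<open>0\<close> for deep traps.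
\<close>

definition shallow_trap :: "nat \<Rightarrow> real \<Rightarrow> real" where
  "shallow_trap n z = exp (- (\<beta> * sqrt (real n)) * z) / r n * indicator {- top_depth n<..} z"

lemma shallow_trap_measurable [measurable]: "shallow_trap n \<in> borel_measurable borel"
  unfolding shallow_trap_def by measurable

lemma exp_top_depth:
  assumes "n \<ge> 1" "blowup n > 0"
  shows "exp (\<beta> * sqrt (real n) * top_depth n) = blowup n * r n"
proof -
  define s where "s = \<beta> * sqrt (real n)"
  have "s \<noteq> 0" using \<beta> assms by (simp add: s_def)
  then have "s * top_depth n = ln (r n) + ln (blowup n)"
    unfolding top_depth_def depth_def[of n] s_def[symmetric] by (simp add: distrib_left)
  then have "\<beta> * sqrt (real n) * top_depth n = ln (r n) + ln (blowup n)" by (simp add: s_def)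
  then show ?thesis using assms r[of n] by (simp add: exp_add)
qed

lemma shallow_trap_nonneg: "n \<ge> 1 \<Longrightarrow> 0 \<le> shallow_trap n z"
  using r[of n] by (simp add: shallow_trap_def)

lemma shallow_trap_le:
  assumes "n \<ge> 1" "blowup n > 0"
  shows "shallow_trap n z \<le> blowup n"
proof (cases "z > - top_depth n")
  case True
  have "(\<beta> * sqrt (real n)) * (- z) \<le> (\<beta> * sqrt (real n)) * top_depth n"
    using True \<beta> by (intro mult_left_mono) auto
  then have "exp (- (\<beta> * sqrt (real n)) * z) \<le> blowup n * r n"
    unfolding exp_top_depth[OF assms, symmetric] by simp
  then show ?thesis using True r[OF assms(1)] by (simp add: shallow_trap_def pos_divide_le_eq)
qed (use assms in \<open>simp add: shallow_trap_def\<close>)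

end

text \<open>
  The landscapes live on \<open>P\<close> and the walks on \<open>D n\<close>; the two are coupled only by evaluating
  the landscape along the walk.
\<close>

locale quenched = short_scale \<beta> r b + prob_space P
  for \<beta> :: real and r b :: "nat \<Rightarrow> real" and P :: "'w measure" +
  fixes H :: "nat \<Rightarrow> (nat \<Rightarrow> int) \<Rightarrow> 'w \<Rightarrow> real" and a :: "nat \<Rightarrow> real"
    and D :: "nat \<Rightarrow> 's measure" and J :: "nat \<Rightarrow> nat \<Rightarrow> 's \<Rightarrow> (nat \<Rightarrow> int)"
  assumes indep: "\<And>n. n \<ge> 1 \<Longrightarrow> indep_vars (\<lambda>_. borel) (H n) (hypercube n)"
    and gaussian: "\<And>n x. n \<ge> 1 \<Longrightarrow> x \<in> hypercube n \<Longrightarrow> distributed P lborel (H n x) std_normal_density"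
    and aux_scale: "(\<lambda>n. a n / b n) \<longlonglongrightarrow> 1"
    and walk: "\<And>n. n \<ge> 1 \<Longrightarrow> hypercube_walk (D n) n (J n)"
begin

definition steps :: "nat \<Rightarrow> real \<Rightarrow> nat" where "steps n t = nat \<lfloor>a n * t\<rfloor>"

definition avoid_prob :: "real \<Rightarrow> nat \<Rightarrow> 'w \<Rightarrow> real" where
  "avoid_prob t n \<omega> =
     measure (D n) {w \<in> space (D n). \<forall>i\<le>steps n t. \<not> H n (J n i w) \<omega> \<le> - top_depth n}"

definition shallow_mean :: "nat \<Rightarrow> 'w \<Rightarrow> real" where
  "shallow_mean n \<omega> = (\<Sum>x\<in>hypercube n. shallow_trap n (H n x \<omega>)) / real (card (hypercube n))"

lemma a_pos: "eventually (\<lambda>n. a n > 0) sequentially"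
proof -
  have "eventually (\<lambda>n. a n / b n > 0) sequentially" using order_tendstoD(1)[OF aux_scale, of 0] by simp
  then show ?thesis using eventually_ge_at_top[of 1]
    by eventually_elim (use b_pos in \<open>force simp: zero_less_divide_iff\<close>)
qed

lemma steps_ratio:
  assumes t: "t \<ge> 0"
  shows "(\<lambda>n. real (steps n t + 1) / b n) \<longlonglongrightarrow> t"
proof (rule tendsto_sandwich)
  have l: "(\<lambda>n. a n / b n * t) \<longlonglongrightarrow> 1 * t" by (intro tendsto_mult aux_scale tendsto_const)
  then show "(\<lambda>n. a n / b n * t) \<longlonglongrightarrow> t" by simp
  have "(\<lambda>n. a n / b n * t + inverse (b n)) \<longlonglongrightarrow> 1 * t + 0"
    by (intro tendsto_add l tendsto_inverse_0_at_top b_at_top)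
  then show "(\<lambda>n. a n / b n * t + inverse (b n)) \<longlonglongrightarrow> t" by simp
  have *: "a n * t \<le> real (steps n t + 1) \<and> real (steps n t + 1) \<le> a n * t + 1" if "a n > 0" for n
  proof -
    have "a n * t \<ge> 0" using that t by simp
    then show ?thesis unfolding steps_def by linarith
  qed
  show "eventually (\<lambda>n. a n / b n * t \<le> real (steps n t + 1) / b n) sequentially"
    using a_pos eventually_ge_at_top[of 1]
  proof eventually_elim
    case (elim n)
    then show ?case using divide_right_mono[of "a n * t" "real (steps n t + 1)" "b n"] *[of n] b_pos[of n] by simp
  qed
  show "eventually (\<lambda>n. real (steps n t + 1) / b n \<le> a n / b n * t + inverse (b n)) sequentially"
    using a_pos eventually_ge_at_top[of 1]
  proof eventually_elim
    case (elim n)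
    then show ?case using divide_right_mono[of "real (steps n t + 1)" "a n * t + 1" "b n"] *[of n] b_pos[of n]
      by (simp add: add_divide_distrib inverse_eq_divide)
  qed
qed

lemma prob_deep: 
  assumes "n \<ge> 1" "x \<in> hypercube n"
  shows "prob {\<omega> \<in> space P. H n x \<omega> \<le> - top_depth n} = gauss_tail (top_depth n)"
  by (rule prob_std_normal_le[OF gaussian[OF assms]])

definition avoid_mean :: "real \<Rightarrow> nat \<Rightarrow> real" where
  "avoid_mean t n = (\<Sum>R\<in>Pow (hypercube n). hypercube_walk.range_law (D n) (J n) (steps n t) R *
     (1 - gauss_tail (top_depth n)) ^ card R)"

lemma avoid_mean_limit:
  assumes t: "t \<ge> 0"
  shows "avoid_mean t \<longlonglongrightarrow> exp (- t)"
proof (rule tendsto_sandwich)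
  let ?p = "\<lambda>n. gauss_tail (top_depth n)" and ?k = "\<lambda>n. steps n t + 1"
  have pk: "(\<lambda>n. real (?k n) * ?p n) \<longlonglongrightarrow> t"
  proof -
    have "(\<lambda>n. real (?k n) / b n * (b n * ?p n)) \<longlonglongrightarrow> t * 1"
      by (intro tendsto_mult steps_ratio t top_tail_limit)
    moreover have "eventually (\<lambda>n. real (?k n) / b n * (b n * ?p n) = real (?k n) * ?p n) sequentially"
      using eventually_ge_at_top[of 1]
    proof eventually_elim
      case (elim n)
      then show ?case using b_pos[of n] by simp
    qed
    ultimately show ?thesis by (rule Lim_transform_eventually[THEN tendsto_eq_rhs]) simp
  qed
  show lim: "(\<lambda>n. (1 - ?p n) ^ ?k n) \<longlonglongrightarrow> exp (- t)"
    by (rule tendsto_one_minus_power[OF tendsto_top_tail pk]) (simp add: top_tail_bounds)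
  \<comment> \<open>the error of the Chernoff bound: \<open>b\<close> grows slower than any exponential\<close>
  have kq: "(\<lambda>n. real (?k n) * (337 / 384) ^ n) \<longlonglongrightarrow> 0"
  proof -
    have "(\<lambda>n. b n * (337 / 384) ^ n) \<longlonglongrightarrow> 0"
    proof (rule Lim_null_comparison)
      have l: "ln (384 / 337 :: real) > 0" by simp
      then have l2: "ln (384 / 337 :: real) / 2 > 0" by simp
      show "eventually (\<lambda>n. norm (b n * (337 / 384) ^ n) \<le> exp (- (ln (384 / 337) / 2)) ^ n) sequentially"
        using b_le_exp[OF l2] eventually_ge_at_top[of 1]
      proof eventually_elim
        case (elim n)
        have "(337 / 384 :: real) = exp (- ln (384 / 337))" by (simp add: exp_minus)
        then have "(337 / 384 :: real) ^ n = exp (- ln (384 / 337)) ^ n" by (rule arg_cong)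
        also have "\<dots> = exp (- ln (384 / 337) * real n)" by (simp only: exp_of_nat_mult[symmetric] mult.commute)
        finally have "b n * (337 / 384) ^ n = b n * exp (- ln (384 / 337) * real n)" by (rule arg_cong)
        also have "\<dots> \<le> exp (ln (384 / 337) / 2 * real n) * exp (- ln (384 / 337) * real n)"
          using elim by (intro mult_right_mono) auto
        also have "\<dots> = exp (- (ln (384 / 337) / 2)) ^ n"
          unfolding exp_of_nat_mult[symmetric] exp_add[symmetric] by (simp add: algebra_simps)
        finally show ?case using b_pos[of n] elim by simp
      qed
      show "(\<lambda>n. exp (- (ln (384 / 337) / 2)) ^ n :: real) \<longlonglongrightarrow> 0"
        by (rule LIMSEQ_realpow_zero) (use l in auto)
    qed
    then have "(\<lambda>n. real (?k n) / b n * (b n * (337 / 384) ^ n)) \<longlonglongrightarrow> t * 0"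
      by (intro tendsto_mult steps_ratio t)
    moreover have "eventually (\<lambda>n. real (?k n) / b n * (b n * (337 / 384) ^ n) = real (?k n) * (337 / 384) ^ n) sequentially"
      using eventually_ge_at_top[of 1]
    proof eventually_elim
      case (elim n)
      then show ?case using b_pos[of n] by simp
    qed
    ultimately show ?thesis by (rule Lim_transform_eventually[THEN tendsto_eq_rhs]) simp
  qed
  have "(\<lambda>n. (1 - ?p n) ^ ?k n + real (?k n) * ?p n * (2 / real n + real (?k n) * (337 / 384) ^ n)) \<longlonglongrightarrow>
      exp (- t) + t * (0 + 0)"
    by (intro tendsto_intros lim pk kq lim_const_over_n)
  then show "(\<lambda>n. (1 - ?p n) ^ ?k n + real (?k n) * ?p n * (2 / real n + real (?k n) * (337 / 384) ^ n)) \<longlonglongrightarrow> exp (- t)"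
    by simp
  show "eventually (\<lambda>n. (1 - ?p n) ^ ?k n \<le> avoid_mean t n) sequentially"
    using eventually_ge_at_top[of 1]
  proof eventually_elim
    case (elim n)
    interpret W: hypercube_walk "D n" n "J n" by (rule walk[OF elim])
    show ?case unfolding avoid_mean_def by (rule W.avoidance_mean_bounds[OF top_tail_bounds])
  qed
  show "eventually (\<lambda>n. avoid_mean t n \<le> (1 - ?p n) ^ ?k n + real (?k n) * ?p n * (2 / real n + real (?k n) * (337 / 384) ^ n)) sequentially"
    using eventually_ge_at_top[of 1]
  proof eventually_elim
    case (elim n)
    interpret W: hypercube_walk "D n" n "J n" by (rule walk[OF elim])
    show ?case unfolding avoid_mean_def
      using W.avoidance_mean_bounds(2)[OF top_tail_bounds, of "steps n t" n] by (simp add: mult_ac)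
  qed
qed

lemma hypercube_nonempty: "hypercube n \<noteq> {}"
  using card_hypercube[of n] by force

text \<open>
  The quenched law of the first visit to a deep trap, rescaled by \<open>a\<close>, is asymptotically
  exponential.
\<close>

lemma AE_avoid_prob:
  assumes t: "t \<ge> 0"
  shows "AE \<omega> in P. (\<lambda>n. avoid_prob t n \<omega>) \<longlonglongrightarrow> exp (- t)"
proof -
  have avoid: "avoid_prob t n \<omega> = (\<Sum>R\<in>Pow (hypercube n). hypercube_walk.range_law (D n) (J n) (steps n t) R *
      of_bool (\<forall>x\<in>R. \<not> H n x \<omega> \<le> - top_depth n))" if "n \<ge> 1" for n \<omega>
  proof -
    interpret W: hypercube_walk "D n" n "J n" by (rule walk[OF that])
    show ?thesis
      unfolding avoid_prob_def using W.prob_walk_avoids[of "steps n t" "{x. H n x \<omega> \<le> - top_depth n}"] by simp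
  qed
  define X where "X n \<omega> = (if n \<ge> 1 then avoid_prob t n \<omega> - avoid_mean t n else 0)" for n \<omega>
  have "eventually (\<lambda>n. real (steps n t + 1) / b n < t + 1) sequentially"
    using order_tendstoD(2)[OF steps_ratio[OF t], of "t + 1"] by simp
  then obtain n0 where n0: "\<And>n. n \<ge> n0 \<Longrightarrow> real (steps n t + 1) / b n < t + 1"
    unfolding eventually_sequentially by blast
  have facts: "X n \<in> borel_measurable P \<and> integrable P (\<lambda>\<omega>. (X n \<omega>)\<^sup>2) \<and>
      expectation (\<lambda>\<omega>. (X n \<omega>)\<^sup>2) \<le> gauss_tail (top_depth n) * (real (steps n t + 1) / 2 ^ n)\<^sup>2 * 2 ^ n"
    if n: "n \<ge> 1" for n
  proof -
    interpret W: hypercube_walk "D n" n "J n" by (rule walk[OF n])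
    note F = finite_hypercube[of n] indep[OF n] prob_deep[OF n] hypercube_nonempty W.range_law_nonneg[of "steps n t"]
      W.range_law_visits
    have X: "X n = (\<lambda>\<omega>. (\<Sum>R\<in>Pow (hypercube n). W.range_law (steps n t) R *
      of_bool (\<forall>x\<in>R. \<not> H n x \<omega> \<le> - top_depth n)) - avoid_mean t n)"
      unfolding X_def avoid[OF n] using n by simp
    have "X n \<in> borel_measurable P"
      unfolding X by (intro borel_measurable_diff borel_measurable_const avoidance_measurable[OF F])
    moreover have "integrable P (\<lambda>\<omega>. (X n \<omega>)\<^sup>2)"
      unfolding X avoid_mean_def by (rule avoidance_integrable[OF F])
    moreover have "expectation (\<lambda>\<omega>. (X n \<omega>)\<^sup>2) \<le> gauss_tail (top_depth n) * (real (steps n t + 1) / 2 ^ n)\<^sup>2 * real (card (hypercube n))"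
      unfolding X avoid_mean_def by (rule avoidance_variance[OF F])
    ultimately show ?thesis by (simp add: card_hypercube)
  qed
  have "AE \<omega> in P. (\<lambda>n. X n \<omega>) \<longlonglongrightarrow> 0"
  proof (rule AE_tendsto_0_if_summable_second_moments[of _ "max 1 n0" "\<lambda>n. (t + 1)\<^sup>2 * (real n * (b n)\<^sup>2 / 2 ^ n)"])
    show "X n \<in> borel_measurable P" for n
      using facts[of n] by (cases "n \<ge> 1") (auto simp: X_def[abs_def])
    show "integrable P (\<lambda>\<omega>. (X n \<omega>)\<^sup>2)" if "n \<ge> max 1 n0" for n using facts that by auto
    show "expectation (\<lambda>\<omega>. (X n \<omega>)\<^sup>2) \<le> (t + 1)\<^sup>2 * (real n * (b n)\<^sup>2 / 2 ^ n)" if n: "n \<ge> max 1 n0" for n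
    proof -
      have b: "b n > 0" using b_pos n by simp
      have "real (steps n t + 1) \<le> (t + 1) * b n" using n0[of n] n b by (simp add: pos_divide_less_eq)
      then have sq: "(real (steps n t + 1))\<^sup>2 \<le> ((t + 1) * b n)\<^sup>2" by (intro power_mono) auto
      have "expectation (\<lambda>\<omega>. (X n \<omega>)\<^sup>2) \<le> gauss_tail (top_depth n) * ((real (steps n t + 1))\<^sup>2 / 2 ^ n)"
        using facts[of n] n by (simp add: power_divide power2_eq_square)
      also have "\<dots> \<le> real n * (((t + 1) * b n)\<^sup>2 / 2 ^ n)"
        using n sq top_tail_bounds[of n] by (intro mult_mono divide_right_mono) auto
      finally show ?thesis by (simp add: power_mult_distrib mult_ac)
    qed
  qed (rule summable_variance_bound)
  then show ?thesis
  proof eventually_elim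
    case (elim \<omega>)
    have "(\<lambda>n. X n \<omega> + avoid_mean t n) \<longlonglongrightarrow> 0 + exp (- t)"
      by (intro tendsto_add elim avoid_mean_limit t)
    moreover have "eventually (\<lambda>n. X n \<omega> + avoid_mean t n = avoid_prob t n \<omega>) sequentially"
      using eventually_ge_at_top[of 1] by eventually_elim (simp add: X_def)
    ultimately show ?case by (rule Lim_transform_eventually[THEN tendsto_eq_rhs]) simp
  qed
qed

lemma shallow_expectation_eq:
  assumes n: "n \<ge> 1" and x: "x \<in> hypercube n"
  shows "expectation (\<lambda>\<omega>. shallow_trap n (H n x \<omega>)) = (\<integral>z. std_normal_density z * shallow_trap n z \<partial>lborel)"
  by (rule distributed_integral[OF gaussian[OF n x], symmetric]) auto

text \<open>
  The integral is the expected relative depth of a shallow trap at an arbitrary site, to which the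
  bound on the truncated exponential moment applies.
\<close>

lemma shallow_integral_le:
  assumes n: "n \<ge> 1" "blowup n > 0" "top_depth n < \<beta> * sqrt (real n)"
  shows "(\<integral>z. std_normal_density z * shallow_trap n z \<partial>lborel) \<le>
     blowup n * std_normal_density (top_depth n) / (\<beta> * sqrt (real n) - top_depth n)"
proof -
  obtain x where x: "x \<in> hypercube n" using hypercube_nonempty by blast
  have "(\<integral>z. std_normal_density z * shallow_trap n z \<partial>lborel) = expectation (\<lambda>\<omega>. shallow_trap n (H n x \<omega>))"
    by (rule shallow_expectation_eq[OF n(1) x, symmetric])
  also have "\<dots> = expectation (\<lambda>\<omega>. exp (- (\<beta> * sqrt (real n)) * H n x \<omega>) * indicator {- top_depth n<..} (H n x \<omega>)) / r n"
    unfolding shallow_trap_def by (simp flip: integral_divide_zero)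
  also have "\<dots> \<le> exp (\<beta> * sqrt (real n) * top_depth n) * std_normal_density (top_depth n) / (\<beta> * sqrt (real n) - top_depth n) / r n"
    using r[OF n(1)] \<beta> n
    by (intro divide_right_mono truncated_exponential_moment_le[OF gaussian[OF n(1) x]]) auto
  also have "\<dots> = blowup n * std_normal_density (top_depth n) / (\<beta> * sqrt (real n) - top_depth n)"
    unfolding exp_top_depth[OF n(1,2)] using r[OF n(1)] by simp
  finally show ?thesis .
qed

text \<open>
  As the walk is stationary, \<open>shallow_mean\<close> is the expected contribution of a single step, and
  about \<open>b\<close> steps are made.
\<close>

lemma AE_shallow_mean: "AE \<omega> in P. (\<lambda>n. b n * shallow_mean n \<omega>) \<longlonglongrightarrow> 0"
proof -
  define m where "m n = (\<integral>z. std_normal_density z * shallow_trap n z \<partial>lborel)" for n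
  have bm: "(\<lambda>n. b n * m n) \<longlonglongrightarrow> 0"
  proof (rule tendsto_sandwich[OF _ _ tendsto_const small_traps_limit])
    show "eventually (\<lambda>n. 0 \<le> b n * m n) sequentially"
      using eventually_ge_at_top[of 1]
    proof eventually_elim
      case (elim n)
      then show ?case unfolding m_def using b_pos[of n] shallow_trap_nonneg[of n]
        by (intro mult_nonneg_nonneg Bochner_Integration.integral_nonneg) auto
    qed
    show "eventually (\<lambda>n. b n * m n \<le> b n * (blowup n * std_normal_density (top_depth n) / (\<beta> * sqrt (real n) - top_depth n))) sequentially"
      using eventually_scales
    proof eventually_elim
      case (elim n)
      then show ?case unfolding m_def using b_pos[of n] by (intro mult_left_mono shallow_integral_le) auto
    qed
  qed
  define X where "X n \<omega> = (if n \<ge> 1 then b n * (shallow_mean n \<omega> - m n) else 0)" for n \<omega>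
  obtain n0 where n0: "\<And>n. n \<ge> n0 \<Longrightarrow> n \<ge> 1 \<and> depth n \<ge> 1 \<and> blowup n \<ge> 1"
    using eventually_scales unfolding eventually_sequentially by blast
  have facts: "shallow_mean n \<in> borel_measurable P \<and> integrable P (\<lambda>\<omega>. (shallow_mean n \<omega> - m n)\<^sup>2) \<and>
      expectation (\<lambda>\<omega>. (shallow_mean n \<omega> - m n)\<^sup>2) \<le> (blowup n)\<^sup>2 / real (card (hypercube n))"
    if n: "n \<ge> n0" for n
  proof -
    have n1: "n \<ge> 1" "blowup n > 0" using n0[OF n] by auto
    note F = finite_hypercube[of n] hypercube_nonempty indep[OF n1(1)] shallow_trap_measurable[of n]
      shallow_trap_nonneg[OF n1(1)] shallow_trap_le[OF n1] shallow_expectation_eq[OF n1(1), folded m_def]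
    show ?thesis
      unfolding shallow_mean_def[abs_def]
      by (intro conjI empirical_mean_measurable[OF F] empirical_mean_integrable[OF F] empirical_mean_variance[OF F])
  qed
  have "AE \<omega> in P. (\<lambda>n. X (n + n0) \<omega>) \<longlonglongrightarrow> 0"
  proof (rule AE_tendsto_0_if_summable_second_moments[of _ 0 "\<lambda>n. \<beta> * (real (n + n0) * (b (n + n0))\<^sup>2 / 2 ^ (n + n0))"])
    fix n
    define k where "k = n + n0"
    have k: "k \<ge> n0" "k \<ge> 1" "depth k \<ge> 1" using n0[of k] by (auto simp: k_def)
    have [measurable]: "shallow_mean k \<in> borel_measurable P" using facts[OF k(1)] by blast
    have X: "X k = (\<lambda>\<omega>. b k * (shallow_mean k \<omega> - m k))" unfolding X_def using k by simp
    show "X (n + n0) \<in> borel_measurable P" unfolding k_def[symmetric] X by measurable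
    show "integrable P (\<lambda>\<omega>. (X (n + n0) \<omega>)\<^sup>2)"
      unfolding k_def[symmetric] X power_mult_distrib using facts[OF k(1)] by (intro integrable_mult_right) auto
    have "expectation (\<lambda>\<omega>. (X k \<omega>)\<^sup>2) = (b k)\<^sup>2 * expectation (\<lambda>\<omega>. (shallow_mean k \<omega> - m k)\<^sup>2)"
      unfolding X power_mult_distrib by simp
    also have "\<dots> \<le> (b k)\<^sup>2 * ((blowup k)\<^sup>2 / 2 ^ k)"
      using facts[OF k(1)] by (intro mult_left_mono) (auto simp: card_hypercube)
    also have "\<dots> \<le> (b k)\<^sup>2 * (\<beta> * real k / 2 ^ k)"
    proof (intro mult_left_mono divide_right_mono)
      have "(blowup k)\<^sup>2 = \<beta> * sqrt (real k) / depth k" unfolding blowup_def using k \<beta> by simp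
      also have "\<dots> \<le> \<beta> * sqrt (real k) / 1" using k \<beta> by (intro divide_left_mono) auto
      also have "\<dots> \<le> \<beta> * real k" using \<beta> k by (auto intro!: mult_left_mono real_le_lsqrt simp: power2_eq_square)
      finally show "(blowup k)\<^sup>2 \<le> \<beta> * real k" .
    qed auto
    finally show "expectation (\<lambda>\<omega>. (X (n + n0) \<omega>)\<^sup>2) \<le> \<beta> * (real (n + n0) * (b (n + n0))\<^sup>2 / 2 ^ (n + n0))"
      unfolding k_def[symmetric] by (simp add: mult_ac)
  next
    show "summable (\<lambda>n. \<beta> * (real (n + n0) * (b (n + n0))\<^sup>2 / 2 ^ (n + n0)))"
      using summable_ignore_initial_segment[OF summable_variance_bound] .
  qed
  then show ?thesis
  proof eventually_elim
    case (elim \<omega>)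
    then have "(\<lambda>n. X n \<omega>) \<longlonglongrightarrow> 0" by (rule LIMSEQ_offset)
    then have "(\<lambda>n. X n \<omega> + b n * m n) \<longlonglongrightarrow> 0 + 0" by (intro tendsto_add bm)
    moreover have "eventually (\<lambda>n. X n \<omega> + b n * m n = b n * shallow_mean n \<omega>) sequentially"
      using eventually_ge_at_top[of 1] by eventually_elim (simp add: X_def algebra_simps)
    ultimately show ?case by (rule Lim_transform_eventually[THEN tendsto_eq_rhs]) simp
  qed
qed

end

section \<open>The clock process for a fixed landscape\<close>

text \<open>
  The walk and the waiting times are independent as processes; each waiting time is used
  through its own law only.
\<close>

locale hopping = hypercube_walk M n J for M :: "'s measure" and n :: nat and J :: "nat \<Rightarrow> 's \<Rightarrow> (nat \<Rightarrow> int)" +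
  fixes e :: "nat \<Rightarrow> 's \<Rightarrow> real"
  assumes exponential: "\<And>i. distributed M lborel (e i) (exponential_density 1)"
    and indep_walk_waiting: "indep_set
       (sets (vimage_algebra (space M) (\<lambda>w i. J i w) (PiM UNIV (\<lambda>_. count_space (hypercube n)))))
       (sets (vimage_algebra (space M) (\<lambda>w i. e i w) (PiM UNIV (\<lambda>_. borel))))"
begin

abbreviation "walk_algebra \<equiv> vimage_algebra (space M) (\<lambda>w i. J i w) (PiM UNIV (\<lambda>_. count_space (hypercube n)))"
abbreviation "waiting_algebra \<equiv> vimage_algebra (space M) (\<lambda>w i. e i w) (PiM UNIV (\<lambda>_. borel))"

lemma measurable_waiting [measurable]: "e i \<in> borel_measurable M"
  using distributed_measurable[OF exponential] by simp

lemma measurable_walk_algebra: "J i \<in> walk_algebra \<rightarrow>\<^sub>M count_space (hypercube n)"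
proof -
  have "(\<lambda>w i. J i w) \<in> walk_algebra \<rightarrow>\<^sub>M PiM UNIV (\<lambda>_. count_space (hypercube n))"
    by (rule measurable_vimage_algebra1) (auto simp: space_PiM walk_in_hypercube)
  from measurable_compose[OF this measurable_component_singleton[of i]] show ?thesis by simp
qed

lemma measurable_waiting_algebra: "e i \<in> borel_measurable waiting_algebra"
proof -
  have "(\<lambda>w i. e i w) \<in> waiting_algebra \<rightarrow>\<^sub>M PiM UNIV (\<lambda>_. borel)"
    by (rule measurable_vimage_algebra1) (auto simp: space_PiM)
  from measurable_compose[OF this measurable_component_singleton[of i]] show ?thesis by simp
qed

lemma sets_walk_algebra_at: "{w \<in> space M. J j w \<in> B} \<in> sets walk_algebra"
proof -
  have "J j -` (B \<inter> hypercube n) \<inter> space M \<in> sets walk_algebra"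
    using measurable_sets[OF measurable_walk_algebra, of "B \<inter> hypercube n" j] unfolding space_vimage_algebra
    by (metis Int_lower2 sets_count_space PowI)
  moreover have "J j -` (B \<inter> hypercube n) \<inter> space M = {w \<in> space M. J j w \<in> B}"
    using walk_in_hypercube by blast
  ultimately show ?thesis by argo
qed

text \<open>
  The index of the first visit to \<open>A\<close> is a function of the walk alone, hence independent of the waiting
  times.
\<close>

lemma sets_walk_algebra_avoid:
  "{w \<in> space M. (\<forall>j<i. J j w \<notin> A) \<and> J i w \<in> A} \<in> sets walk_algebra"
proof -
  have "{w \<in> space walk_algebra. \<forall>j\<in>{..<i}. J j w \<in> - A} \<in> sets walk_algebra"
    by (rule sets.sets_Collect_finite_All, unfold space_vimage_algebra, rule sets_walk_algebra_at, rule finite_lessThan)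
  from sets.Int[OF this sets_walk_algebra_at[of i A]] show ?thesis
    unfolding space_vimage_algebra by (rule back_subst[of "\<lambda>E. E \<in> sets walk_algebra"]) blast
qed

lemma first_visit_event: "{w \<in> space M. (\<forall>j<i. J j w \<notin> A) \<and> J i w \<in> A} \<in> events"
  by (rule subsetD[OF indep_setD_ev1[OF indep_walk_waiting] sets_walk_algebra_avoid])

lemma prob_first_visit_short_wait:
  assumes \<delta>: "\<delta> \<ge> 0"
  shows "prob {w \<in> space M. (\<forall>j<i. J j w \<notin> A) \<and> J i w \<in> A \<and> e i w \<le> \<delta>}
    \<le> \<delta> * prob {w \<in> space M. (\<forall>j<i. J j w \<notin> A) \<and> J i w \<in> A}"
proof -
  let ?A = "{w \<in> space M. (\<forall>j<i. J j w \<notin> A) \<and> J i w \<in> A}" and ?B = "{w \<in> space M. e i w \<le> \<delta>}"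
  have "e i -` {..\<delta>} \<inter> space M \<in> sets waiting_algebra"
    using measurable_sets[OF measurable_waiting_algebra, of "{..\<delta>}" i] unfolding space_vimage_algebra
    by (metis atMost_borel)
  moreover have "e i -` {..\<delta>} \<inter> space M = ?B" by auto
  ultimately have "?B \<in> sets waiting_algebra" by argo
  then have "prob (?A \<inter> ?B) = prob ?A * prob ?B"
    by (rule indep_setD[OF indep_walk_waiting sets_walk_algebra_avoid])
  moreover have "prob ?B \<le> \<delta>"
    using exponential_distributedD_le[OF exponential \<delta>] exp_ge_add_one_self[of "- \<delta>"] by simp
  moreover have "?A \<inter> ?B = {w \<in> space M. (\<forall>j<i. J j w \<notin> A) \<and> J i w \<in> A \<and> e i w \<le> \<delta>}" by auto
  ultimately show ?thesis using mult_left_mono[of "prob ?B" \<delta> "prob ?A"] by (simp add: mult.commute)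
qed

lemma waiting_nonneg: "AE w in M. e i w \<ge> 0"
proof -
  have "\<P>(w in M. 0 < e i w) = 1" using exponential_distributedD_gt[OF exponential, of 0] by simp
  then have "AE w in M. 0 < e i w" by (subst (asm) prob_Collect_eq_1) auto
  then show ?thesis by eventually_elim simp
qed

lemma waiting_integral: "integrable M (e i)" "expectation (e i) = 1"
proof -
  show 1: "expectation (e i) = 1" using exponential_distributed_expectation[OF _ exponential] by simp
  then show "integrable M (e i)" using not_integrable_integral_eq[of M "e i"] by fastforce
qed

lemma expectation_walk:
  fixes g :: "(nat \<Rightarrow> int) \<Rightarrow> real"
  shows "integrable M (\<lambda>w. g (J i w))" "expectation (\<lambda>w. g (J i w)) = (\<Sum>x\<in>hypercube n. g x) / 2 ^ n"
proof -
  have eq: "g (J i w) = (\<Sum>x\<in>hypercube n. g x * indicator {w \<in> space M. J i w = x} w)" if "w \<in> space M" for w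
    using walk_in_hypercube[OF that, of i] that by (simp add: indicator_def of_bool_def if_distrib cong: if_cong)
  have int: "integrable M (\<lambda>w. g x * indicator {w \<in> space M. J i w = x} w)" for x
    using sets_walk_eq[of i x] by (intro integrable_mult_right integrable_real_indicator) (auto simp: emeasure_eq_measure)
  show "integrable M (\<lambda>w. g (J i w))"
    by (rule Bochner_Integration.integrable_cong[OF refl eq, THEN iffD2], assumption)
       (intro Bochner_Integration.integrable_sum int)
  have "expectation (\<lambda>w. g (J i w)) = expectation (\<lambda>w. \<Sum>x\<in>hypercube n. g x * indicator {w \<in> space M. J i w = x} w)"
    by (intro Bochner_Integration.integral_cong eq) auto
  also have "\<dots> = (\<Sum>x\<in>hypercube n. expectation (\<lambda>w. g x * indicator {w \<in> space M. J i w = x} w))"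
    by (rule Bochner_Integration.integral_sum) (rule int)
  also have "\<dots> = (\<Sum>x\<in>hypercube n. g x * (1 / 2 ^ n))"
    using prob_walk_at sets_walk_eq by (intro sum.cong) (auto simp: emeasure_eq_measure)
  finally show "expectation (\<lambda>w. g (J i w)) = (\<Sum>x\<in>hypercube n. g x) / 2 ^ n" by (simp add: sum_divide_distrib)
qed

lemma expectation_walk_waiting:
  fixes g :: "(nat \<Rightarrow> int) \<Rightarrow> real"
  shows "integrable M (\<lambda>w. g (J i w) * e i w)"
    "expectation (\<lambda>w. g (J i w) * e i w) = (\<Sum>x\<in>hypercube n. g x) / 2 ^ n"
proof -
  have g: "(\<lambda>w. g (J i w)) \<in> borel_measurable walk_algebra"
    by (rule measurable_compose[OF measurable_walk_algebra]) simp
  have gM: "(\<lambda>w. g (J i w)) \<in> borel_measurable M"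
    by (rule measurable_compose[OF measurable_walk]) simp
  have "sigma_sets (space M) {(\<lambda>w. g (J i w)) -` A \<inter> space M |A. A \<in> sets borel} \<subseteq> sets walk_algebra"
    using sets.sigma_sets_subset[of "{(\<lambda>w. g (J i w)) -` A \<inter> space M |A. A \<in> sets borel}" walk_algebra]
      measurable_sets[OF g] by auto
  moreover have "sigma_sets (space M) {e i -` A \<inter> space M |A. A \<in> sets borel} \<subseteq> sets waiting_algebra"
    using sets.sigma_sets_subset[of "{e i -` A \<inter> space M |A. A \<in> sets borel}" waiting_algebra]
      measurable_sets[OF measurable_waiting_algebra[of i]] by auto
  ultimately have ind: "indep_var borel (\<lambda>w. g (J i w)) borel (e i)"
    unfolding indep_var_eq indep_sets2_eq
    using gM measurable_waiting indep_setD_ev1[OF indep_walk_waiting] indep_setD_ev2[OF indep_walk_waiting]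
      indep_setD[OF indep_walk_waiting]
    by (intro conjI ballI) blast+
  show "integrable M (\<lambda>w. g (J i w) * e i w)"
    by (rule indep_var_integrable[OF ind expectation_walk(1) waiting_integral(1)])
  show "expectation (\<lambda>w. g (J i w) * e i w) = (\<Sum>x\<in>hypercube n. g x) / 2 ^ n"
    using indep_var_lebesgue_integral[OF ind expectation_walk(1) waiting_integral(1)]
    by (simp add: waiting_integral expectation_walk)
qed

text \<open>
  On this event the shallow traps \<open>g\<close> add up to less than \<open>\<epsilon>\<close> and the first visit to the deep traps
  \<open>A\<close> lasts longer than \<open>\<delta>\<close>.
\<close>

definition good_event :: "((nat \<Rightarrow> int) \<Rightarrow> real) \<Rightarrow> (nat \<Rightarrow> int) set \<Rightarrow> real \<Rightarrow> real \<Rightarrow> nat \<Rightarrow> 's set" where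
  "good_event g A \<epsilon> \<delta> k = {w \<in> space M. (\<forall>i\<le>k. 0 \<le> e i w) \<and> (\<Sum>i\<le>k. g (J i w) * e i w) < \<epsilon> \<and>
     (\<forall>i\<le>k. (\<forall>j<i. J j w \<notin> A) \<and> J i w \<in> A \<longrightarrow> \<delta> < e i w)}"

text \<open>
  Markov's inequality for the shallow traps; for the deep ones, the first visits at different times are
  disjoint events, and a waiting time is shorter than \<open>\<delta>\<close> with probability at most \<open>\<delta>\<close>.
\<close>

lemma
  fixes g :: "(nat \<Rightarrow> int) \<Rightarrow> real"
  assumes g: "\<And>x. g x \<ge> 0" and \<epsilon>: "\<epsilon> > 0" and \<delta>: "\<delta> \<ge> 0"
  shows sets_good_event: "good_event g A \<epsilon> \<delta> k \<in> events"
    and prob_good_event: "prob (good_event g A \<epsilon> \<delta> k) \<ge>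
       1 - real (k + 1) * ((\<Sum>x\<in>hypercube n. g x) / 2 ^ n) / \<epsilon> - \<delta>"
proof -
  define Z where "Z w = (\<Sum>i\<le>k. g (J i w) * e i w)" for w
  define F where "F i = {w \<in> space M. (\<forall>j<i. J j w \<notin> A) \<and> J i w \<in> A}" for i
  have F: "F i \<in> events" for i unfolding F_def by (rule first_visit_event)
  have [measurable]: "(\<lambda>w. g (J i w)) \<in> borel_measurable M" for i
    by (rule measurable_compose[OF measurable_walk]) simp
  have [measurable]: "Z \<in> borel_measurable M" unfolding Z_def by measurable
  define B0 where "B0 = {w \<in> space M. \<exists>i\<le>k. e i w < 0}"
  define B1 where "B1 = {w \<in> space M. \<epsilon> \<le> Z w}"
  define B2 where "B2 i = F i \<inter> {w \<in> space M. e i w \<le> \<delta>}" for i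
  have B0: "B0 \<in> events" and B1: "B1 \<in> events" unfolding B0_def B1_def by measurable
  have B2: "B2 i \<in> events" for i unfolding B2_def by (intro sets.Int F) measurable
  have G: "good_event g A \<epsilon> \<delta> k = space M - (B0 \<union> B1 \<union> (\<Union>i\<le>k. B2 i))"
    unfolding good_event_def B0_def B1_def B2_def F_def Z_def by (auto simp: not_le not_less)
  have bad: "B0 \<union> B1 \<union> (\<Union>i\<le>k. B2 i) \<in> events" using B0 B1 B2 by auto
  show "good_event g A \<epsilon> \<delta> k \<in> events" unfolding G using bad by auto
  have ae: "AE w in M. \<forall>i\<in>{..k}. 0 \<le> e i w"
    by (subst AE_finite_all) (auto intro: waiting_nonneg)
  have "prob B0 = 0"
  proof -
    have "AE w in M. w \<notin> B0" using ae by eventually_elim (auto simp: B0_def not_less)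
    then show ?thesis using B0 by (simp add: prob_eq_0)
  qed
  moreover have "prob B1 \<le> real (k + 1) * ((\<Sum>x\<in>hypercube n. g x) / 2 ^ n) / \<epsilon>"
  proof -
    have intZ: "integrable M Z" unfolding Z_def by (intro Bochner_Integration.integrable_sum expectation_walk_waiting)
    have "expectation Z = (\<Sum>i\<le>k. expectation (\<lambda>w. g (J i w) * e i w))"
      unfolding Z_def by (rule Bochner_Integration.integral_sum) (rule expectation_walk_waiting)
    then have EZ: "expectation Z = real (k + 1) * ((\<Sum>x\<in>hypercube n. g x) / 2 ^ n)"
      by (simp add: expectation_walk_waiting)
    have "AE w in M. 0 \<le> Z w"
      using ae by eventually_elim (auto simp: Z_def intro!: sum_nonneg mult_nonneg_nonneg g)
    then have "prob B1 \<le> expectation Z / \<epsilon>"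
      unfolding B1_def by (intro integral_Markov_inequality_measure[OF intZ, of "{}"] \<epsilon>) auto
    then show ?thesis unfolding EZ .
  qed
  moreover have "prob (\<Union>i\<le>k. B2 i) \<le> \<delta>"
  proof -
    have disj: "disjoint_family_on F {..k}"
      unfolding disjoint_family_on_def F_def using linorder_neqE_nat by blast
    have "prob (\<Union>i\<le>k. B2 i) \<le> (\<Sum>i\<le>k. prob (B2 i))"
      using B2 by (intro finite_measure_subadditive_finite) auto
    also have "\<dots> \<le> (\<Sum>i\<le>k. \<delta> * prob (F i))"
    proof (rule sum_mono)
      fix i
      have "B2 i = {w \<in> space M. (\<forall>j<i. J j w \<notin> A) \<and> J i w \<in> A \<and> e i w \<le> \<delta>}"
        by (auto simp: B2_def F_def)
      then show "prob (B2 i) \<le> \<delta> * prob (F i)" using prob_first_visit_short_wait[OF \<delta>] by (simp add: F_def)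
    qed
    also have "\<dots> = \<delta> * prob (\<Union>i\<le>k. F i)"
      using F by (subst finite_measure_finite_Union[OF _ _ disj]) (auto simp: sum_distrib_left)
    also have "\<dots> \<le> \<delta>" using \<delta> by (simp add: mult_left_le)
    finally show ?thesis .
  qed
  moreover have "prob (B0 \<union> B1 \<union> (\<Union>i\<le>k. B2 i)) \<le> prob B0 + prob B1 + prob (\<Union>i\<le>k. B2 i)"
  proof -
    have "(\<Union>i\<le>k. B2 i) \<in> events" using B2 by auto
    then have "prob (B0 \<union> B1 \<union> (\<Union>i\<le>k. B2 i)) \<le> prob (B0 \<union> B1) + prob (\<Union>i\<le>k. B2 i)"
      using B0 B1 by (intro measure_Un_le) auto
    also have "prob (B0 \<union> B1) \<le> prob B0 + prob B1" using B0 B1 by (rule measure_Un_le)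
    finally show ?thesis by simp
  qed
  ultimately show "prob (good_event g A \<epsilon> \<delta> k) \<ge>
       1 - real (k + 1) * ((\<Sum>x\<in>hypercube n. g x) / 2 ^ n) / \<epsilon> - \<delta>"
    unfolding G prob_compl[OF bad] by linarith
qed

text \<open>
  On the good event the clock is below \<open>\<epsilon>\<close> before the first deep trap. This trap contributes at least
  \<open>\<Lambda>\<close> times its waiting time, hence more than \<open>1 / \<epsilon>\<close>, which \<open>exp_neg\<close> maps below \<open>\<epsilon>\<close>.
\<close>

lemma clock_near_jump:
  fixes \<tau> :: "(nat \<Rightarrow> int) \<Rightarrow> real"
  assumes a: "a > 0" and c: "c > 0" and \<tau>: "\<And>x. \<tau> x > 0" and \<epsilon>: "\<epsilon> > 0" and \<Lambda>: "\<Lambda> > 0" and T: "T \<ge> 0"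
    and A: "\<And>x. x \<in> A \<Longrightarrow> \<tau> x \<ge> \<Lambda> * c"
    and w: "w \<in> good_event (\<lambda>x. if x \<in> A then 0 else \<tau> x / c) A \<epsilon> (1 / (\<epsilon> * \<Lambda>)) (nat \<lfloor>a * T\<rfloor>)"
  shows "\<exists>\<sigma>. near_jump \<epsilon> T \<sigma> (rescaled_clock c a \<tau> J e w) \<and>
    (\<forall>s\<in>{0..T}. (\<forall>i\<le>nat \<lfloor>a * s\<rfloor>. J i w \<notin> A) \<longleftrightarrow> s < \<sigma>)"
proof -
  define k where "k = nat \<lfloor>a * T\<rfloor>"
  define g where "g x = (if x \<in> A then 0 else \<tau> x / c)" for x
  have e0: "0 \<le> e i w" if "i \<le> k" for i using w that by (auto simp: good_event_def k_def)
  have shallow: "(\<Sum>i\<le>k. g (J i w) * e i w) < \<epsilon>" using w by (auto simp: good_event_def k_def g_def[abs_def])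
  have long: "1 / (\<epsilon> * \<Lambda>) < e i w" if "i \<le> k" "\<And>j. j < i \<Longrightarrow> J j w \<notin> A" "J i w \<in> A" for i
    using w that by (auto simp: good_event_def k_def)
  define S where "S i = inverse c * clock_process \<tau> J e i w" for i
  have S: "S i = (\<Sum>j\<le>i. \<tau> (J j w) / c * e j w)" for i
    unfolding S_def clock_process_def sum_distrib_left by (intro sum.cong) (auto simp: field_simps)
  have path: "rescaled_clock c a \<tau> J e w = step_path a S"
    unfolding rescaled_clock_def step_path_def S_def ..
  have S_nonneg: "S i \<ge> 0" if "i \<le> k" for i
    unfolding S using e0 that \<tau> c by (intro sum_nonneg mult_nonneg_nonneg) (auto simp: less_imp_le)
  have before: "1 - \<epsilon> \<le> exp_neg (ennreal (S i))" if i: "i \<le> k" and no: "\<And>j. j \<le> i \<Longrightarrow> J j w \<notin> A" for i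
  proof -
    have "S i = (\<Sum>j\<le>i. g (J j w) * e j w)" unfolding S using no by (intro sum.cong) (auto simp: g_def)
    also have "\<dots> \<le> (\<Sum>j\<le>k. g (J j w) * e j w)"
      using i e0 \<tau> c by (intro sum_mono2) (auto simp: g_def less_imp_le)
    finally have "S i \<le> \<epsilon>" using shallow by simp
    then have "1 - \<epsilon> \<le> exp (- S i)" using exp_ge_add_one_self[of "- S i"] by linarith
    then show ?thesis using S_nonneg[OF i] by (simp add: exp_neg_def)
  qed
  have after: "exp_neg (ennreal (S i)) \<le> \<epsilon>"
    if i: "i \<le> k" and j: "j \<le> i" "\<And>l. l < j \<Longrightarrow> J l w \<notin> A" "J j w \<in> A" for i j
  proof -
    have "1 / \<epsilon> = \<Lambda> * (1 / (\<epsilon> * \<Lambda>))" using \<Lambda> \<epsilon> by simp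
    also have "\<dots> \<le> \<tau> (J j w) / c * e j w"
      using long[of j] i j A[OF j(3)] c \<Lambda> \<epsilon> \<tau>[of "J j w"] by (intro mult_mono) (auto simp: pos_le_divide_eq less_imp_le)
    also have "\<dots> \<le> S i"
      unfolding S using j i e0 \<tau> c by (intro member_le_sum) (auto simp: less_imp_le)
    finally have "1 / \<epsilon> \<le> S i" .
    then have "exp (- S i) \<le> exp (- (1 / \<epsilon>))" by simp
    also have "\<dots> \<le> \<epsilon>"
    proof -
      have "1 / \<epsilon> \<le> exp (1 / \<epsilon>)" using exp_ge_add_one_self[of "1 / \<epsilon>"] by linarith
      then show ?thesis using \<epsilon> by (simp add: exp_minus field_simps)
    qed
    finally show ?thesis using S_nonneg[OF i] by (simp add: exp_neg_def)
  qed
  have floor_le: "nat \<lfloor>a * s\<rfloor> \<le> k" if "s \<in> {0..T}" for s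
    unfolding k_def using that a by (intro nat_mono floor_mono) auto
  have less_iff: "nat \<lfloor>a * s\<rfloor> < K \<longleftrightarrow> s < real K / a" if "s \<in> {0..T}" for s K
  proof -
    have "a * s \<ge> 0" using that a by simp
    then have "nat \<lfloor>a * s\<rfloor> < K \<longleftrightarrow> a * s < real K" by linarith
    then show ?thesis using a by (simp add: pos_less_divide_eq mult.commute)
  qed
  show ?thesis
  proof (cases "\<exists>i\<le>k. J i w \<in> A")
    case True
    define K where "K = (LEAST i. J i w \<in> A)"
    have KA: "J K w \<in> A" unfolding K_def using True LeastI_ex[of "\<lambda>i. J i w \<in> A"] by blast
    have Kmin: "J l w \<notin> A" if "l < K" for l using that not_less_Least unfolding K_def by blast
    have iff: "(\<forall>i\<le>nat \<lfloor>a * s\<rfloor>. J i w \<notin> A) \<longleftrightarrow> s < real K / a" if s: "s \<in> {0..T}" for s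
    proof -
      have "(\<forall>i\<le>m. J i w \<notin> A) \<longleftrightarrow> m < K" for m
        using KA Kmin by (meson le_less_trans not_le)
      then show ?thesis using less_iff[OF s, of K] by simp
    qed
    have "near_jump \<epsilon> T (real K / a) (step_path a S)"
      unfolding near_jump_def
    proof (intro conjI ballI step_path_cadlag a)
      fix t assume t: "t \<in> {0..T}"
      show "if t < real K / a then 1 - \<epsilon> \<le> exp_neg (step_path a S t) else exp_neg (step_path a S t) \<le> \<epsilon>"
        using before[OF floor_le[OF t]] after[OF floor_le[OF t], of K] iff[OF t] KA Kmin less_iff[OF t, of K] t
        by (auto simp: step_path_def not_less)
    qed
    then show ?thesis using iff unfolding path by blast
  next
    case False
    \<comment> \<open>without a visit in the window, any jump time beyond \<open>T\<close> will do\<close>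
    have iff: "(\<forall>i\<le>nat \<lfloor>a * s\<rfloor>. J i w \<notin> A) \<longleftrightarrow> s < T + 1" if s: "s \<in> {0..T}" for s
      using False floor_le[OF s] s by auto
    have "near_jump \<epsilon> T (T + 1) (step_path a S)"
      unfolding near_jump_def
    proof (intro conjI ballI step_path_cadlag a)
      fix t assume t: "t \<in> {0..T}"
      show "if t < T + 1 then 1 - \<epsilon> \<le> exp_neg (step_path a S t) else exp_neg (step_path a S t) \<le> \<epsilon>"
        using before[OF floor_le[OF t]] iff[OF t] t by (auto simp: step_path_def)
    qed
    then show ?thesis using iff unfolding path by blast
  qed
qed

lemma measurable_rescaled_clock:
  assumes a: "a > 0"
  shows "rescaled_clock c a \<tau> J e \<in> M \<rightarrow>\<^sub>M borel_of_top skorohod_J1"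
proof -
  have [measurable]: "(\<lambda>w. \<tau> (J i w)) \<in> borel_measurable M" for i
    by (rule measurable_compose[OF measurable_walk]) simp
  have "(\<lambda>w. step_path a (\<lambda>k. inverse c * clock_process \<tau> J e k w)) \<in> M \<rightarrow>\<^sub>M borel_of_top skorohod_J1"
    by (rule measurable_step_path[OF a]) (simp add: clock_process_def)
  moreover have "rescaled_clock c a \<tau> J e = (\<lambda>w. step_path a (\<lambda>k. inverse c * clock_process \<tau> J e k w))"
    unfolding rescaled_clock_def step_path_def ..
  ultimately show ?thesis by simp
qed

end

section \<open>Weak convergence\<close>

lemma short_subordinator_functional_le:
  fixes f :: "(real \<Rightarrow> ennreal) \<Rightarrow> real"
  assumes S: "subordinator_of_levy_measure nu_short N S"
    and f: "continuous_map skorohod_J1 euclideanreal f" and B: "\<And>y. y \<in> cadlag \<Longrightarrow> \<bar>f y\<bar> \<le> B"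
    and \<eta>: "\<eta> \<ge> 0" and \<epsilon>: "\<epsilon> \<ge> 0" and s: "s 0 = \<delta>" "s m = L" "\<And>i. i \<le> m \<Longrightarrow> 0 \<le> s i \<and> s i \<le> T"
    and approx: "\<And>\<sigma> y. near_jump \<epsilon> T \<sigma> y \<Longrightarrow>
        \<bar>f y - (\<Sum>i<m. v i * (of_bool (s i < \<sigma>) - of_bool (s (Suc i) < \<sigma>)))\<bar>
          \<le> \<eta> + B * (1 - of_bool (\<delta> < \<sigma>) + of_bool (L < \<sigma>))"
  shows "\<bar>(\<integral>y. f y \<partial>distr N (borel_of_top skorohod_J1) S) -
           (\<Sum>i<m. v i * (exp (- s i) - exp (- s (Suc i))))\<bar> \<le> \<eta> + B * (1 - exp (- \<delta>) + exp (- L))"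
proof -
  have sub: "subordinator N S" using S by (simp add: subordinator_of_levy_measure_def)
  interpret prob_space N using sub by (simp add: subordinator_def)
  define U where "U t = {w \<in> space N. S w t = 0}" for t
  have pU: "prob (U t) = exp (- t)" if "t \<ge> 0" for t
    unfolding U_def by (rule prob_short_subordinator[OF S that])
  have U: "U t \<in> events" if "t \<ge> 0" for t
  proof -
    have [measurable]: "(\<lambda>w. S w t) \<in> borel_measurable N" using sub that by (simp add: subordinator_def)
    show ?thesis unfolding U_def by measurable
  qed
  obtain Z where Z: "{w \<in> space N. \<not> (\<exists>\<sigma>. near_jump \<epsilon> T \<sigma> (S w) \<and> (\<forall>t\<in>{0..T}. S w t = 0 \<longleftrightarrow> t < \<sigma>))} \<subseteq> Z"
    "emeasure N Z = 0" "Z \<in> events"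
    using AE_E[OF AE_short_subordinator_near_jump[OF S \<epsilon>, of T]] .
  have "prob Z = 0" using Z(2) by (simp add: measure_def)
  then have G: "prob (space N - Z) = 1" using prob_compl[OF Z(3)] by simp
  have "\<bar>(\<integral>y. f y \<partial>distr N (borel_of_top skorohod_J1) S) -
           (\<Sum>i<m. v i * (prob (U (s i)) - prob (U (s (Suc i)))))\<bar>
         \<le> \<eta> + B * (1 - prob (U \<delta>) + prob (U L)) + (2 * B + (\<Sum>i<m. \<bar>v i\<bar>)) * (1 - prob (space N - Z))"
  proof (rule expectation_functional_near_jump[OF _ f B \<eta> s(1,2) approx])
    show "S \<in> N \<rightarrow>\<^sub>M borel_of_top skorohod_J1" using sub by (simp add: subordinator_def)
    show "U (s i) \<in> events" if "i \<le> m" for i using U s(3)[OF that] by simp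
    show "space N - Z \<in> events" using Z by auto
    fix w assume w: "w \<in> space N - Z"
    then obtain \<sigma> where \<sigma>: "near_jump \<epsilon> T \<sigma> (S w)" "\<forall>t\<in>{0..T}. S w t = 0 \<longleftrightarrow> t < \<sigma>"
      using Z(1) by blast
    moreover have "\<forall>i\<le>m. w \<in> U (s i) \<longleftrightarrow> s i < \<sigma>"
      using \<sigma>(2) s(3) w by (auto simp: U_def)
    ultimately show "\<exists>\<sigma>. near_jump \<epsilon> T \<sigma> (S w) \<and> (\<forall>i\<le>m. w \<in> U (s i) \<longleftrightarrow> s i < \<sigma>)" by blast
  qed
  moreover have "(\<Sum>i<m. v i * (prob (U (s i)) - prob (U (s (Suc i))))) = (\<Sum>i<m. v i * (exp (- s i) - exp (- s (Suc i))))"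
    using s(3) by (intro sum.cong) (auto simp: pU)
  moreover have "prob (U \<delta>) = exp (- \<delta>)" "prob (U L) = exp (- L)" using pU s(3)[of 0] s(3)[of m] s(1,2) by auto
  ultimately show ?thesis using G by simp
qed

context quenched
begin

lemma shallow_trap_eq:
  assumes n: "n \<ge> 1"
  shows "shallow_trap n (H n x \<omega>) =
    (if x \<in> {x. H n x \<omega> \<le> - top_depth n} then 0 else trap_depth \<beta> H n \<omega> x / r n)"
  by (auto simp: shallow_trap_def trap_depth_def)

lemma deep_trap_ge:
  assumes n: "n \<ge> 1" "blowup n > 0" and x: "H n x \<omega> \<le> - top_depth n"
  shows "trap_depth \<beta> H n \<omega> x \<ge> blowup n * r n"
proof -
  have "(\<beta> * sqrt (real n)) * top_depth n \<le> (\<beta> * sqrt (real n)) * (- H n x \<omega>)"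
    using x \<beta> by (intro mult_left_mono) auto
  then show ?thesis unfolding exp_top_depth[OF n, symmetric] trap_depth_def by simp
qed

text \<open>
  Both integrals are compared with linear combinations of the probabilities that no jump has occurred
  up to the points of the same partition; for the clock these are the avoidance probabilities, which converge
  to those of the exponential law.
\<close>

lemma weak_convergence_quenched:
  fixes e :: "nat \<Rightarrow> nat \<Rightarrow> 's \<Rightarrow> real"
  assumes hop: "\<And>n. n \<ge> 1 \<Longrightarrow> hopping (D n) n (J n) (e n)"
    and S: "subordinator_of_levy_measure nu_short N S"
    and avoid: "\<And>t. t \<in> \<rat> \<Longrightarrow> t \<ge> 0 \<Longrightarrow> (\<lambda>n. avoid_prob t n \<omega>) \<longlonglongrightarrow> exp (- t)"
    and shallow: "(\<lambda>n. b n * shallow_mean n \<omega>) \<longlonglongrightarrow> 0"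
  shows "weak_conv_top skorohod_J1
     (\<lambda>n. distr (D n) (borel_of_top skorohod_J1)
            (rescaled_clock (r n) (a n) (trap_depth \<beta> H n \<omega>) (J n) (e n)))
     (distr N (borel_of_top skorohod_J1) S)"
  unfolding weak_conv_top_def
proof (intro allI impI)
  fix f :: "(real \<Rightarrow> ennreal) \<Rightarrow> real"
  assume "continuous_map skorohod_J1 euclideanreal f \<and> bounded (f ` topspace skorohod_J1)"
  then have f: "continuous_map skorohod_J1 euclideanreal f" and "bounded (f ` cadlag)"
    by (auto simp: topspace_skorohod_J1)
  then obtain B where B: "\<And>y. y \<in> cadlag \<Longrightarrow> \<bar>f y\<bar> \<le> B" by (auto simp: bounded_iff)
  define I where "I n = (\<integral>y. f y \<partial>distr (D n) (borel_of_top skorohod_J1)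
            (rescaled_clock (r n) (a n) (trap_depth \<beta> H n \<omega>) (J n) (e n)))" for n
  let ?I0 = "\<integral>y. f y \<partial>distr N (borel_of_top skorohod_J1) S"
  have "I \<longlonglongrightarrow> ?I0"
  proof (rule LIMSEQ_I)
    fix \<xi> :: real assume \<xi>: "\<xi> > 0"
    have "(\<lambda>q. B * (1 - exp (- (1 / real q)) + exp (- real q))) \<longlonglongrightarrow> B * (1 - exp (- 0) + 0)"
      by (intro tendsto_intros lim_1_over_n) real_asymp
    then have "eventually (\<lambda>q. B * (1 - exp (- (1 / real q)) + exp (- real q)) < \<xi> / 8) sequentially"
      using \<xi> by (intro order_tendstoD(2)) auto
    then have "eventually (\<lambda>q. q \<ge> 2 \<and> B * (1 - exp (- (1 / real q)) + exp (- real q)) < \<xi> / 8) sequentially"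
      using eventually_ge_at_top[of 2] by eventually_elim simp
    \<comment> \<open>the jump time lies in \<open>[1/q, q]\<close> up to a small probability\<close>
    then obtain q :: nat where q: "q \<ge> 2" "B * (1 - exp (- (1 / real q)) + exp (- real q)) < \<xi> / 8"
      unfolding eventually_sequentially by blast
    define \<delta> L where "\<delta> = 1 / real q" and "L = real q"
    have \<delta>L: "0 < \<delta>" "\<delta> < L" "\<delta> \<in> \<rat>" "L \<in> \<rat>"
    proof -
      have "1 / real q < 1" "1 < real q" using q(1) by auto
      then have "1 / real q < real q" by linarith
      then show "\<delta> < L" by (simp add: \<delta>_def L_def)
    qed (use q(1) in \<open>auto simp: \<delta>_def L_def\<close>)
    have tail: "B * (1 - exp (- \<delta>) + exp (- L)) < \<xi> / 8" using q(2) by (simp add: \<delta>_def L_def)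
    have \<eta>: "\<xi> / 8 > 0" using \<xi> by simp
    obtain \<epsilon> T and m :: nat and s v where \<epsilon>: "\<epsilon> > 0" and T: "T \<ge> L" and s: "s 0 = \<delta>" "s m = L"
      "\<And>i. i \<le> m \<Longrightarrow> s i \<in> \<rat> \<and> \<delta> \<le> s i \<and> s i \<le> L"
      and approx: "\<And>\<sigma> y. near_jump \<epsilon> T \<sigma> y \<Longrightarrow>
        \<bar>f y - (\<Sum>i<m. v i * (of_bool (s i < \<sigma>) - of_bool (s (Suc i) < \<sigma>)))\<bar>
          \<le> \<xi> / 8 + B * (1 - of_bool (\<delta> < \<sigma>) + of_bool (L < \<sigma>))"
      by (rule discretise_functional_near_jump[OF f B \<eta> \<delta>L]) blast+
    have sT: "0 \<le> s i \<and> s i \<le> T" if "i \<le> m" for i using s(3)[OF that] T \<delta>L(1) by linarith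
    define \<Psi> where "\<Psi> = (\<Sum>i<m. v i * (exp (- s i) - exp (- s (Suc i))))"
    have lim: "\<bar>?I0 - \<Psi>\<bar> \<le> \<xi> / 8 + B * (1 - exp (- \<delta>) + exp (- L))"
      unfolding \<Psi>_def
      by (rule short_subordinator_functional_le[OF S f B _ _ s(1,2) sT approx]) (use \<eta> \<epsilon> in auto)
    have av: "(\<lambda>n. avoid_prob (s i) n \<omega>) \<longlonglongrightarrow> exp (- s i)" if "i \<le> m" for i
      using s(3)[OF that] \<delta>L(1) by (intro avoid) auto
    define \<Psi>n where "\<Psi>n n = (\<Sum>i<m. v i * (avoid_prob (s i) n \<omega> - avoid_prob (s (Suc i)) n \<omega>))" for n
    have \<Psi>n: "\<Psi>n \<longlonglongrightarrow> \<Psi>"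
      unfolding \<Psi>n_def[abs_def] \<Psi>_def by (intro tendsto_intros av) auto
    define err where "err n = real (steps n T + 1) * shallow_mean n \<omega> / \<epsilon> + 1 / (\<epsilon> * blowup n)" for n
    have T0: "T \<ge> 0" using T \<delta>L by linarith
    have err: "err \<longlonglongrightarrow> 0"
    proof -
      have "(\<lambda>n. real (steps n T + 1) / b n * (b n * shallow_mean n \<omega>) / \<epsilon> + 1 / \<epsilon> * inverse (blowup n)) \<longlonglongrightarrow> T * 0 / \<epsilon> + 1 / \<epsilon> * 0"
        using \<epsilon> by (intro tendsto_intros steps_ratio T0 shallow tendsto_inverse_0_at_top blowup_at_top) auto
      moreover have "eventually (\<lambda>n. real (steps n T + 1) / b n * (b n * shallow_mean n \<omega>) / \<epsilon> + 1 / \<epsilon> * inverse (blowup n) = err n) sequentially"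
        using eventually_ge_at_top[of 1]
      proof eventually_elim
        case (elim n)
        then show ?case using b_pos[of n] by (simp add: err_def divide_inverse)
      qed
      ultimately show ?thesis by (rule Lim_transform_eventually[THEN tendsto_eq_rhs]) simp
    qed
    define C where "C = 2 * B + (\<Sum>i<m. \<bar>v i\<bar>)"
    have C: "C \<ge> 0" unfolding C_def using B[OF jump_path_cadlag[of 0]] by (intro add_nonneg_nonneg sum_nonneg) auto
    have est: "eventually (\<lambda>n. \<bar>I n - \<Psi>n n\<bar> \<le> \<xi> / 8 + B * (1 - avoid_prob \<delta> n \<omega> + avoid_prob L n \<omega>) + C * err n) sequentially"
      using a_pos eventually_scales
    proof eventually_elim
      case (elim n)
      have n: "n \<ge> 1" "blowup n > 0" using elim by auto
      interpret W: hopping "D n" n "J n" "e n" by (rule hop[OF n(1)])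
      define A where "A = {x. H n x \<omega> \<le> - top_depth n}"
      define g where "g x = (if x \<in> A then 0 else trap_depth \<beta> H n \<omega> x / r n)" for x
      define U where "U t = {w \<in> space (D n). \<forall>i\<le>steps n t. J n i w \<notin> A}" for t
      define G where "G = W.good_event g A \<epsilon> (1 / (\<epsilon> * blowup n)) (steps n T)"
      have PU: "W.prob (U t) = avoid_prob t n \<omega>" for t
        unfolding U_def A_def avoid_prob_def by simp
      have g0: "g x \<ge> 0" for x using r[OF n(1)] by (auto simp: g_def trap_depth_def)
      have \<delta>': "1 / (\<epsilon> * blowup n) \<ge> 0" using \<epsilon> n by simp
      have mean: "(\<Sum>x\<in>hypercube n. g x) / 2 ^ n = shallow_mean n \<omega>"
        unfolding shallow_mean_def shallow_trap_eq[OF n(1)] g_def A_def by (simp add: card_hypercube)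
      have "W.prob G \<ge> 1 - real (steps n T + 1) * shallow_mean n \<omega> / \<epsilon> - 1 / (\<epsilon> * blowup n)"
        unfolding G_def mean[symmetric] by (rule W.prob_good_event[OF g0 \<epsilon> \<delta>'])
      then have PG: "1 - W.prob G \<le> err n" unfolding err_def by linarith
      have "\<bar>I n - (\<Sum>i<m. v i * (W.prob (U (s i)) - W.prob (U (s (Suc i)))))\<bar>
         \<le> \<xi> / 8 + B * (1 - W.prob (U \<delta>) + W.prob (U L)) + (2 * B + (\<Sum>i<m. \<bar>v i\<bar>)) * (1 - W.prob G)"
        unfolding I_def
      proof (rule W.expectation_functional_near_jump[where U = U and G = G, OF _ f B _ s(1,2) approx])
        show "rescaled_clock (r n) (a n) (trap_depth \<beta> H n \<omega>) (J n) (e n) \<in> D n \<rightarrow>\<^sub>M borel_of_top skorohod_J1"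
          by (rule W.measurable_rescaled_clock) (use elim in simp)
        have "U t \<in> W.events" for t
        proof -
          have "U t = {w \<in> space (D n). \<forall>i\<le>steps n t. (\<lambda>i\<in>{..steps n t}. J n i w) i \<notin> A}"
            unfolding U_def by auto
          then show ?thesis
            using W.sets_path_event[of "\<lambda>x. \<forall>i\<le>steps n t. x i \<notin> A" "steps n t"] by argo
        qed
        then show "U (s i) \<in> W.events" for i .
        show "G \<in> W.events" unfolding G_def by (rule W.sets_good_event[OF g0 \<epsilon> \<delta>'])
        fix w assume w: "w \<in> G"
        have sp: "w \<in> space (D n)" using w by (auto simp: G_def W.good_event_def)
        have "\<exists>\<sigma>. near_jump \<epsilon> T \<sigma> (rescaled_clock (r n) (a n) (trap_depth \<beta> H n \<omega>) (J n) (e n) w) \<and>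
            (\<forall>s\<in>{0..T}. (\<forall>i\<le>nat \<lfloor>a n * s\<rfloor>. J n i w \<notin> A) \<longleftrightarrow> s < \<sigma>)"
        proof (rule W.clock_near_jump)
          show "w \<in> W.good_event (\<lambda>x. if x \<in> A then 0 else trap_depth \<beta> H n \<omega> x / r n) A \<epsilon>
              (1 / (\<epsilon> * blowup n)) (nat \<lfloor>a n * T\<rfloor>)"
            using w unfolding G_def g_def[abs_def] steps_def .
        qed (use elim n r \<epsilon> T0 deep_trap_ge[OF n] in \<open>auto simp: A_def trap_depth_def\<close>)
        then obtain \<sigma> where \<sigma>: "near_jump \<epsilon> T \<sigma> (rescaled_clock (r n) (a n) (trap_depth \<beta> H n \<omega>) (J n) (e n) w)"
          "\<forall>s\<in>{0..T}. (\<forall>i\<le>nat \<lfloor>a n * s\<rfloor>. J n i w \<notin> A) \<longleftrightarrow> s < \<sigma>" by blast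
        moreover have "\<forall>i\<le>m. w \<in> U (s i) \<longleftrightarrow> s i < \<sigma>"
          using \<sigma>(2) sT sp by (auto simp: U_def steps_def)
        ultimately show "\<exists>\<sigma>. near_jump \<epsilon> T \<sigma> (rescaled_clock (r n) (a n) (trap_depth \<beta> H n \<omega>) (J n) (e n) w) \<and>
            (\<forall>i\<le>m. w \<in> U (s i) \<longleftrightarrow> s i < \<sigma>)" by blast
      qed (use \<eta> in auto)
      also have "\<dots> \<le> \<xi> / 8 + B * (1 - W.prob (U \<delta>) + W.prob (U L)) + C * err n"
        unfolding C_def[symmetric] using PG C by (intro add_left_mono mult_left_mono) auto
      finally show ?case unfolding PU \<Psi>n_def .
    qed
    have "(\<lambda>n. \<xi> / 8 + B * (1 - avoid_prob \<delta> n \<omega> + avoid_prob L n \<omega>) + C * err n) \<longlonglongrightarrow>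
        \<xi> / 8 + B * (1 - exp (- \<delta>) + exp (- L)) + C * 0"
      using av[of 0] av[of m] s(1,2) by (intro tendsto_intros err) auto
    then have "eventually (\<lambda>n. \<xi> / 8 + B * (1 - avoid_prob \<delta> n \<omega> + avoid_prob L n \<omega>) + C * err n < \<xi> / 4) sequentially"
      by (rule order_tendstoD(2)) (use tail in linarith)
    moreover have "eventually (\<lambda>n. \<bar>\<Psi>n n - \<Psi>\<bar> < \<xi> / 8) sequentially"
      using tendstoD[OF \<Psi>n \<eta>] by (simp add: dist_real_def)
    ultimately have "eventually (\<lambda>n. norm (I n - ?I0) < \<xi>) sequentially"
      using est
    proof eventually_elim
      case (elim n)
      have "\<bar>I n - ?I0\<bar> \<le> \<bar>I n - \<Psi>n n\<bar> + \<bar>\<Psi>n n - \<Psi>\<bar> + \<bar>?I0 - \<Psi>\<bar>" by linarith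
      then show ?case using elim lim tail \<xi> unfolding real_norm_def by linarith
    qed
    then show "\<exists>n0. \<forall>n\<ge>n0. norm (I n - ?I0) < \<xi>" by (simp add: eventually_sequentially)
  qed
  then show "(\<lambda>n. \<integral>y. f y \<partial>distr (D n) (borel_of_top skorohod_J1)
            (rescaled_clock (r n) (a n) (trap_depth \<beta> H n \<omega>) (J n) (e n))) \<longlonglongrightarrow> ?I0"
    unfolding I_def .
qed

end

theorem proposition1p4:
  fixes \<beta> :: real
    and P :: "'w measure"
    and H :: "nat \<Rightarrow> (nat \<Rightarrow> int) \<Rightarrow> 'w \<Rightarrow> real"
    and r a b c :: "nat \<Rightarrow> real"
    and \<mu> :: "nat \<Rightarrow> (nat \<Rightarrow> int) \<Rightarrow> real"
    and D :: "nat \<Rightarrow> 's measure"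
    and J :: "nat \<Rightarrow> nat \<Rightarrow> 's \<Rightarrow> (nat \<Rightarrow> int)"
    and e :: "nat \<Rightarrow> nat \<Rightarrow> 's \<Rightarrow> real"
    and N :: "'t measure"
    and S_short :: "'t \<Rightarrow> real \<Rightarrow> ennreal"
  assumes beta: "0 < \<beta>"
    and landscape: "gaussian_landscape P H"
    and dynamics: "\<And>n. n \<ge> 1 \<Longrightarrow> hopping_dynamics n (\<mu> n) (D n) (J n) (e n)"
    and initial: "\<mu> = hypercube_uniform"
    and r_pos: "\<And>n. n \<ge> 1 \<Longrightarrow> 0 < r n"
    and b: "\<And>n x. n \<ge> 1 \<Longrightarrow> x \<in> hypercube n \<Longrightarrow>
              b n * measure P {\<omega> \<in> space P. trap_depth \<beta> H n \<omega> x \<ge> r n} = 1"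
    and time_scale: "c = r"
    and aux_scale: "(\<lambda>n. a n / b n) \<longlonglongrightarrow> 1"
    and short: "short_space_scale r b"
    and r_lower: "\<And>n. n \<ge> 1 \<Longrightarrow>
              1 / (\<beta> * real n) * ln (r n) \<ge> 4 * sqrt (ln (real n) / real n)"
    and S_short: "subordinator_of_levy_measure nu_short N S_short"
  shows "AE \<omega> in P. weak_conv_top skorohod_J1
           (\<lambda>n. distr (D n) (borel_of_top skorohod_J1)
                  (rescaled_clock (c n) (a n) (trap_depth \<beta> H n \<omega>) (J n) (e n)))
           (distr N (borel_of_top skorohod_J1) S_short)"
proof -
  interpret prob_space P using landscape by (simp add: gaussian_landscape_def)
  have gauss: "distributed P lborel (H n x) std_normal_density" if "n \<ge> 1" "x \<in> hypercube n" for n x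
    using landscape that by (simp add: gaussian_landscape_def)
  interpret short_scale \<beta> r b
  proof
    fix n :: nat assume n: "n \<ge> 1"
    have s: "\<beta> * sqrt (real n) > 0" using beta n by simp
    obtain x where x: "x \<in> hypercube n" using card_hypercube[of n] by fastforce
    have "trap_depth \<beta> H n \<omega> x \<ge> r n \<longleftrightarrow> H n x \<omega> \<le> - (ln (r n) / (\<beta> * sqrt (real n)))" for \<omega>
    proof -
      have "trap_depth \<beta> H n \<omega> x \<ge> r n \<longleftrightarrow> ln (r n) \<le> (\<beta> * sqrt (real n)) * (- H n x \<omega>)"
        unfolding trap_depth_def using ln_le_cancel_iff[of "r n" "exp (- \<beta> * sqrt (real n) * H n x \<omega>)"] r_pos[OF n] by simp
      also have "\<dots> \<longleftrightarrow> ln (r n) / (\<beta> * sqrt (real n)) \<le> - H n x \<omega>"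
        using s by (simp only: pos_divide_le_eq mult.commute)
      finally show ?thesis by linarith
    qed
    then show "b n * gauss_tail (ln (r n) / (\<beta> * sqrt (real n))) = 1"
      using b[OF n x] prob_std_normal_le[OF gauss[OF n x]] by simp
    have "4 * sqrt (ln (real n)) = sqrt (real n) * (4 * sqrt (ln (real n) / real n))"
      using n by (simp add: real_sqrt_divide)
    also have "\<dots> \<le> sqrt (real n) * (1 / (\<beta> * real n) * ln (r n))"
      using r_lower[OF n] by (intro mult_left_mono) auto
    also have "\<dots> = ln (r n) / (\<beta> * sqrt (real n))"
      using n beta by (simp add: field_simps)
    finally show "4 * sqrt (ln (real n)) \<le> ln (r n) / (\<beta> * sqrt (real n))" .
  next
    have ln2: "ln (2 :: real) > 0" by simp
    have "filterlim (\<lambda>n. ln 2 * (ln (b n) / ln 2)) at_top sequentially"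
      using short ln2 by (intro filterlim_tendsto_pos_mult_at_top[OF tendsto_const]) (auto simp: short_space_scale_def)
    then show "filterlim (\<lambda>n. ln (b n)) at_top sequentially" by simp
    have "(\<lambda>n. ln 2 * ((ln (b n) / ln 2) / real n)) \<longlonglongrightarrow> ln 2 * 0"
      using short by (intro tendsto_mult tendsto_const) (simp add: short_space_scale_def)
    then show "(\<lambda>n. ln (b n) / real n) \<longlonglongrightarrow> 0" by simp
  qed (use beta r_pos in auto)
  have hop: "hopping (D n) n (J n) (e n)" if n: "n \<ge> 1" for n
  proof -
    have d: "hopping_dynamics n (hypercube_uniform n) (D n) (J n) (e n)"
      using dynamics[OF n] initial by simp
    interpret D: prob_space "D n" using d by (simp add: hopping_dynamics_def)
    show ?thesis by unfold_locales (use d n in \<open>auto simp: hopping_dynamics_def\<close>)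
  qed
  interpret quenched \<beta> r b P H a D J
  proof (intro quenched.intro quenched_axioms.intro)
    show "short_scale \<beta> r b" by unfold_locales
    show "prob_space P" by unfold_locales
    show "indep_vars (\<lambda>_. borel) (H n) (hypercube n)" if "n \<ge> 1" for n
      using landscape that by (simp add: gaussian_landscape_def)
    show "hypercube_walk (D n) n (J n)" if "n \<ge> 1" for n
      using hop[OF that] by (simp add: hopping_def)
  qed (use gauss aux_scale in auto)
  have "AE \<omega> in P. \<forall>t\<in>\<rat> \<inter> {0..}. (\<lambda>n. avoid_prob t n \<omega>) \<longlonglongrightarrow> exp (- t)"
    using AE_avoid_prob by (subst AE_ball_countable) (auto intro: countable_rat)
  then show ?thesis
    using AE_shallow_mean
  proof eventually_elim
    case (elim \<omega>)
    show ?case unfolding time_scale by (rule weak_convergence_quenched[OF hop S_short]) (use elim in auto)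
  qed
qed

end
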